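(* Let $r\ge1$ and $m\ge1$ be integers, let $\mathbf U=\mathbf U_q(\mathfrak{sl}_{2r+1})\otimes_{\mathbb Q(q)}\mathbb Q(p,q)$, let $\mathbf U^{\jmath}\subset\mathbf U$ be the coideal subalgebra defined in the context, let $\mathbb V$ be the natural representation of $\mathbf U$, and let $\mathcal H_m$ be the two-parameter Hecke algebra of type $B_m$. The left action $\Phi$ of $\mathbf U^{\jmath}$ and the right action $\Psi$ of $\mathcal H_m$ on $\mathbb V^{\otimes m}$ commute and form double centralizers; that is, $$\Phi(\mathbf U^{\jmath})=\operatorname{End}_{\mathcal H_m}(\mathbb V^{\otimes m}),\qquad \operatorname{End}_{\mathbf U^{\jmath}}(\mathbb V^{\otimes m})^{\mathrm{op}}=\Psi(\mathcal H_m).$$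
   Context: $p,q$ are independent indeterminates; everything is over $\mathbb Q(p,q)$. Quantum group. Let $\mathbb I=\{-r+\frac12,-r+\frac32,\dots,r-\frac12\}$, $\mathbb I^{\jmath}=\{\frac12,\frac32,\dots,r-\frac12\}$, $\alpha_i=\varepsilon_{i-\frac12}-\varepsilon_{i+\frac12}$ for $i\in\mathbb I$ (simple roots of type $A_{2r}$), where the $\varepsilon_a$ ($-r\le a\le r$) are orthonormal for $(\cdot,\cdot)$. $\mathbf U$ is generated by $E_i,F_i,K_i^{\pm1}$ ($i\in\mathbb I$) with the standard relations: the $K_i$ commute, $K_iE_jK_i^{-1}=q^{(\alpha_i,\alpha_j)}E_j$, $K_iF_jK_i^{-1}=q^{-(\alpha_i,\alpha_j)}F_j$, $E_iF_j-F_jE_i=\delta_{ij}\frac{K_i-K_i^{-1}}{q-q^{-1}}$, and the quantum Serre relations. The comultiplication is $\Delta(E_i)=1\otimes E_i+E_i\otimes K_i^{-1}$, $\Delta(F_i)=F_i\otimes1+K_i\otimes F_i$, $\Delta(K_i)=K_i\otimes K_i$. Coideal subalgebra. $\mathbf U^{\jmath}$ is the $\mathbb Q(p,q)$-subalgebra of $\mathbf U$ generated by $k_i^{\pm1}$ with $k_i=K_iK_{-i}^{-1}$ ($i\in\mathbb I^{\jmath}$), $e_i=E_i+F_{-i}K_i^{-1}$ and $f_i=E_{-i}+K_{-i}^{-1}F_i$ ($i\in\mathbb I^{\jmath}$, $i\ne\frac12$), and $e_{\frac12}=E_{\frac12}+p^{-1}F_{-\frac12}K_{\frac12}^{-1}$,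 $f_{\frac12}=E_{-\frac12}+pK_{-\frac12}^{-1}F_{\frac12}$. Natural representation. Let $I=\{-r,-r+1,\dots,r\}$. $\mathbb V=\bigoplus_{a\in I}\mathbb Q(p,q)u_a$ with $E_iu_{i+\frac12}=u_{i-\frac12}$, $F_iu_{i-\frac12}=u_{i+\frac12}$, all other $E_iu_a,F_iu_a$ zero, $K_iu_a=q^{(\alpha_i,\varepsilon_a)}u_a$. $\mathbb V^{\otimes m}$ is a $\mathbf U$-module via iterated $\Delta$, hence a $\mathbf U^{\jmath}$-module by restriction; $\Phi:\mathbf U^{\jmath}\to\operatorname{End}(\mathbb V^{\otimes m})$ denotes this action. Hecke algebra. $\mathcal H_m$ is the $\mathbb Q(p,q)$-algebra generated by $H_0,H_1,\dots,H_{m-1}$ with relations, where $q_0=p$ and $q_i=q$ for $i\ge1$: $(H_i-q_i^{-1})(H_i+q_i)=0$ for $i\ge0$; $H_iH_{i+1}H_i=H_{i+1}H_iH_{i+1}$ for $i\ge1$; $H_0H_1H_0H_1=H_1H_0H_1H_0$; $H_iH_j=H_jH_i$ for $|i-j|>1$. Action of $\mathcal H_m$. For $f=(f(1),\dots,f(m))\in I^m$ put $M_f=u_{f(1)}\otimes\cdots\otimes u_{f(m)}$. The Weyl group $W_{B_m}=\langle s_0,\dots,s_{m-1}\rangle$ acts on the right on $I^m$: for $j\ge1$, $f\cdot s_j$ swaps the entries $f(j),f(j+1)$, and $f\cdot s_0$ replaces $f(1)$ by $-f(1)$. The right action $\Psi$ of $\mathcal H_m$ on $\mathbb V^{\otimes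 m}$ is: for $i\ge1$, $M_fH_i=q^{-1}M_f$ if $f(i)=f(i+1)$; $M_fH_i=M_{f\cdot s_i}$ if $f(i)<f(i+1)$; $M_fH_i=M_{f\cdot s_i}+(q^{-1}-q)M_f$ if $f(i)>f(i+1)$; and $M_fH_0=p^{-1}M_f$ if $f(1)=0$; $M_fH_0=M_{f\cdot s_0}$ if $f(1)>0$; $M_fH_0=M_{f\cdot s_0}+(p^{-1}-p)M_f$ if $f(1)<0$. *)

theory Defs
  imports
    "HOL-Library.Poly_Mapping"
    "HOL-Library.FuncSet"
    "HOL-Computational_Algebra.Polynomial"
    "HOL-Computational_Algebra.Fraction_Field"
    "HOL-Algebra.QuotRing"
    "HOL-Algebra.Generated_Rings"
begin

section \<open>The ground field\<close>

text \<open>\<open>\<rat>(p,q)\<close> is the fraction field of \<open>\<rat>[p][q]\<close>.\<close>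

type_synonym Qpq = "rat poly poly fract"

definition pvar :: Qpq where "pvar = Fract [:[:0, 1:]:] 1"
definition qvar :: Qpq where "qvar = Fract [:0, 1:] 1"


section \<open>Algebras given by generators and relations\<close>

text \<open>The free algebra on a set of letters is the monoid algebra of the free monoid. Words are a
  copy of lists, made into a monoid under concatenation, so that the convolution product of
  \<^theory>\<open>HOL-Library.Poly_Mapping\<close> is the product of noncommutative polynomials.\<close>

datatype 'g word = Word (letters: "'g list")

instantiation word :: (type) monoid_add
begin
definition zero_word :: "'a word" where "0 = Word []"
definition plus_word :: "'a word \<Rightarrow> 'a word \<Rightarrow> 'a word" where
  "x + y = Word (letters x @ letters y)"
instance by standard (simp_all add: zero_word_def plus_word_def)
end

type_synonym 'g ncpoly = "'g word \<Rightarrow>\<^sub>0 Qpq"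

definition gen :: "'g \<Rightarrow> 'g ncpoly" where
  "gen g = Poly_Mapping.single (Word [g]) 1"

definition const :: "Qpq \<Rightarrow> 'g ncpoly" where
  "const c = Poly_Mapping.single 0 c"

definition free_alg :: "'g set \<Rightarrow> 'g ncpoly ring" where
  "free_alg X = \<lparr>carrier = {a. \<forall>w \<in> Poly_Mapping.keys a. set (letters w) \<subseteq> X},
     mult = (*), one = 1, zero = 0, add = (+)\<rparr>"

text \<open>\<open>Idl\<close> is the two-sided ideal generated by a set. A relation \<open>l = r\<close> is encoded as \<open>l - r\<close>.\<close>

definition presented_alg :: "'g set \<Rightarrow> 'g ncpoly set \<Rightarrow> 'g ncpoly set ring" where
  "presented_alg X R = free_alg X Quot (Idl\<^bsub>free_alg X\<^esub> R)"

definition cls :: "'g set \<Rightarrow> 'g ncpoly set \<Rightarrow> 'g ncpoly \<Rightarrow> 'g ncpoly set" where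
  "cls X R a = (Idl\<^bsub>free_alg X\<^esub> R) +>\<^bsub>free_alg X\<^esub> a"

definition opposite :: "('a, 'b) ring_scheme \<Rightarrow> ('a, 'b) ring_scheme" where
  "opposite R = R\<lparr>mult := (\<lambda>x y. y \<otimes>\<^bsub>R\<^esub> x)\<rparr>"

lemma free_alg_ring: "ring (free_alg X)"
proof -
  have simps: "x \<oplus>\<^bsub>free_alg X\<^esub> y = x + y" "x \<otimes>\<^bsub>free_alg X\<^esub> y = x * y"
    "\<zero>\<^bsub>free_alg X\<^esub> = 0" "\<one>\<^bsub>free_alg X\<^esub> = 1" for x y
    by (simp_all add: free_alg_def)
  have add: "x + y \<in> carrier (free_alg X)"
    if "x \<in> carrier (free_alg X)" "y \<in> carrier (free_alg X)" for x y
    using that Poly_Mapping.keys_add[of x y] by (auto simp: free_alg_def)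
  have neg: "- x \<in> carrier (free_alg X)" if "x \<in> carrier (free_alg X)" for x
    using that by (simp add: free_alg_def)
  have zero: "0 \<in> carrier (free_alg X)" and one: "1 \<in> carrier (free_alg X)"
    by (simp_all add: free_alg_def zero_word_def)
  have mul: "x * y \<in> carrier (free_alg X)"
    if "x \<in> carrier (free_alg X)" "y \<in> carrier (free_alg X)" for x y
  proof -
    have "set (letters w) \<subseteq> X" if w: "w \<in> Poly_Mapping.keys (x * y)" for w
    proof -
      obtain a b where "w = a + b" "a \<in> Poly_Mapping.keys x" "b \<in> Poly_Mapping.keys y"
        using w Poly_Mapping.keys_mult[of x y] by blast
      then show ?thesis
        using \<open>x \<in> _\<close> \<open>y \<in> _\<close> by (simp add: free_alg_def plus_word_def)
    qed
    then show ?thesis by (simp add: free_alg_def)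
  qed
  have "\<exists>y\<in>carrier (free_alg X). y + x = 0" if "x \<in> carrier (free_alg X)" for x
    using neg[OF that] by (intro bexI[of _ "- x"]) simp_all
  then have ab: "abelian_group (free_alg X)"
    by (intro abelian_groupI) (simp_all add: simps add zero add.assoc add.commute)
  have "monoid (free_alg X)"
    by (intro monoidI) (simp_all add: simps mul one mult.assoc)
  with ab show ?thesis
    by (intro ringI) (simp_all add: simps distrib_left distrib_right)
qed


section \<open>The quantum group\<close>

text \<open>Both the integral indices \<open>a \<in> I\<close> and the half-integral indices \<open>i\<close> of the simple roots are
  rational numbers.\<close>

definition idx :: "nat \<Rightarrow> rat set" where
  "idx r = {of_int k | k. - int r \<le> k \<and> k \<le> int r}"

definition roots :: "nat \<Rightarrow> rat set" where
  "roots r = {of_int k - 1/2 | k. 1 - int r \<le> k \<and> k \<le> int r}"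

definition pos_roots :: "nat \<Rightarrow> rat set" where
  "pos_roots r = {of_int k - 1/2 | k. 1 \<le> k \<and> k \<le> int r}"

text \<open>Weights are given by their coordinates in the orthonormal basis \<open>\<epsilon>\<^sub>a\<close>, \<open>a \<in> I\<close>.\<close>

definition eps :: "rat \<Rightarrow> rat \<Rightarrow> int" where
  "eps a = (\<lambda>b. of_bool (a = b))"

definition alpha :: "rat \<Rightarrow> rat \<Rightarrow> int" where
  "alpha i = (\<lambda>b. eps (i - 1/2) b - eps (i + 1/2) b)"

definition form :: "nat \<Rightarrow> (rat \<Rightarrow> int) \<Rightarrow> (rat \<Rightarrow> int) \<Rightarrow> int" where
  "form r x y = (\<Sum>b\<in>idx r. x b * y b)"

datatype ugen = Eg rat | Fg rat | Kg rat | Kinvg rat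

definition U_gens :: "nat \<Rightarrow> ugen set" where
  "U_gens r = Eg ` roots r \<union> Fg ` roots r \<union> Kg ` roots r \<union> Kinvg ` roots r"

definition serre :: "'g \<Rightarrow> 'g \<Rightarrow> 'g ncpoly" where
  "serre x y = gen x * gen x * gen y - const (qvar + inverse qvar) * gen x * gen y * gen x
     + gen y * gen x * gen x"

definition U_rels :: "nat \<Rightarrow> ugen ncpoly set" where
  "U_rels r =
     {gen (Kg i) * gen (Kinvg i) - 1 | i. i \<in> roots r}
   \<union> {gen (Kinvg i) * gen (Kg i) - 1 | i. i \<in> roots r}
   \<union> {gen (Kg i) * gen (Kg j) - gen (Kg j) * gen (Kg i) | i j. i \<in> roots r \<and> j \<in> roots r}
   \<union> {gen (Kg i) * gen (Eg j) * gen (Kinvg i)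
        - const (qvar powi form r (alpha i) (alpha j)) * gen (Eg j)
        | i j. i \<in> roots r \<and> j \<in> roots r}
   \<union> {gen (Kg i) * gen (Fg j) * gen (Kinvg i)
        - const (qvar powi (- form r (alpha i) (alpha j))) * gen (Fg j)
        | i j. i \<in> roots r \<and> j \<in> roots r}
   \<union> {gen (Eg i) * gen (Fg j) - gen (Fg j) * gen (Eg i)
        - (if i = j then const (inverse (qvar - inverse qvar)) * (gen (Kg i) - gen (Kinvg i)) else 0)
        | i j. i \<in> roots r \<and> j \<in> roots r}
   \<union> {gen (Eg i) * gen (Eg j) - gen (Eg j) * gen (Eg i)
        | i j. i \<in> roots r \<and> j \<in> roots r \<and> \<bar>i - j\<bar> > 1}
   \<union> {gen (Fg i) * gen (Fg j) - gen (Fg j) * gen (Fg i)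
        | i j. i \<in> roots r \<and> j \<in> roots r \<and> \<bar>i - j\<bar> > 1}
   \<union> {serre (Eg i) (Eg j) | i j. i \<in> roots r \<and> j \<in> roots r \<and> \<bar>i - j\<bar> = 1}
   \<union> {serre (Fg i) (Fg j) | i j. i \<in> roots r \<and> j \<in> roots r \<and> \<bar>i - j\<bar> = 1}"

definition U_alg :: "nat \<Rightarrow> ugen ncpoly set ring" where
  "U_alg r = presented_alg (U_gens r) (U_rels r)"

abbreviation U_cls :: "nat \<Rightarrow> ugen ncpoly \<Rightarrow> ugen ncpoly set" where
  "U_cls r \<equiv> cls (U_gens r) (U_rels r)"


section \<open>The coideal subalgebra\<close>

definition e_jmath :: "rat \<Rightarrow> ugen ncpoly" where
  "e_jmath i = (if i = 1/2
     then gen (Eg i) + const (inverse pvar) * gen (Fg (- i)) * gen (Kinvg i)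
     else gen (Eg i) + gen (Fg (- i)) * gen (Kinvg i))"

definition f_jmath :: "rat \<Rightarrow> ugen ncpoly" where
  "f_jmath i = (if i = 1/2
     then gen (Eg (- i)) + const pvar * gen (Kinvg (- i)) * gen (Fg i)
     else gen (Eg (- i)) + gen (Kinvg (- i)) * gen (Fg i))"

definition k_jmath :: "rat \<Rightarrow> ugen ncpoly" where
  "k_jmath i = gen (Kg i) * gen (Kinvg (- i))"

definition kinv_jmath :: "rat \<Rightarrow> ugen ncpoly" where
  "kinv_jmath i = gen (Kg (- i)) * gen (Kinvg i)"

text \<open>The scalars are added to the generators of the subring to get a \<open>\<rat>(p,q)\<close>-subalgebra.\<close>

definition U_jmath :: "nat \<Rightarrow> ugen ncpoly set set" where
  "U_jmath r = generate_ring (U_alg r)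
     (U_cls r ` (range const \<union> e_jmath ` pos_roots r \<union> f_jmath ` pos_roots r
        \<union> k_jmath ` pos_roots r \<union> kinv_jmath ` pos_roots r))"


section \<open>Tensor space\<close>

text \<open>The free vector space on \<open>'a\<close> is \<open>'a \<Rightarrow>\<^sub>0 Qpq\<close>. The tensor power \<open>V\<^sup>\<otimes>\<^sup>m\<close> is the subspace of the
  free vector space on \<open>rat list\<close> with basis the \<open>M f\<close>, where \<open>f\<close> is a word of length \<open>m\<close> over \<open>I\<close>
  and \<open>M [f\<^sub>1, \<dots>, f\<^sub>m]\<close> stands for the tensor product of \<open>u f\<^sub>1, \<dots>, u f\<^sub>m\<close>. List positions count
  from 0, so \<open>f(i)\<close> is \<open>f ! (i - 1)\<close>.\<close>

type_synonym tvec = "rat list \<Rightarrow>\<^sub>0 Qpq"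

definition u :: "rat \<Rightarrow> (rat \<Rightarrow>\<^sub>0 Qpq)" where
  "u a = Poly_Mapping.single a 1"

definition M :: "rat list \<Rightarrow> tvec" where
  "M f = Poly_Mapping.single f 1"

definition tensor_space :: "nat \<Rightarrow> nat \<Rightarrow> tvec set" where
  "tensor_space r m = {v. \<forall>f \<in> Poly_Mapping.keys v. length f = m \<and> set f \<subseteq> idx r}"

definition scale :: "Qpq \<Rightarrow> ('a \<Rightarrow>\<^sub>0 Qpq) \<Rightarrow> ('a \<Rightarrow>\<^sub>0 Qpq)" where
  "scale c = Poly_Mapping.map ((*) c)"

text \<open>Linear extension of a map given on basis vectors.\<close>

definition lin :: "('a \<Rightarrow> ('b \<Rightarrow>\<^sub>0 Qpq)) \<Rightarrow> ('a \<Rightarrow>\<^sub>0 Qpq) \<Rightarrow> ('b \<Rightarrow>\<^sub>0 Qpq)" where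
  "lin T v = (\<Sum>a\<in>Poly_Mapping.keys v. scale (Poly_Mapping.lookup v a) (T a))"

definition tensor :: "(rat \<Rightarrow>\<^sub>0 Qpq) \<Rightarrow> tvec \<Rightarrow> tvec" where
  "tensor v w = lin (\<lambda>a. lin (\<lambda>f. M (a # f)) w) v"

text \<open>The algebra of linear endomorphisms; these are extensional functions on the tensor space, so
  that equality of endomorphisms is equality on the tensor space.\<close>

definition End_alg :: "nat \<Rightarrow> nat \<Rightarrow> (tvec \<Rightarrow> tvec) ring" where
  "End_alg r m =
    \<lparr>carrier = {T \<in> tensor_space r m \<rightarrow>\<^sub>E tensor_space r m.
        (\<forall>v\<in>tensor_space r m. \<forall>w\<in>tensor_space r m. T (v + w) = T v + T w) \<and>
        (\<forall>c. \<forall>v\<in>tensor_space r m. T (scale c v) = scale c (T v))},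
     mult = (\<lambda>S T. \<lambda>v\<in>tensor_space r m. S (T v)),
     one = (\<lambda>v\<in>tensor_space r m. v),
     zero = (\<lambda>v\<in>tensor_space r m. 0),
     add = (\<lambda>S T. \<lambda>v\<in>tensor_space r m. S v + T v)\<rparr>"

text \<open>Endomorphisms commuting with the operators \<open>\<rho> x\<close>, \<open>x \<in> A\<close>.\<close>

definition End_over :: "nat \<Rightarrow> nat \<Rightarrow> ('x \<Rightarrow> tvec \<Rightarrow> tvec) \<Rightarrow> 'x set \<Rightarrow> (tvec \<Rightarrow> tvec) ring" where
  "End_over r m \<rho> A = (End_alg r m)
     \<lparr>carrier := {T \<in> carrier (End_alg r m).
        \<forall>x\<in>A. \<forall>v\<in>tensor_space r m. T (\<rho> x v) = \<rho> x (T v)}\<rparr>"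


section \<open>The action of the quantum group\<close>

fun natural_rep :: "nat \<Rightarrow> ugen \<Rightarrow> rat \<Rightarrow> (rat \<Rightarrow>\<^sub>0 Qpq)" where
  "natural_rep r (Eg i) a = (if a = i + 1/2 then u (i - 1/2) else 0)"
| "natural_rep r (Fg i) a = (if a = i - 1/2 then u (i + 1/2) else 0)"
| "natural_rep r (Kg i) a = scale (qvar powi form r (alpha i) (eps a)) (u a)"
| "natural_rep r (Kinvg i) a = scale (qvar powi (- form r (alpha i) (eps a))) (u a)"

text \<open>A list of pairs of words \<open>(x, y)\<close> stands for the sum of the tensors \<open>x \<otimes> y\<close>.\<close>

fun comult :: "ugen \<Rightarrow> (ugen list \<times> ugen list) list" where
  "comult (Eg i) = [([], [Eg i]), ([Eg i], [Kinvg i])]"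
| "comult (Fg i) = [([Fg i], []), ([Kg i], [Fg i])]"
| "comult (Kg i) = [([Kg i], [Kg i])]"
| "comult (Kinvg i) = [([Kinvg i], [Kinvg i])]"

fun counit :: "ugen \<Rightarrow> Qpq" where
  "counit (Eg i) = 0"
| "counit (Fg i) = 0"
| "counit (Kg i) = 1"
| "counit (Kinvg i) = 1"

text \<open>A word \<open>[x\<^sub>1, \<dots>, x\<^sub>n]\<close> acts from the left as the composite of the actions of its letters.\<close>

definition word_act :: "('g \<Rightarrow> 'a \<Rightarrow> ('a \<Rightarrow>\<^sub>0 Qpq)) \<Rightarrow> 'g list \<Rightarrow> ('a \<Rightarrow>\<^sub>0 Qpq) \<Rightarrow> ('a \<Rightarrow>\<^sub>0 Qpq)" where
  "word_act \<phi> x = foldr (\<lambda>g. lin (\<phi> g)) x"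

text \<open>Action of a generator on the basis vector \<open>M f\<close> of the tensor power with \<open>length f\<close> factors,
  through \<open>\<Delta>\<close> applied to \<open>V \<otimes> V\<^sup>\<otimes>\<^sup>n\<close>; the zeroth tensor power is the trivial module, so that
  the first one is the natural representation.\<close>

primrec tensor_rep :: "nat \<Rightarrow> nat \<Rightarrow> ugen \<Rightarrow> rat list \<Rightarrow> tvec" where
  "tensor_rep r 0 = (\<lambda>g f. scale (counit g) (M f))"
| "tensor_rep r (Suc n) = (\<lambda>g f. \<Sum>(x, y)\<leftarrow>comult g.
     tensor (word_act (natural_rep r) x (u (hd f))) (word_act (tensor_rep r n) y (M (tl f))))"

definition Phi_free :: "nat \<Rightarrow> nat \<Rightarrow> ugen ncpoly \<Rightarrow> tvec \<Rightarrow> tvec" where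
  "Phi_free r m a = (\<lambda>v\<in>tensor_space r m.
     \<Sum>w\<in>Poly_Mapping.keys a.
       scale (Poly_Mapping.lookup a w) (word_act (tensor_rep r m) (letters w) v))"

text \<open>An element of the quotient algebra is a coset, and it acts as any of its representatives.\<close>

definition Phi :: "nat \<Rightarrow> nat \<Rightarrow> ugen ncpoly set \<Rightarrow> tvec \<Rightarrow> tvec" where
  "Phi r m X = the_elem (Phi_free r m ` X)"


section \<open>The Hecke algebra of type B and its action\<close>

text \<open>The generator \<open>H\<^sub>i\<close> is the letter \<open>i\<close>.\<close>

definition qpar :: "nat \<Rightarrow> Qpq" where
  "qpar i = (if i = 0 then pvar else qvar)"

definition hecke_rels :: "nat \<Rightarrow> nat ncpoly set" where
  "hecke_rels m =
     {(gen i - const (inverse (qpar i))) * (gen i + const (qpar i)) | i. i < m}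
   \<union> {gen i * gen (i + 1) * gen i - gen (i + 1) * gen i * gen (i + 1) | i. 1 \<le> i \<and> i + 1 < m}
   \<union> (if 1 < m then {gen 0 * gen 1 * gen 0 * gen 1 - gen 1 * gen 0 * gen 1 * gen 0} else {})
   \<union> {gen i * gen j - gen j * gen i | i j. i < m \<and> j < m \<and> \<bar>int i - int j\<bar> > 1}"

definition hecke_alg :: "nat \<Rightarrow> nat ncpoly set ring" where
  "hecke_alg m = presented_alg {..<m} (hecke_rels m)"

definition weyl_act :: "rat list \<Rightarrow> nat \<Rightarrow> rat list" where
  "weyl_act f j = (if j = 0 then f[0 := - f ! 0] else f[j - 1 := f ! j, j := f ! (j - 1)])"

definition hecke_rep :: "nat \<Rightarrow> rat list \<Rightarrow> tvec" where
  "hecke_rep i f =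
    (if i = 0 then
       (if f ! 0 = 0 then scale (inverse pvar) (M f)
        else if f ! 0 > 0 then M (weyl_act f 0)
        else M (weyl_act f 0) + scale (inverse pvar - pvar) (M f))
     else
       (if f ! (i - 1) = f ! i then scale (inverse qvar) (M f)
        else if f ! (i - 1) < f ! i then M (weyl_act f i)
        else M (weyl_act f i) + scale (inverse qvar - qvar) (M f)))"

text \<open>This is a right action: in a word, the first letter acts first.\<close>

definition Psi_free :: "nat \<Rightarrow> nat \<Rightarrow> nat ncpoly \<Rightarrow> tvec \<Rightarrow> tvec" where
  "Psi_free r m a = (\<lambda>v\<in>tensor_space r m.
     \<Sum>w\<in>Poly_Mapping.keys a.
       scale (Poly_Mapping.lookup a w) (fold (\<lambda>i. lin (hecke_rep i)) (letters w) v))"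

definition Psi :: "nat \<Rightarrow> nat \<Rightarrow> nat ncpoly set \<Rightarrow> tvec \<Rightarrow> tvec" where
  "Psi r m X = the_elem (Psi_free r m ` X)"

end

theory Submission
  imports Defs "HOL-Library.Product_Lexorder"
begin

text \<open>
  The double centralizer property is reduced to the single statement that every endomorphism
  commuting with \<open>\<H>\<^sub>m\<close> comes from \<open>U\<^sup>\<jmath>\<close>. In the standard basis the \<open>H\<^sub>i\<close> act by symmetric matrices and
  \<open>\<rat>(p,q)\<close> is an ordered field, so the image of \<open>\<H>\<^sub>m\<close> is closed under transposition and equals its
  bicommutant, by von Neumann's orthogonal projection argument.

  An endomorphism commuting with \<open>\<H>\<^sub>m\<close> is determined by its matrix entries at the pairs \<open>(f, g)\<close>
  with \<open>g\<close> dominant and \<open>f\<close> dominant for the stabilizer of \<open>g\<close>, one pair for each orbit of the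
  Weyl group on \<open>I\<^sup>m \<times> I\<^sup>m\<close>. It therefore suffices to find in the image of \<open>U\<^sup>\<jmath>\<close>, for every such pair, a
  matrix that specializes at \<open>p = q = 1\<close> to a nonzero multiple of the indicator matrix of its orbit:
  the resulting square system of entries is then invertible. At \<open>p = q = 1\<close> the image of \<open>U\<^sup>\<jmath>\<close>
  contains the derivations \<open>\<Sum>\<^sub>j 1 \<otimes> \<dots> \<otimes> x \<otimes> \<dots> \<otimes> 1\<close> for \<open>x\<close> in the centralizer of \<open>a \<mapsto> -a\<close> in
  \<open>gl(2r+1)\<close>, and these generate all symmetrized tensors.
\<close>

section \<open>Linear maps on free vector spaces\<close>

text \<open>The specialization is used in one direction only. If a square array over the local ring
  at p = q = 1 becomes invertible at that point, it was invertible before; so matrices found in the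
  limit yield generic elements of the image of \<open>U_jmath\<close> with arbitrary prescribed
  entries. The opposite bound, that these entries determine a commuting matrix, is proved for
  generic parameters in \<open>commuting_eq_0\<close>. Both sides refer to the same pairs of words,
  and this closes the gap between image and commutant. Two features of the coideal generators shape
  the limit. Each \<open>k_jmath i\<close> tends to the identity, so the Cartan part is reached
  through (k - 1)/(q - 1). And the derivations obtained from the generators are all traceless; the
  missing trace is supplied by the scalars, because the identity of V induces the derivation m times
  1. The order on Q(p,q) makes nonzero sums of squares positive, so every space of matrices has an
  orthogonal complement; transposition makes that complement invariant under the Hecke
  algebra.\<close>

abbreviation lookup :: "('a \<Rightarrow>\<^sub>0 'b::zero) \<Rightarrow> 'a \<Rightarrow> 'b" where
  "lookup \<equiv> Poly_Mapping.lookup"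

lemma lookup_scale [simp]: "lookup (scale c v) x = c * lookup v x"
  by (simp add: scale_def Poly_Mapping.map.rep_eq when_def)

lemma scale_add [simp]: "scale c (v + w) = scale c v + scale c w"
  by (rule poly_mapping_eqI) (simp add: lookup_add algebra_simps)

lemma scale_diff [simp]: "scale c (v - w) = scale c v - scale c w"
  by (rule poly_mapping_eqI) (simp add: lookup_minus algebra_simps)

lemma scale_zero [simp]: "scale c 0 = 0" and scale_0 [simp]: "scale 0 v = 0"
  and scale_1 [simp]: "scale 1 v = v"
  and scale_scale [simp]: "scale c (scale d v) = scale (c * d) v"
  by (rule poly_mapping_eqI; simp)+

lemma scale_add_left: "scale (c + d) v = scale c v + scale d v"
  by (rule poly_mapping_eqI) (simp add: lookup_add algebra_simps)

lemma scale_sum: "scale c (sum F S) = (\<Sum>x\<in>S. scale c (F x))"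
  by (induction S rule: infinite_finite_induct) auto

lemma scale_single [simp]: "scale c (Poly_Mapping.single x d) = Poly_Mapping.single x (c * d)"
  by (rule poly_mapping_eqI) (simp add: lookup_single when_def)

lemma keys_scale: "Poly_Mapping.keys (scale c v) \<subseteq> Poly_Mapping.keys v"
  by (auto simp: in_keys_iff)

definition linop :: "(('a \<Rightarrow>\<^sub>0 Qpq) \<Rightarrow> ('b \<Rightarrow>\<^sub>0 Qpq)) \<Rightarrow> bool" where
  "linop F \<longleftrightarrow> (\<forall>v w. F (v + w) = F v + F w) \<and> (\<forall>c v. F (scale c v) = scale c (F v))"

lemma linopI: "(\<And>v w. F (v + w) = F v + F w) \<Longrightarrow> (\<And>c v. F (scale c v) = scale c (F v)) \<Longrightarrow> linop F"
  by (simp add: linop_def)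

lemma linop_add: "linop F \<Longrightarrow> F (v + w) = F v + F w"
  and linop_scale: "linop F \<Longrightarrow> F (scale c v) = scale c (F v)"
  by (simp_all add: linop_def)

lemma linop_0: "linop F \<Longrightarrow> F 0 = 0"
  using linop_scale[of F 0 0] by simp

lemma linop_diff: "linop F \<Longrightarrow> F (v - w) = F v - F w"
  using linop_add[of F "v - w" w] by (simp add: algebra_simps)

lemma linop_sum: "linop F \<Longrightarrow> F (sum g S) = (\<Sum>x\<in>S. F (g x))"
  by (induction S rule: infinite_finite_induct) (auto simp: linop_0 linop_add)

lemmas linop_simps = linop_add linop_scale linop_0 linop_diff linop_sum

lemma linop_id: "linop (\<lambda>v. v)"
  and linop_zero: "linop (\<lambda>v. 0)"
  and linop_plus: "linop F \<Longrightarrow> linop G \<Longrightarrow> linop (\<lambda>v. F v + G v)"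
  and linop_minus: "linop F \<Longrightarrow> linop G \<Longrightarrow> linop (\<lambda>v. F v - G v)"
  and linop_smult: "linop F \<Longrightarrow> linop (\<lambda>v. scale c (F v))"
  and linop_comp: "linop H \<Longrightarrow> linop F \<Longrightarrow> linop (\<lambda>v. H (F v))"
  by (auto simp: linop_def algebra_simps)

lemma linop_if_fun: "linop F \<Longrightarrow> linop G \<Longrightarrow> linop (\<lambda>v. if b then F v else G v)"
  by (cases b) (auto simp: linop_def)

lemmas linop_intros = linop_id linop_zero linop_plus linop_minus linop_smult linop_if_fun

lemma scale_cancel: "scale c v = scale d v \<longleftrightarrow> c = d \<or> v = 0"
proof
  assume eq: "scale c v = scale d v"
  have "c = d" if "v \<noteq> 0"
  proof -
    obtain x where "lookup v x \<noteq> 0" using \<open>v \<noteq> 0\<close> by (metis poly_mapping_eqI lookup_zero)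
    moreover have "c * lookup v x = d * lookup v x"
      using arg_cong[OF eq, of "\<lambda>w. lookup w x"] by simp
    ultimately show ?thesis by simp
  qed
  then show "c = d \<or> v = 0" by blast
qed auto

lemma linop_fun_sum: "(\<And>x. x \<in> S \<Longrightarrow> linop (F x)) \<Longrightarrow> linop (\<lambda>v. \<Sum>x\<in>S. F x v)"
  by (induction S rule: infinite_finite_induct) (auto intro: linop_zero linop_plus)

lemma lin_superset:
  assumes "finite S" "Poly_Mapping.keys v \<subseteq> S"
  shows "lin T v = (\<Sum>a\<in>S. scale (lookup v a) (T a))"
  unfolding lin_def
  by (rule sum.mono_neutral_left) (use assms in \<open>auto simp: in_keys_iff\<close>)

lemma linop_lin [simp]: "linop (lin T)"
proof (rule linopI)
  fix v w :: "'a \<Rightarrow>\<^sub>0 Qpq" and c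
  let ?S = "Poly_Mapping.keys v \<union> Poly_Mapping.keys w"
  have "Poly_Mapping.keys (v + w) \<subseteq> ?S" by (rule Poly_Mapping.keys_add)
  then show "lin T (v + w) = lin T v + lin T w"
    by (subst (1 2 3) lin_superset[of ?S]) (auto simp: lookup_add scale_add_left sum.distrib)
  show "lin T (scale c v) = scale c (lin T v)"
    by (subst (1 2) lin_superset[of ?S]) (use keys_scale[of c v] in \<open>auto simp: scale_sum\<close>)
qed

lemma lin_single [simp]: "lin T (Poly_Mapping.single a c) = scale c (T a)"
  by (subst lin_superset[of "{a}"]) auto

lemma lin_M [simp]: "lin T (M f) = T f"
  by (simp add: M_def)

lemma lookup_M: "lookup (M f) g = of_bool (f = g)"
  by (simp add: M_def lookup_single when_def)

lemma lookup_lin: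
  assumes "finite S" "Poly_Mapping.keys v \<subseteq> S"
  shows "lookup (lin T v) b = (\<Sum>a\<in>S. lookup v a * lookup (T a) b)"
  by (simp add: lin_superset[OF assms] lookup_sum)

lemma linop_eq_lin:
  fixes F :: "('a \<Rightarrow>\<^sub>0 Qpq) \<Rightarrow> ('b \<Rightarrow>\<^sub>0 Qpq)"
  assumes "linop F"
  shows "F v = lin (\<lambda>a. F (Poly_Mapping.single a 1)) v"
proof -
  have "v = lin (\<lambda>a. Poly_Mapping.single a 1) v"
    by (rule poly_mapping_eqI)
      (simp add: lin_def lookup_sum lookup_single when_def in_keys_iff)
  then have "F v = F (lin (\<lambda>a. Poly_Mapping.single a 1) v)" by (rule arg_cong)
  also have "\<dots> = lin (\<lambda>a. F (Poly_Mapping.single a 1)) v"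
    by (simp add: lin_def linop_simps[OF assms] del: scale_single)
  finally show ?thesis .
qed

lemma linop_eqI:
  fixes F G :: "tvec \<Rightarrow> ('b \<Rightarrow>\<^sub>0 Qpq)"
  assumes "linop F" "linop G" "\<And>f. f \<in> Poly_Mapping.keys v \<Longrightarrow> F (M f) = G (M f)"
  shows "F v = G v"
  by (subst linop_eq_lin[OF assms(1)], subst linop_eq_lin[OF assms(2)])
    (use assms(3) in \<open>simp add: lin_def M_def\<close>)

definition tcons :: "rat \<Rightarrow> tvec \<Rightarrow> tvec" where
  "tcons a = lin (\<lambda>f. M (a # f))"

lemma linop_tcons [simp]: "linop (tcons a)"
  by (simp add: tcons_def)

lemma tcons_M: "tcons a (M f) = M (a # f)"
  by (simp add: tcons_def)

lemma tensor_u [simp]: "tensor (u a) w = tcons a w"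
  by (simp add: tensor_def u_def tcons_def)

lemma linop_tensor_left: "linop (\<lambda>v. tensor v w)"
  unfolding tensor_def by simp

lemmas tcons_simps [simp] = linop_simps[OF linop_tcons]

lemma lookup_tcons: "lookup (tcons a w) f = (case f of [] \<Rightarrow> 0 | b # g \<Rightarrow> of_bool (a = b) * lookup w g)"
proof (cases f)
  case Nil
  then show ?thesis by (auto simp: tcons_def lin_def lookup_sum lookup_M)
next
  case (Cons b g)
  then show ?thesis
    by (auto simp: tcons_def lin_def lookup_sum lookup_M in_keys_iff of_bool_def if_distrib
        cong: if_cong)
qed

text \<open>Induction on the tensor length, with \<open>tcons a w\<close> in the role of u_a
  \<otimes> w. Since w stays a vector variable, the recursions of the operators on
  \<open>tcons a w\<close> reduce an operator identity to finitely many coefficient cases.\<close>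

lemma tensor_eqI:
  fixes F G :: "tvec \<Rightarrow> tvec"
  assumes "linop F" "linop G" "F (M []) = G (M [])"
    "\<And>a w. F w = G w \<Longrightarrow> F (tcons a w) = G (tcons a w)"
  shows "F v = G v"
proof (rule linop_eqI[OF assms(1,2)])
  fix f show "F (M f) = G (M f)"
  proof (induction f)
    case (Cons a f)
    from assms(4)[OF this] show ?case by (simp add: tcons_M)
  qed (rule assms(3))
qed

section \<open>The operators of the quantum group\<close>

lemma qvar_nz [simp]: "qvar \<noteq> 0" and pvar_nz [simp]: "pvar \<noteq> 0"
  by (simp_all add: qvar_def pvar_def Zero_fract_def eq_fract)

text \<open>The operators are indexed by the integer \<open>c = i - 1/2\<close> instead of the simple root \<open>i\<close>, so that
  \<open>Eop c\<close> sends \<open>u\<^bsub>c+1\<^esub>\<close> to \<open>u\<^bsub>c\<^esub>\<close>; \<open>Lop\<close> is the inverse of \<open>Kop\<close>.\<close>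

definition cf :: "rat \<Rightarrow> rat \<Rightarrow> int" where
  "cf i a = of_bool (a = i) - of_bool (a = i + 1)"

definition wt :: "rat \<Rightarrow> rat list \<Rightarrow> int" where
  "wt i f = (\<Sum>a\<leftarrow>f. cf i a)"

lemma wt_simps [simp]: "wt i [] = 0" "wt i (a # f) = cf i a + wt i f"
  by (simp_all add: wt_def)

definition Kop :: "rat \<Rightarrow> tvec \<Rightarrow> tvec" where
  "Kop i = lin (\<lambda>f. scale (qvar powi wt i f) (M f))"

definition Lop :: "rat \<Rightarrow> tvec \<Rightarrow> tvec" where
  "Lop i = lin (\<lambda>f. scale (qvar powi (- wt i f)) (M f))"

text \<open>The recursions of E and F are the coproducts 1 \<otimes> E + E \<otimes> K^{-1} and F
  \<otimes> 1 + K \<otimes> F with the first tensor factor split off.\<close>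

primrec Ebas :: "rat \<Rightarrow> rat list \<Rightarrow> tvec" where
  "Ebas i [] = 0"
| "Ebas i (a # f) = tcons a (Ebas i f) + (if a = i + 1 then tcons i (Lop i (M f)) else 0)"

primrec Fbas :: "rat \<Rightarrow> rat list \<Rightarrow> tvec" where
  "Fbas i [] = 0"
| "Fbas i (a # f) = (if a = i then M ((i + 1) # f) else 0)
    + scale (qvar powi cf i a) (tcons a (Fbas i f))"

definition Eop :: "rat \<Rightarrow> tvec \<Rightarrow> tvec" where "Eop i = lin (Ebas i)"
definition Fop :: "rat \<Rightarrow> tvec \<Rightarrow> tvec" where "Fop i = lin (Fbas i)"

lemma linop_ops [simp]: "linop (Kop i)" "linop (Lop i)" "linop (Eop i)" "linop (Fop i)"
  by (simp_all add: Kop_def Lop_def Eop_def Fop_def)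

lemmas op_lin_simps [simp] = linop_ops[THEN linop_add] linop_ops[THEN linop_scale]
  linop_ops[THEN linop_0] linop_ops[THEN linop_diff] linop_ops[THEN linop_sum]

lemmas op_comp = linop_ops[THEN linop_comp] linop_tcons[THEN linop_comp]

lemmas lin_intros = linop_intros op_comp linop_lin linop_tcons linop_ops

lemma Kop_M: "Kop i (M f) = scale (qvar powi wt i f) (M f)"
  and Lop_M: "Lop i (M f) = scale (qvar powi (- wt i f)) (M f)"
  by (simp_all add: Kop_def Lop_def)

lemma Eop_M: "Eop i (M f) = Ebas i f" and Fop_M: "Fop i (M f) = Fbas i f"
  by (simp_all add: Eop_def Fop_def)

lemma op_Nil [simp]: "Kop i (M []) = M []" "Lop i (M []) = M []" "Eop i (M []) = 0" "Fop i (M []) = 0"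
  by (simp_all add: Kop_def Lop_def Eop_def Fop_def)

lemma qpow_simps:
  "qvar powi (m + n) = qvar powi m * qvar powi n"
  "qvar powi (m - n) = qvar powi m * inverse (qvar powi n)"
  "qvar powi (- n) = inverse (qvar powi n)"
  by (simp_all add: power_int_add power_int_diff power_int_minus divide_inverse)

lemma Kop_tcons [simp]: "Kop i (tcons a w) = scale (qvar powi cf i a) (tcons a (Kop i w))"
  by (rule linop_eqI[where v = w])
     (auto intro!: lin_intros simp: tcons_M Kop_M qpow_simps mult_ac)

lemma Lop_tcons [simp]: "Lop i (tcons a w) = scale (qvar powi (- cf i a)) (tcons a (Lop i w))"
  by (rule linop_eqI[where v = w])
     (auto intro!: lin_intros simp: tcons_M Lop_M qpow_simps mult_ac)

lemma Eop_tcons [simp]: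
  "Eop i (tcons a w) = tcons a (Eop i w) + (if a = i + 1 then tcons i (Lop i w) else 0)"
  by (rule linop_eqI[where v = w]) (auto intro!: lin_intros simp: tcons_M Eop_M)

lemma Fop_tcons [simp]:
  "Fop i (tcons a w) = (if a = i then tcons (i + 1) w else 0)
     + scale (qvar powi cf i a) (tcons a (Fop i w))"
  by (rule linop_eqI[where v = w]) (auto intro!: lin_intros simp: tcons_M Fop_M)

text \<open>The pairing of two simple roots, obtained by pairing one of them with both ends of the
  other.\<close>

definition cart :: "rat \<Rightarrow> rat \<Rightarrow> int" where
  "cart i j = cf i j - cf i (j + 1)"

lemma Kop_Lop: "Kop i (Lop i v) = v" and Lop_Kop: "Lop i (Kop i v) = v"
  by (rule tensor_eqI[where v = v]; auto intro!: lin_intros simp: qpow_simps)+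

lemma Kop_Kop: "Kop i (Kop j v) = Kop j (Kop i v)" and Lop_Lop: "Lop i (Lop j v) = Lop j (Lop i v)"
  and Kop_Lop_commute: "Kop i (Lop j v) = Lop j (Kop i v)"
  by (rule tensor_eqI[where v = v]; auto intro!: lin_intros simp: qpow_simps mult_ac)+

lemma Kop_Eop: "Kop i (Eop j v) = scale (qvar powi cart i j) (Eop j (Kop i v))"
  by (rule tensor_eqI[where v = v]; auto intro!: lin_intros
     simp: cart_def Kop_Lop_commute qpow_simps scale_cancel mult_ac)

lemma Lop_Eop: "Lop i (Eop j v) = scale (qvar powi (- cart i j)) (Eop j (Lop i v))"
  by (rule tensor_eqI[where v = v]; auto intro!: lin_intros
     simp: cart_def Lop_Lop qpow_simps scale_cancel mult_ac)

lemma Kop_Fop: "Kop i (Fop j v) = scale (qvar powi (- cart i j)) (Fop j (Kop i v))"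
  by (rule tensor_eqI[where v = v]; auto intro!: lin_intros
     simp: cart_def Kop_Lop_commute qpow_simps scale_cancel mult_ac)

lemma Lop_Fop: "Lop i (Fop j v) = scale (qvar powi cart i j) (Fop j (Lop i v))"
  by (rule tensor_eqI[where v = v]; auto intro!: lin_intros
     simp: cart_def Lop_Lop qpow_simps scale_cancel mult_ac)

lemma qvar_minus_inverse_nz: "qvar - inverse qvar \<noteq> 0"
proof
  assume "qvar - inverse qvar = 0"
  then have "qvar * qvar = 1" by (simp add: field_simps)
  then show False by (simp add: qvar_def One_fract_def eq_fract one_pCons)
qed

lemmas vec_simps = power2_eq_square lookup_add lookup_minus lookup_scale qpow_simps cf_def cart_def

lemma Eop_Fop: "Eop i (Fop j v)
  = Fop j (Eop i v) + (if i = j then scale (inverse (qvar - inverse qvar)) (Kop i v - Lop i v) else 0)"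
proof -
  \<comment> \<open>Keeping D opaque leaves D (q^2 - 1) = q as the one fact about the denominator
    that the coefficient comparison uses.\<close>
  define D where "D = inverse (qvar - inverse qvar)"
  have D: "D * (qvar * (qvar * x)) = qvar * x + D * x" for x
    using qvar_minus_inverse_nz by (simp add: D_def field_simps)
  have "Eop i (Fop j v) = Fop j (Eop i v) + (if i = j then scale D (Kop i v - Lop i v) else 0)"
  proof (rule tensor_eqI[where v = v])
    fix a w
    assume IH: "Eop i (Fop j w) = Fop j (Eop i w) + (if i = j then scale D (Kop i w - Lop i w) else 0)"
    show "Eop i (Fop j (tcons a w)) = Fop j (Eop i (tcons a w))
      + (if i = j then scale D (Kop i (tcons a w) - Lop i (tcons a w)) else 0)"
      by (intro poly_mapping_eqI) (auto simp: IH Lop_Fop D vec_simps field_simps)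
  qed (auto intro!: lin_intros)
  then show ?thesis by (simp add: D_def)
qed

lemma Eop_Eop_far:
  assumes "\<bar>i - j\<bar> > 1"
  shows "Eop i (Eop j v) = Eop j (Eop i v)"
  by (rule tensor_eqI[where v = v]; use assms in \<open>auto intro!: lin_intros
     simp: Lop_Eop Lop_Lop vec_simps\<close>)

lemma Fop_Fop_far:
  assumes "\<bar>i - j\<bar> > 1"
  shows "Fop i (Fop j v) = Fop j (Fop i v)"
  by (rule tensor_eqI[where v = v]; use assms in \<open>auto intro!: lin_intros
     simp: mult_ac vec_simps\<close>)

text \<open>Solved for the word with E_j leftmost, so that the induction hypothesis acts as a
  rewrite rule on the tail.\<close>

lemma Eop_serre:
  assumes "j = i + 1 \<or> j = i - 1"
  shows "Eop j (Eop i (Eop i v)) = scale (qvar + inverse qvar) (Eop i (Eop j (Eop i v))) - Eop i (Eop i (Eop j v))"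
proof (rule tensor_eqI[where v = v])
  fix a w
  assume IH: "Eop j (Eop i (Eop i w)) = scale (qvar + inverse qvar) (Eop i (Eop j (Eop i w))) - Eop i (Eop i (Eop j w))"
  show "Eop j (Eop i (Eop i (tcons a w))) = scale (qvar + inverse qvar) (Eop i (Eop j (Eop i (tcons a w)))) - Eop i (Eop i (Eop j (tcons a w)))"
    using assms
    by (intro poly_mapping_eqI) (auto simp: IH Lop_Eop Lop_Lop vec_simps field_simps)
qed (auto intro!: lin_intros)

lemma Fop_serre:
  assumes "j = i + 1 \<or> j = i - 1"
  shows "Fop j (Fop i (Fop i v)) = scale (qvar + inverse qvar) (Fop i (Fop j (Fop i v))) - Fop i (Fop i (Fop j v))"
proof (rule tensor_eqI[where v = v])
  fix a w
  assume IH: "Fop j (Fop i (Fop i w)) = scale (qvar + inverse qvar) (Fop i (Fop j (Fop i w))) - Fop i (Fop i (Fop j w))"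
  show "Fop j (Fop i (Fop i (tcons a w))) = scale (qvar + inverse qvar) (Fop i (Fop j (Fop i (tcons a w)))) - Fop i (Fop i (Fop j (tcons a w)))"
    using assms
    by (intro poly_mapping_eqI) (auto simp: IH vec_simps field_simps)
qed (auto intro!: lin_intros)

section \<open>Actions of presented algebras\<close>

definition act :: "('g list \<Rightarrow> tvec \<Rightarrow> tvec) \<Rightarrow> 'g ncpoly \<Rightarrow> tvec \<Rightarrow> tvec" where
  "act W a v = (\<Sum>w\<in>Poly_Mapping.keys a. scale (lookup a w) (W (letters w) v))"

lemma act_superset:
  assumes "finite S" "Poly_Mapping.keys a \<subseteq> S"
  shows "act W a v = (\<Sum>w\<in>S. scale (lookup a w) (W (letters w) v))"
  unfolding act_def
  by (rule sum.mono_neutral_left) (use assms in \<open>auto simp: in_keys_iff\<close>)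

lemma act_add: "act W (a + b) v = act W a v + act W b v"
proof -
  let ?S = "Poly_Mapping.keys a \<union> Poly_Mapping.keys b"
  have "Poly_Mapping.keys (a + b) \<subseteq> ?S" by (rule Poly_Mapping.keys_add)
  then show ?thesis
    by (subst (1 2 3) act_superset[of ?S]) (auto simp: lookup_add scale_add_left sum.distrib)
qed

lemma act_0 [simp]: "act W 0 v = 0"
  by (simp add: act_def)

lemma act_uminus: "act W (- a) v = - act W a v"
  using act_add[of W a "- a" v] by (simp add: eq_neg_iff_add_eq_0 add.commute)

lemma act_diff: "act W (a - b) v = act W a v - act W b v"
  using act_add[of W "a - b" b v] by (simp add: algebra_simps)

lemma act_sum: "act W (sum g S) v = (\<Sum>x\<in>S. act W (g x) v)"
  by (induction S rule: infinite_finite_induct) (auto simp: act_add)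

lemma act_single [simp]: "act W (Poly_Mapping.single w c) v = scale c (W (letters w) v)"
  by (subst act_superset[of "{w}"]) auto

lemma act_gen [simp]: "act W (gen g) v = W [g] v"
  by (simp add: gen_def)

lemma poly_mapping_sum_single:
  "a = (\<Sum>w\<in>Poly_Mapping.keys a. Poly_Mapping.single w (lookup a w))"
  by (rule poly_mapping_eqI) (simp add: lookup_sum lookup_single when_def in_keys_iff)

lemma tensor_space_closed:
  "0 \<in> tensor_space r m"
  "v \<in> tensor_space r m \<Longrightarrow> w \<in> tensor_space r m \<Longrightarrow> v + w \<in> tensor_space r m"
  "v \<in> tensor_space r m \<Longrightarrow> scale c v \<in> tensor_space r m"
  "(\<And>x. x \<in> S \<Longrightarrow> F x \<in> tensor_space r m) \<Longrightarrow> sum F S \<in> tensor_space r m"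
proof -
  show *: "0 \<in> tensor_space r m"
    "v \<in> tensor_space r m \<Longrightarrow> w \<in> tensor_space r m \<Longrightarrow> v + w \<in> tensor_space r m" for v w
    using Poly_Mapping.keys_add[of v w] by (auto simp: tensor_space_def)
  show "v \<in> tensor_space r m \<Longrightarrow> scale c v \<in> tensor_space r m"
    using keys_scale[of c v] by (auto simp: tensor_space_def)
  show "(\<And>x. x \<in> S \<Longrightarrow> F x \<in> tensor_space r m) \<Longrightarrow> sum F S \<in> tensor_space r m"
    by (induction S rule: infinite_finite_induct) (auto simp: *)
qed

lemma free_alg_closed:
  "1 \<in> carrier (free_alg X)" "const c \<in> carrier (free_alg X)"
  "g \<in> X \<Longrightarrow> gen g \<in> carrier (free_alg X)"
  "a \<in> carrier (free_alg X) \<Longrightarrow> b \<in> carrier (free_alg X) \<Longrightarrow> a + b \<in> carrier (free_alg X)"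
  "a \<in> carrier (free_alg X) \<Longrightarrow> b \<in> carrier (free_alg X) \<Longrightarrow> a * b \<in> carrier (free_alg X)"
proof -
  interpret F: ring "free_alg X" by (rule free_alg_ring)
  have ops: "x \<oplus>\<^bsub>free_alg X\<^esub> y = x + y" "x \<otimes>\<^bsub>free_alg X\<^esub> y = x * y"
    "\<one>\<^bsub>free_alg X\<^esub> = 1" for x y
    by (simp_all add: free_alg_def)
  show "1 \<in> carrier (free_alg X)" using F.one_closed by (simp add: ops)
  show "const c \<in> carrier (free_alg X)" "g \<in> X \<Longrightarrow> gen g \<in> carrier (free_alg X)"
    by (auto simp: const_def gen_def free_alg_def zero_word_def)
  show "a + b \<in> carrier (free_alg X)" "a * b \<in> carrier (free_alg X)"
    if "a \<in> carrier (free_alg X)" "b \<in> carrier (free_alg X)"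
    using F.a_closed[OF that] F.m_closed[OF that] by (simp_all add: ops)
qed

text \<open>The flag \<open>flip\<close> distinguishes right actions from left ones.\<close>

locale word_operators =
  fixes W :: "'g list \<Rightarrow> tvec \<Rightarrow> tvec" and flip :: bool
  assumes linop_W: "linop (W x)"
    and W_Nil: "W [] v = v"
    and W_append: "W (x @ y) v = (if flip then W y (W x v) else W x (W y v))"
begin

lemma linop_act: "linop (act W a)"
  unfolding act_def[abs_def] by (intro linop_fun_sum linop_smult linop_W)

lemma act_one [simp]: "act W 1 v = v"
  by (simp add: W_Nil zero_word_def flip: single_one)

lemma act_const: "act W (const c) v = scale c v"
  by (simp add: const_def W_Nil zero_word_def)

lemma act_mult: "act W (a * b) v = (if flip then act W b (act W a v) else act W a (act W b v))"
proof -
  let ?s = "Poly_Mapping.single"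
  have *: "act W (?s x c * ?s y d) v
      = (if flip then act W (?s y d) (act W (?s x c) v) else act W (?s x c) (act W (?s y d) v))"
    for x y c d
    by (simp add: mult_single plus_word_def W_append linop_scale[OF linop_W] mult.commute)
  have "act W (a * b) v = act W ((\<Sum>x\<in>Poly_Mapping.keys a. ?s x (lookup a x)) *
      (\<Sum>y\<in>Poly_Mapping.keys b. ?s y (lookup b y))) v"
    by (simp flip: poly_mapping_sum_single)
  also have "\<dots> = (\<Sum>x\<in>Poly_Mapping.keys a. \<Sum>y\<in>Poly_Mapping.keys b.
      act W (?s x (lookup a x) * ?s y (lookup b y)) v)"
    by (simp only: sum_distrib_left sum_distrib_right act_sum)
       (rule sum.swap)
  also have "\<dots> = (if flip
      then act W (\<Sum>y\<in>Poly_Mapping.keys b. ?s y (lookup b y)) (act W (\<Sum>x\<in>Poly_Mapping.keys a. ?s x (lookup a x)) v)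
      else act W (\<Sum>x\<in>Poly_Mapping.keys a. ?s x (lookup a x)) (act W (\<Sum>y\<in>Poly_Mapping.keys b. ?s y (lookup b y)) v))"
    unfolding * by (simp only: act_sum linop_sum[OF linop_act] split: if_splits)
       (auto intro: sum.swap)
  finally show ?thesis by (simp flip: poly_mapping_sum_single)
qed

end

text \<open>Relations are required on the tensor power only, since the Hecke operators satisfy
  theirs on words of length m. \<open>rep\<close> is tied to \<open>act\<close> on polynomials in
  the letters X only, because the explicit operators are compared with the coproduct action on those
  letters.\<close>

locale presented_action = word_operators W flip
  for W :: "'g list \<Rightarrow> tvec \<Rightarrow> tvec" and flip :: bool +
  fixes X :: "'g set" and R :: "'g ncpoly set" and r m :: nat
    and rep :: "'g ncpoly \<Rightarrow> tvec \<Rightarrow> tvec"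
  assumes W_closed: "set x \<subseteq> X \<Longrightarrow> v \<in> tensor_space r m \<Longrightarrow> W x v \<in> tensor_space r m"
    and rels_closed: "R \<subseteq> carrier (free_alg X)"
    and rels: "a \<in> R \<Longrightarrow> v \<in> tensor_space r m \<Longrightarrow> act W a v = 0"
    and rep: "a \<in> carrier (free_alg X) \<Longrightarrow> rep a = (\<lambda>v\<in>tensor_space r m. act W a v)"
begin

lemma act_closed:
  assumes "a \<in> carrier (free_alg X)" "v \<in> tensor_space r m"
  shows "act W a v \<in> tensor_space r m"
  using assms unfolding act_def
  by (auto simp: free_alg_def intro!: tensor_space_closed W_closed)

lemma rep_closed: "a \<in> carrier (free_alg X) \<Longrightarrow> rep a \<in> carrier (End_alg r m)"
  by (auto simp: rep End_alg_def act_closed tensor_space_closed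
      linop_add[OF linop_act] linop_scale[OF linop_act])

lemma Idl_ideal: "ideal (Idl\<^bsub>free_alg X\<^esub> R) (free_alg X)"
  by (intro ring.genideal_ideal free_alg_ring rels_closed)

text \<open>The polynomials acting by zero on the tensor space form a two-sided ideal containing the
  relations; absorption of a factor uses that the letters of X preserve that space.\<close>

lemma act_Idl:
  assumes "a \<in> Idl\<^bsub>free_alg X\<^esub> R" "v \<in> tensor_space r m"
  shows "act W a v = 0"
proof -
  interpret F: ring "free_alg X" by (rule free_alg_ring)
  let ?N = "{a \<in> carrier (free_alg X). \<forall>v\<in>tensor_space r m. act W a v = 0}"
  have ops: "x \<oplus>\<^bsub>free_alg X\<^esub> y = x + y" "x \<otimes>\<^bsub>free_alg X\<^esub> y = x * y"
    "\<zero>\<^bsub>free_alg X\<^esub> = 0" for x y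
    by (simp_all add: free_alg_def)
  have inv: "act W (\<ominus>\<^bsub>free_alg X\<^esub> x) v = 0"
    if "x \<in> carrier (free_alg X)" "act W x v = 0" for x v
    using F.l_neg[OF that(1)] that(2) act_add[of W "\<ominus>\<^bsub>free_alg X\<^esub> x" x v] by (simp add: ops)
  have "ideal ?N (free_alg X)"
  proof (rule idealI[OF free_alg_ring])
    show "subgroup ?N (add_monoid (free_alg X))"
    proof (rule F.add.subgroupI)
      fix a b assume "a \<in> ?N" "b \<in> ?N"
      then show "a \<oplus>\<^bsub>free_alg X\<^esub> b \<in> ?N"
        using F.a_closed[of a b] by (auto simp: ops act_add)
    next
      show "?N \<noteq> {}" using F.zero_closed by (auto simp: ops intro!: exI[of _ 0])
    qed (auto simp: inv)
  next
    fix a x assume a: "a \<in> ?N" and x: "x \<in> carrier (free_alg X)"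
    then show "x \<otimes>\<^bsub>free_alg X\<^esub> a \<in> ?N" "a \<otimes>\<^bsub>free_alg X\<^esub> x \<in> ?N"
      using F.m_closed[of a x] F.m_closed[of x a]
      by (auto simp: ops act_mult act_closed linop_0[OF linop_act])
  qed
  then have "Idl\<^bsub>free_alg X\<^esub> R \<subseteq> ?N"
    by (rule F.genideal_minimal) (use rels rels_closed in auto)
  with assms show ?thesis by blast
qed

text \<open>This gives \<open>the_elem\<close> in \<open>Phi\<close> and \<open>Psi\<close> its
  meaning: the operator is constant on a coset, so the image of the coset is a singleton.\<close>

lemma coset_rep:
  assumes a: "a \<in> carrier (free_alg X)"
  shows "the_elem (rep ` cls X R a) = rep a"
proof -
  interpret F: ring "free_alg X" by (rule free_alg_ring)
  interpret I: ideal "Idl\<^bsub>free_alg X\<^esub> R" "free_alg X" by (rule Idl_ideal)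
  have "rep x = rep a" if "x \<in> cls X R a" for x
  proof -
    obtain i where i: "i \<in> Idl\<^bsub>free_alg X\<^esub> R" "x = i \<oplus>\<^bsub>free_alg X\<^esub> a"
      using \<open>x \<in> cls X R a\<close> unfolding cls_def a_r_coset_def' by blast
    then have "x = i + a" by (simp add: free_alg_def)
    moreover have "x \<in> carrier (free_alg X)"
      using F.a_closed[OF I.Icarr[OF i(1)] a] i(2) by simp
    ultimately show ?thesis using a i(1) \<open>x = i + a\<close> by (simp add: rep act_add act_Idl cong: restrict_cong)
  qed
  moreover have "a \<in> cls X R a"
    unfolding cls_def by (rule I.a_rcos_self[OF a])
  ultimately have "rep ` cls X R a = {rep a}" by blast
  then show ?thesis by simp
qed

lemma presented_carrier: "carrier (presented_alg X R) = cls X R ` carrier (free_alg X)"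
  by (auto simp: presented_alg_def FactRing_def A_RCOSETS_def' cls_def)

lemma cls_hom:
  assumes "a \<in> carrier (free_alg X)" "b \<in> carrier (free_alg X)"
  shows "cls X R a \<oplus>\<^bsub>presented_alg X R\<^esub> cls X R b = cls X R (a + b)"
    and "cls X R a \<otimes>\<^bsub>presented_alg X R\<^esub> cls X R b = cls X R (a * b)"
    and "\<one>\<^bsub>presented_alg X R\<^esub> = cls X R 1"
proof -
  interpret I: ideal "Idl\<^bsub>free_alg X\<^esub> R" "free_alg X" by (rule Idl_ideal)
  have ops: "x \<oplus>\<^bsub>free_alg X\<^esub> y = x + y" "x \<otimes>\<^bsub>free_alg X\<^esub> y = x * y"
    "\<one>\<^bsub>free_alg X\<^esub> = 1" for x y
    by (simp_all add: free_alg_def)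
  show "cls X R a \<oplus>\<^bsub>presented_alg X R\<^esub> cls X R b = cls X R (a + b)"
    using I.a_rcos_sum[OF assms] by (simp add: presented_alg_def FactRing_def cls_def ops)
  show "cls X R a \<otimes>\<^bsub>presented_alg X R\<^esub> cls X R b = cls X R (a * b)"
    using I.rcoset_mult_add[OF assms] by (simp add: presented_alg_def FactRing_def cls_def ops)
  show "\<one>\<^bsub>presented_alg X R\<^esub> = cls X R 1"
    by (simp add: presented_alg_def FactRing_def cls_def ops)
qed

lemma ring_hom:
  "(\<lambda>C. the_elem (rep ` C)) \<in> ring_hom (presented_alg X R)
     (if flip then opposite (End_alg r m) else End_alg r m)"
proof (rule ring_hom_memI)
  let ?h = "\<lambda>C. the_elem (rep ` C)"
  fix x assume "x \<in> carrier (presented_alg X R)"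
  then obtain a where a: "a \<in> carrier (free_alg X)" and x: "x = cls X R a"
    by (auto simp: presented_carrier)
  show "?h x \<in> carrier (if flip then opposite (End_alg r m) else End_alg r m)"
    by (simp add: x coset_rep a rep_closed opposite_def)
  fix y assume "y \<in> carrier (presented_alg X R)"
  then obtain b where b: "b \<in> carrier (free_alg X)" and y: "y = cls X R b"
    by (auto simp: presented_carrier)
  show "?h (x \<otimes>\<^bsub>presented_alg X R\<^esub> y)
      = ?h x \<otimes>\<^bsub>if flip then opposite (End_alg r m) else End_alg r m\<^esub> ?h y"
    using a b by (auto simp: x y cls_hom coset_rep free_alg_closed rep act_mult opposite_def
        End_alg_def act_closed)
  show "?h (x \<oplus>\<^bsub>presented_alg X R\<^esub> y)
      = ?h x \<oplus>\<^bsub>if flip then opposite (End_alg r m) else End_alg r m\<^esub> ?h y"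
    using a b by (auto simp: x y cls_hom coset_rep free_alg_closed rep act_add opposite_def
        End_alg_def)
next
  show "the_elem (rep ` \<one>\<^bsub>presented_alg X R\<^esub>)
      = \<one>\<^bsub>if flip then opposite (End_alg r m) else End_alg r m\<^esub>"
    using free_alg_closed(1)[of X] by (auto simp: cls_hom(3)[of 1 1] coset_rep rep opposite_def End_alg_def)
qed

end

section \<open>Bases of the tensor powers and the explicit form of the action of U\<close>

lemma finite_idx [simp]: "finite (idx r)"
proof -
  have "idx r = of_int ` {- int r..int r}" by (auto simp: idx_def)
  then show ?thesis by simp
qed

definition basis :: "nat \<Rightarrow> nat \<Rightarrow> rat list set" where
  "basis r m = {f. set f \<subseteq> idx r \<and> length f = m}"

lemma finite_basis [simp]: "finite (basis r m)"
  unfolding basis_def by (rule finite_lists_length_eq) simp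

lemma tensor_space_iff: "v \<in> tensor_space r m \<longleftrightarrow> Poly_Mapping.keys v \<subseteq> basis r m"
  by (auto simp: tensor_space_def basis_def)

lemma M_in_tensor_space [simp]: "M f \<in> tensor_space r m \<longleftrightarrow> f \<in> basis r m"
  by (simp add: tensor_space_iff M_def)

lemma linop_closedI:
  assumes "linop F" "\<And>f. f \<in> basis r m \<Longrightarrow> F (M f) \<in> tensor_space s n" "v \<in> tensor_space r m"
  shows "F v \<in> tensor_space s n"
  unfolding linop_eq_lin[OF assms(1), of v] lin_def
  using assms(2,3) by (intro tensor_space_closed) (auto simp: tensor_space_iff M_def)

lemma basis_Cons [simp]: "a # f \<in> basis r (Suc m) \<longleftrightarrow> a \<in> idx r \<and> f \<in> basis r m"
  and basis_0: "basis r 0 = {[]}"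
  by (auto simp: basis_def)

lemma tcons_closed: "a \<in> idx r \<Longrightarrow> w \<in> tensor_space r m \<Longrightarrow> tcons a w \<in> tensor_space r (Suc m)"
  by (rule linop_closedI[OF linop_tcons]) (simp_all add: tcons_M)

fun gop :: "ugen \<Rightarrow> tvec \<Rightarrow> tvec" where
  "gop (Eg i) = Eop (i - 1/2)"
| "gop (Fg i) = Fop (i - 1/2)"
| "gop (Kg i) = Kop (i - 1/2)"
| "gop (Kinvg i) = Lop (i - 1/2)"

lemma linop_gop [simp]: "linop (gop g)"
  by (cases g) simp_all

lemma roots_idx:
  assumes "i \<in> roots r"
  shows "i - 1/2 \<in> idx r" "i + 1/2 \<in> idx r"
proof -
  obtain k where k: "i = of_int k - 1/2" "1 - int r \<le> k" "k \<le> int r"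
    using assms by (auto simp: roots_def)
  show "i - 1/2 \<in> idx r"
    unfolding idx_def using k by (intro CollectI exI[of _ "k - 1"]) auto
  show "i + 1/2 \<in> idx r"
    unfolding idx_def using k by (intro CollectI exI[of _ k]) auto
qed

text \<open>\<open>form\<close> sums over I only; for i in \<open>roots r\<close> both ends of
  \<alpha>_i lie in I, so no term is lost.\<close>

lemma form_alpha_eps:
  assumes "i \<in> roots r"
  shows "form r (alpha i) (eps a) = cf (i - 1/2) a"
proof -
  have "form r (alpha i) (eps a) = (\<Sum>b\<in>idx r. if b = a then cf (i - 1/2) a else 0)"
    unfolding form_def by (rule sum.cong) (auto simp: alpha_def eps_def cf_def)
  also have "\<dots> = cf (i - 1/2) a"
    using roots_idx[OF assms] by (auto simp: cf_def add.commute)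
  finally show ?thesis .
qed

lemma form_alpha_alpha:
  assumes "i \<in> roots r"
  shows "form r (alpha i) (alpha j) = cart (i - 1/2) (j - 1/2)"
proof -
  have "form r (alpha i) (alpha j)
      = form r (alpha i) (eps (j - 1/2)) - form r (alpha i) (eps (j + 1/2))"
    by (simp add: form_def alpha_def[of j] right_diff_distrib sum_subtractf)
  then show ?thesis by (simp add: form_alpha_eps[OF assms] cart_def add.commute)
qed

lemma lin_u [simp]: "lin T (u a) = T a"
  by (simp add: u_def)

lemma tensor_scale: "tensor (scale c v) w = scale c (tensor v w)"
  and tensor_0: "tensor 0 w = 0"
  using linop_scale[OF linop_tensor_left] linop_0[OF linop_tensor_left] by auto

text \<open>g varies in the induction because the coproduct of E_i puts another generator, K_i^{-1},
  on the remaining factors.\<close>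

lemma tensor_rep_gop:
  assumes "g \<in> U_gens r" "length f = n"
  shows "tensor_rep r n g f = gop g (M f)"
  using assms
proof (induction n arbitrary: g f)
  case 0
  then show ?case by (cases g) auto
next
  case (Suc n)
  then obtain a f' where f: "f = a # f'" "length f' = n" by (cases f) auto
  have Kinv: "tensor_rep r n (Kinvg i) f' = Lop (i - 1/2) (M f')" if "g = Eg i" for i
    using Suc.IH[of "Kinvg i" f'] Suc.prems f(2) that by (auto simp: U_gens_def)
  show ?case
    using Suc.IH[OF Suc.prems(1) f(2)] Suc.prems(1)
    by (cases g) (auto simp: f word_act_def Kinv U_gens_def form_alpha_eps tensor_scale tensor_0
      Eop_M Fop_M Kop_M Lop_M tcons_M qpow_simps add.commute)
qed

lemma tensor_rep_closed:
  assumes "g \<in> U_gens r" "v \<in> tensor_space r m"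
  shows "gop g v \<in> tensor_space r m"
proof (rule linop_closedI[OF linop_gop _ assms(2)])
  fix f assume "f \<in> basis r m"
  then show "gop g (M f) \<in> tensor_space r m"
  proof (induction f arbitrary: m)
    case Nil
    then show ?case by (cases g) (auto simp: tensor_space_closed)
  next
    case (Cons a f)
    then obtain n where m: "m = Suc n" by (auto simp: basis_def)
    have L: "Lop i (M f) \<in> tensor_space r n" "M f \<in> tensor_space r n" for i
      using Cons.prems m by (simp_all add: Lop_M tensor_space_closed)
    have IH: "gop g (M f) \<in> tensor_space r n" using Cons m by simp
    show ?case
      using roots_idx[of _ r] Cons.prems assms(1) IH L
      by (cases g) (auto simp: m U_gens_def add.commute simp flip: tcons_M intro!: tensor_space_closed tcons_closed)
  qed
qed

lemma foldr_gop:
  assumes "set ws \<subseteq> U_gens r" "v \<in> tensor_space r m"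
  shows "word_act (tensor_rep r m) ws v = foldr gop ws v \<and> foldr gop ws v \<in> tensor_space r m"
  using assms(1)
proof (induction ws)
  case Nil
  then show ?case using assms(2) by (simp add: word_act_def)
next
  case (Cons g ws)
  have "lin (tensor_rep r m g) w = gop g w" if "w \<in> tensor_space r m" for w
    by (rule linop_eqI)
      (use that Cons.prems in \<open>auto simp: tensor_rep_gop tensor_space_def\<close>)
  with Cons show ?case by (auto simp: word_act_def tensor_rep_closed)
qed

lemma linop_foldr: "(\<And>g. linop (G g)) \<Longrightarrow> linop (foldr G ws)"
  by (induction ws) (auto simp: linop_def)

lemma Phi_free_act:
  assumes "a \<in> carrier (free_alg (U_gens r))"
  shows "Phi_free r m a = (\<lambda>v\<in>tensor_space r m. act (foldr gop) a v)"
  unfolding Phi_free_def act_def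
  by (rule restrict_ext, rule sum.cong)
    (use assms foldr_gop in \<open>auto simp: free_alg_def\<close>)

lemma U_rels_closed: "U_rels r \<subseteq> carrier (free_alg (U_gens r))"
proof
  interpret F: ring "free_alg (U_gens r)" by (rule free_alg_ring)
  have diff: "x - y \<in> carrier (free_alg (U_gens r))"
    if "x \<in> carrier (free_alg (U_gens r))" "y \<in> carrier (free_alg (U_gens r))" for x y
    using Poly_Mapping.keys_add[of x "- y"] that by (auto simp: free_alg_def)
  have if0: "(if b then x else 0) \<in> carrier (free_alg (U_gens r))"
    if "x \<in> carrier (free_alg (U_gens r))" for b x
    using that by (auto simp: free_alg_def)
  fix a assume "a \<in> U_rels r"
  then show "a \<in> carrier (free_alg (U_gens r))"
    unfolding U_rels_def serre_def
    by (elim UnE CollectE exE conjE; simp only:)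
      (intro diff if0 free_alg_closed; simp add: U_gens_def)+
qed

interpretation U: word_operators "foldr gop" False
proof
  show "linop (foldr gop x)" for x by (rule linop_foldr) simp
qed simp_all

lemmas U_act_simps = act_add act_diff U.act_mult U.act_const act_gen

lemma roots_diff:
  assumes "i \<in> roots r" "j \<in> roots r" "\<bar>i - j\<bar> = 1"
  shows "j - 1/2 = (i - 1/2) + 1 \<or> j - 1/2 = (i - 1/2) - 1"
  using assms(3) by arith

lemma U_rels_act:
  assumes "a \<in> U_rels r"
  shows "act (foldr gop) a v = 0"
  using assms unfolding U_rels_def
proof (elim UnE)
  assume "a \<in> {serre (Eg i) (Eg j) | i j. i \<in> roots r \<and> j \<in> roots r \<and> \<bar>i - j\<bar> = 1}"
  then show ?thesis
    by (auto simp: serre_def U_act_simps Eop_serre[OF roots_diff])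
next
  assume "a \<in> {serre (Fg i) (Fg j) | i j. i \<in> roots r \<and> j \<in> roots r \<and> \<bar>i - j\<bar> = 1}"
  then show ?thesis
    by (auto simp: serre_def U_act_simps Fop_serre[OF roots_diff])
next
  assume "a \<in> {gen (Eg i) * gen (Eg j) - gen (Eg j) * gen (Eg i)
        | i j. i \<in> roots r \<and> j \<in> roots r \<and> \<bar>i - j\<bar> > 1}"
  then obtain i j where a: "a = gen (Eg i) * gen (Eg j) - gen (Eg j) * gen (Eg i)" "\<bar>i - j\<bar> > 1"
    by blast
  then have "\<bar>(i - 1/2) - (j - 1/2)\<bar> > 1" by simp
  from Eop_Eop_far[OF this] show ?thesis by (simp add: a U_act_simps)
next
  assume "a \<in> {gen (Fg i) * gen (Fg j) - gen (Fg j) * gen (Fg i)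
        | i j. i \<in> roots r \<and> j \<in> roots r \<and> \<bar>i - j\<bar> > 1}"
  then obtain i j where a: "a = gen (Fg i) * gen (Fg j) - gen (Fg j) * gen (Fg i)" "\<bar>i - j\<bar> > 1"
    by blast
  then have "\<bar>(i - 1/2) - (j - 1/2)\<bar> > 1" by simp
  from Fop_Fop_far[OF this] show ?thesis by (simp add: a U_act_simps)
next
  assume "a \<in> {gen (Eg i) * gen (Fg j) - gen (Fg j) * gen (Eg i)
        - (if i = j then const (inverse (qvar - inverse qvar)) * (gen (Kg i) - gen (Kinvg i)) else 0)
        | i j. i \<in> roots r \<and> j \<in> roots r}"
  then show ?thesis
    by (auto simp: U_act_simps Eop_Fop)
qed (auto simp: U_act_simps Kop_Lop Lop_Kop Kop_Kop Kop_Eop Kop_Fop form_alpha_alpha)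

interpretation U: presented_action "foldr gop" False "U_gens r" "U_rels r" r m "Phi_free r m"
  for r m
  by unfold_locales (auto simp: U_rels_act Phi_free_act foldr_gop dest: subsetD[OF U_rels_closed])

lemma Phi_hom: "Phi r m \<in> ring_hom (U_alg r) (End_alg r m)"
  using U.ring_hom[of r m] by (simp add: Phi_def[abs_def] U_alg_def)

section \<open>The operators of the Hecke algebra\<close>

definition hop :: "nat \<Rightarrow> tvec \<Rightarrow> tvec" where
  "hop i = lin (hecke_rep i)"

lemma linop_hop [simp]: "linop (hop i)"
  by (simp add: hop_def)

lemmas hop_simps [simp] = linop_hop[THEN linop_add] linop_hop[THEN linop_scale]
  linop_hop[THEN linop_0] linop_hop[THEN linop_diff] linop_hop[THEN linop_sum]

lemma hop_M: "hop i (M f) = hecke_rep i f"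
  by (simp add: hop_def)

lemmas hop_intros = lin_intros linop_hop linop_hop[THEN linop_comp]

lemma hop_0_tcons [simp]: "hop 0 (tcons a w)
  = (if a = 0 then scale (inverse pvar) (tcons a w)
     else if a > 0 then tcons (- a) w
     else tcons (- a) w + scale (inverse pvar - pvar) (tcons a w))"
  by (rule linop_eqI[where v = w])
    (auto intro!: hop_intros simp: tcons_M hop_M hecke_rep_def weyl_act_def)

lemma hop_1_tcons [simp]: "hop (Suc 0) (tcons a (tcons b w))
  = (if a = b then scale (inverse qvar) (tcons a (tcons b w))
     else if a < b then tcons b (tcons a w)
     else tcons b (tcons a w) + scale (inverse qvar - qvar) (tcons a (tcons b w)))"
  by (rule linop_eqI[where v = w])
    (auto intro!: hop_intros simp: tcons_M hop_M hecke_rep_def weyl_act_def)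

lemma hop_Suc_tcons [simp]: "hop (Suc (Suc i)) (tcons a w) = tcons a (hop (Suc i) w)"
  by (rule linop_eqI[where v = w])
    (auto intro!: hop_intros simp: tcons_M hop_M hecke_rep_def weyl_act_def)

lemma list_split2: "Suc 0 < length f \<Longrightarrow> \<exists>a b g. f = a # b # g"
  and list_split3: "Suc (Suc 0) < length f \<Longrightarrow> \<exists>a b c g. f = a # b # c # g"
  by (metis Suc_less_eq length_Cons list.exhaust list.size(3) not_less0)+

text \<open>The relation expanded to H^2 = 1 + (q_i^{-1} - q_i) H. H_0 and H_1 touch the first one
  or two letters, and later generators slide past the first letter; hence two base cases.\<close>

lemma hop_quadratic:
  assumes "i < length f"
  shows "hop i (hop i (M f)) = M f + scale (inverse (qpar i) - qpar i) (hop i (M f))"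
  using assms
proof (induction i arbitrary: f rule: induct_nat_012)
  case 0
  then obtain a g where "M f = tcons a (M g)" by (cases f) (auto simp: tcons_M)
  then show ?case
    by (intro poly_mapping_eqI) (auto simp: qpar_def vec_simps field_simps)
next
  case 1
  then obtain a b g where "M f = tcons a (tcons b (M g))"
    by (auto dest!: list_split2 simp: tcons_M)
  then show ?case
    by (intro poly_mapping_eqI) (auto simp: qpar_def vec_simps field_simps)
next
  case (ge2 i)
  then obtain a g where "f = a # g" "Suc i < length g" by (cases f) auto
  with ge2.IH(2)[of g] show ?case by (simp add: qpar_def flip: tcons_M)
qed

lemma hop_braid:
  assumes "Suc (Suc i) < length f"
  shows "hop (Suc i) (hop (Suc (Suc i)) (hop (Suc i) (M f)))
    = hop (Suc (Suc i)) (hop (Suc i) (hop (Suc (Suc i)) (M f)))"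
  using assms
proof (induction i arbitrary: f)
  case 0
  then obtain a b c g where "M f = tcons a (tcons b (tcons c (M g)))"
    by (auto dest!: list_split3 simp: tcons_M)
  then show ?case
    by (intro poly_mapping_eqI) (auto simp: vec_simps field_simps)
next
  case (Suc i)
  then obtain a g where "f = a # g" "Suc (Suc i) < length g" by (cases f) auto
  with Suc.IH[of g] show ?case by (simp flip: tcons_M)
qed

lemma hop_braid_0:
  assumes "Suc 0 < length f"
  shows "hop (Suc 0) (hop 0 (hop (Suc 0) (hop 0 (M f)))) = hop 0 (hop (Suc 0) (hop 0 (hop (Suc 0) (M f))))"
proof -
  obtain a b g where "M f = tcons a (tcons b (M g))"
    using assms by (auto dest!: list_split2 simp: tcons_M)
  then show ?thesis
    by (intro poly_mapping_eqI) (auto simp: vec_simps field_simps)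
qed

lemma hop_far_aux:
  assumes "Suc i + k + 1 < length f"
  shows "hop (i + k + 2) (hop i (M f)) = hop i (hop (i + k + 2) (M f))"
  using assms
proof (induction i arbitrary: f rule: induct_nat_012)
  case 0
  then obtain a g where "M f = tcons a (M g)" by (cases f) (auto simp: tcons_M)
  then show ?case by auto
next
  case 1
  then obtain a b g where "M f = tcons a (tcons b (M g))"
    using list_split2[of f] by (auto simp: tcons_M)
  then show ?case by auto
next
  case (ge2 i)
  then obtain a g where "f = a # g" "Suc (Suc i) + k + 1 < length g" by (cases f) auto
  with ge2.IH(2)[of g] show ?case by (simp flip: tcons_M)
qed

lemma hop_far:
  assumes "i < length f" "j < length f" "\<bar>int i - int j\<bar> > 1"
  shows "hop j (hop i (M f)) = hop i (hop j (M f))"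
proof -
  consider k where "j = i + k + 2" | k where "i = j + k + 2"
  proof -
    from assms(3) have "j = i + (j - i - 2) + 2 \<or> i = j + (i - j - 2) + 2" by arith
    with that show thesis by blast
  qed
  then show ?thesis
    by cases (use assms hop_far_aux in auto)
qed

lemma idx_uminus: "a \<in> idx r \<Longrightarrow> - a \<in> idx r"
proof -
  assume "a \<in> idx r"
  then obtain k where "a = of_int k" "- int r \<le> k" "k \<le> int r" by (auto simp: idx_def)
  then show ?thesis unfolding idx_def by (intro CollectI exI[of _ "- k"]) auto
qed

lemma weyl_act_basis: "i < m \<Longrightarrow> f \<in> basis r m \<Longrightarrow> weyl_act f i \<in> basis r m"
  unfolding basis_def weyl_act_def
  by (auto split: if_splits intro!: idx_uminus dest!: subsetD[OF set_update_subset_insert]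
     dest: nth_mem)

lemma hop_closed:
  assumes "i < m" "v \<in> tensor_space r m"
  shows "hop i v \<in> tensor_space r m"
proof (rule linop_closedI[OF linop_hop _ assms(2)])
  fix f assume "f \<in> basis r m"
  then show "hop i (M f) \<in> tensor_space r m"
    using weyl_act_basis[OF assms(1)]
    by (auto simp: hop_M hecke_rep_def intro!: tensor_space_closed)
qed

interpretation H: word_operators "fold hop" True
proof
  show "linop (fold hop x)" for x by (induction x) (auto intro: linop_id linop_comp simp: linop_def)
qed simp_all

lemmas H_act_simps = act_add act_diff H.act_mult H.act_const act_gen

lemma hecke_rels_closed: "hecke_rels m \<subseteq> carrier (free_alg {..<m})"
proof
  have diff: "x - y \<in> carrier (free_alg {..<m})"
    if "x \<in> carrier (free_alg {..<m})" "y \<in> carrier (free_alg {..<m})" for x y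
    using Poly_Mapping.keys_add[of x "- y"] that by (auto simp: free_alg_def)
  fix a assume "a \<in> hecke_rels m"
  then show "a \<in> carrier (free_alg {..<m})"
    unfolding hecke_rels_def
  proof (elim UnE)
    assume "a \<in> (if 1 < m then {gen 0 * gen 1 * gen 0 * gen 1 - gen 1 * gen 0 * gen 1 * gen 0} else {})"
    then show ?thesis
      by (auto split: if_splits intro!: diff free_alg_closed)
  qed (elim CollectE exE conjE; simp only:; intro diff free_alg_closed; simp)+
qed

lemma hecke_rels_act:
  assumes "a \<in> hecke_rels m" "v \<in> tensor_space r m"
  shows "act (fold hop) a v = 0"
proof -
  have "act (fold hop) a (M f) = 0" if "f \<in> basis r m" for f
  proof -
    have len: "length f = m" using that by (simp add: basis_def)
    have quad: "act (fold hop) ((gen i - const (inverse (qpar i))) * (gen i + const (qpar i))) (M f) = 0"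
      if "i < m" for i
      using hop_quadratic[of i f] that len
      by (intro poly_mapping_eqI) (simp add: H_act_simps vec_simps qpar_def field_simps)
    show ?thesis
      using assms(1) unfolding hecke_rels_def
    proof (elim UnE)
      assume "a \<in> {gen i * gen (i + 1) * gen i - gen (i + 1) * gen i * gen (i + 1) | i. 1 \<le> i \<and> i + 1 < m}"
      then obtain i where i: "1 \<le> i" "i + 1 < m"
        and a: "a = gen i * gen (i + 1) * gen i - gen (i + 1) * gen i * gen (i + 1)"
        by blast
      then show ?thesis using hop_braid[of "i - 1" f] len by (simp add: a H_act_simps)
    next
      assume "a \<in> {(gen i - const (inverse (qpar i))) * (gen i + const (qpar i)) | i. i < m}"
      then show ?thesis using quad by blast
    qed (use len in \<open>auto simp: H_act_simps hop_braid_0 hop_far split: if_splits\<close>)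
  qed
  then show ?thesis
    using linop_eqI[OF H.linop_act linop_zero, of v a] assms(2)
    by (auto simp: tensor_space_iff)
qed

lemma Psi_free_act:
  assumes "a \<in> carrier (free_alg {..<m})"
  shows "Psi_free r m a = (\<lambda>v\<in>tensor_space r m. act (fold hop) a v)"
  unfolding Psi_free_def act_def hop_def ..

lemma fold_hop_closed: "set x \<subseteq> {..<m} \<Longrightarrow> v \<in> tensor_space r m \<Longrightarrow> fold hop x v \<in> tensor_space r m"
  by (induction x arbitrary: v) (auto simp: hop_closed)

interpretation H: presented_action "fold hop" True "{..<m}" "hecke_rels m" r m "Psi_free r m"
  for r m
  by unfold_locales (auto simp: hecke_rels_act Psi_free_act fold_hop_closed dest: subsetD[OF hecke_rels_closed])

lemma Psi_hom: "Psi r m \<in> ring_hom (hecke_alg m) (opposite (End_alg r m))"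
  using H.ring_hom[of r m] by (simp add: Psi_def[abs_def] hecke_alg_def)

section \<open>The two actions commute\<close>

lemma Ints_gap:
  assumes "a \<in> \<int>" "c \<in> \<int>"
  shows "a \<le> c \<or> c + 1 \<le> (a :: rat)"
proof -
  obtain x y where a: "a = of_int x" and c: "c = of_int y"
    using assms by (elim Ints_cases)
  have "x \<le> y \<or> y + 1 \<le> x" by linarith
  then have "a \<le> c \<or> of_int (y + 1) \<le> a" unfolding a c of_int_le_iff .
  then show ?thesis by (simp add: c)
qed

text \<open>A check on two adjacent factors, since later generators slide past the first letter. E_c
  and F_c move between the letters c and c + 1, which compare alike with every other integer; a
  letter strictly between them would break the commutation.\<close>

lemma hop_Suc_comm:
  assumes "Suc i < length f" "set f \<subseteq> \<int>" "c \<in> \<int>"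
  shows "hop (Suc i) (Kop c (M f)) = Kop c (hop (Suc i) (M f))"
    and "hop (Suc i) (Lop c (M f)) = Lop c (hop (Suc i) (M f))"
    and "hop (Suc i) (Eop c (M f)) = Eop c (hop (Suc i) (M f))"
    and "hop (Suc i) (Fop c (M f)) = Fop c (hop (Suc i) (M f))"
  using assms
proof (induction i arbitrary: f)
  case 0
  {
    case 1
    then obtain a b g where f: "M f = tcons a (tcons b (M g))" and "a \<in> \<int>" "b \<in> \<int>"
      using list_split2[of f] by (auto simp: tcons_M)
    then have "a \<le> c \<or> c + 1 \<le> a" "b \<le> c \<or> c + 1 \<le> b"
      using 1(3) Ints_gap by blast+
    then show ?case unfolding f by (intro poly_mapping_eqI) (auto simp: vec_simps field_simps)
  next
    case 2
    then obtain a b g where f: "M f = tcons a (tcons b (M g))" and "a \<in> \<int>" "b \<in> \<int>"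
      using list_split2[of f] by (auto simp: tcons_M)
    then have "a \<le> c \<or> c + 1 \<le> a" "b \<le> c \<or> c + 1 \<le> b"
      using 2(3) Ints_gap by blast+
    then show ?case unfolding f by (intro poly_mapping_eqI) (auto simp: vec_simps field_simps)
  next
    case 3
    then obtain a b g where f: "M f = tcons a (tcons b (M g))" and "a \<in> \<int>" "b \<in> \<int>"
      using list_split2[of f] by (auto simp: tcons_M)
    then have "a \<le> c \<or> c + 1 \<le> a" "b \<le> c \<or> c + 1 \<le> b"
      using 3(3) Ints_gap by blast+
    then show ?case unfolding f by (intro poly_mapping_eqI) (auto simp: vec_simps field_simps)
  next
    case 4
    then obtain a b g where f: "M f = tcons a (tcons b (M g))" and "a \<in> \<int>" "b \<in> \<int>"
      using list_split2[of f] by (auto simp: tcons_M)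
    then have "a \<le> c \<or> c + 1 \<le> a" "b \<le> c \<or> c + 1 \<le> b"
      using 4(3) Ints_gap by blast+
    then show ?case unfolding f by (intro poly_mapping_eqI) (auto simp: vec_simps field_simps)
  }
next
  case (Suc i)
  {
    case 1
    then obtain a g where "f = a # g" "Suc i < length g" "set g \<subseteq> \<int>" by (cases f) auto
    with Suc.IH[of g] 1(3) show ?case by (simp flip: tcons_M)
  next
    case 2
    then obtain a g where "f = a # g" "Suc i < length g" "set g \<subseteq> \<int>" by (cases f) auto
    with Suc.IH[of g] 2(3) show ?case by (simp flip: tcons_M)
  next
    case 3
    then obtain a g where "f = a # g" "Suc i < length g" "set g \<subseteq> \<int>" by (cases f) auto
    with Suc.IH[of g] 3(3) show ?case by (simp flip: tcons_M)
  next
    case 4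
    then obtain a g where "f = a # g" "Suc i < length g" "set g \<subseteq> \<int>" by (cases f) auto
    with Suc.IH[of g] 4(3) show ?case by (simp flip: tcons_M)
  }
qed

lemma idx_Ints: "idx r \<subseteq> \<int>"
  by (auto simp: idx_def)

lemma gop_hop_Suc:
  assumes "Suc i < m" "v \<in> tensor_space r m" "g \<in> U_gens r"
  shows "hop (Suc i) (gop g v) = gop g (hop (Suc i) v)"
proof (rule linop_eqI[where v = v])
  fix f assume "f \<in> Poly_Mapping.keys v"
  then have f: "Suc i < length f" "set f \<subseteq> \<int>"
    using assms(1,2) idx_Ints[of r] by (auto simp: tensor_space_def)
  have "i - 1/2 \<in> \<int>" if "i \<in> roots r" for i
    using roots_idx[OF that] idx_Ints by blast
  then show "hop (Suc i) (gop g (M f)) = gop g (hop (Suc i) (M f))"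
    using assms(3) hop_Suc_comm[OF f] by (auto simp: U_gens_def)
qed (auto intro!: linop_comp[OF linop_hop linop_gop] linop_comp[OF linop_gop linop_hop])

lemma foldr_gop_hop_Suc:
  assumes "Suc i < m" "v \<in> tensor_space r m" "set ws \<subseteq> U_gens r"
  shows "hop (Suc i) (foldr gop ws v) = foldr gop ws (hop (Suc i) v)"
  using assms(3)
  by (induction ws) (use assms foldr_gop[of _ r v m] in \<open>auto simp: gop_hop_Suc[of _ m _ r]\<close>)

lemma act_hop_Suc:
  assumes "Suc i < m" "v \<in> tensor_space r m" "a \<in> carrier (free_alg (U_gens r))"
  shows "hop (Suc i) (act (foldr gop) a v) = act (foldr gop) a (hop (Suc i) v)"
  using assms by (auto simp: act_def foldr_gop_hop_Suc free_alg_def)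

section \<open>The coideal generators and \<open>hop 0\<close>\<close>

definition jpar :: "rat \<Rightarrow> Qpq" where
  "jpar c = (if c = 0 then pvar else 1)"

lemma jpar_nz [simp]: "jpar c \<noteq> 0"
  by (simp add: jpar_def)

text \<open>With c = i - 1/2 the root -i has index -c - 1, and \<open>jpar c\<close> merges the two
  cases in the definitions of e and f.\<close>

lemma act_jmath:
  "act (foldr gop) (e_jmath i) v
     = Eop (i - 1/2) v + scale (inverse (jpar (i - 1/2))) (Fop (- i - 1/2) (Lop (i - 1/2) v))"
  "act (foldr gop) (f_jmath i) v
     = Eop (- i - 1/2) v + scale (jpar (i - 1/2)) (Lop (- i - 1/2) (Fop (i - 1/2) v))"
  "act (foldr gop) (k_jmath i) v = Kop (i - 1/2) (Lop (- i - 1/2) v)"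
  "act (foldr gop) (kinv_jmath i) v = Kop (- i - 1/2) (Lop (i - 1/2) v)"
  by (auto simp: e_jmath_def f_jmath_def k_jmath_def kinv_jmath_def jpar_def U_act_simps)

lemma neg_one_minus: "- 1 - c = - c - (1 :: rat)"
  by simp

text \<open>The coideal property at work: \<Delta>(e_i) = 1 \<otimes> E_i + e_i \<otimes> K_i^{-1} +
  k_i^{-1} \<otimes> F_{-i} K_i^{-1}, up to p^{-1} in the last term for i = 1/2. All left tensor
  factors lie in \<open>U_jmath\<close>, so the check concerns the letter a alone, whatever w is. At
  c = 0 the parameter p matches the eigenvalue p^{-1} of H_0 on u_0.\<close>

lemma jmath_hop_0_tcons:
  assumes "c \<ge> 0"
  shows "hop 0 (Eop c (tcons a w) + scale (inverse (jpar c)) (Fop (- c - 1) (Lop c (tcons a w))))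
      = Eop c (hop 0 (tcons a w)) + scale (inverse (jpar c)) (Fop (- c - 1) (Lop c (hop 0 (tcons a w))))"
    and "hop 0 (Eop (- c - 1) (tcons a w) + scale (jpar c) (Lop (- c - 1) (Fop c (tcons a w))))
      = Eop (- c - 1) (hop 0 (tcons a w)) + scale (jpar c) (Lop (- c - 1) (Fop c (hop 0 (tcons a w))))"
    and "hop 0 (Kop c (Lop (- c - 1) (tcons a w))) = Kop c (Lop (- c - 1) (hop 0 (tcons a w)))"
    and "hop 0 (Kop (- c - 1) (Lop c (tcons a w))) = Kop (- c - 1) (Lop c (hop 0 (tcons a w)))"
  using assms
  by (intro poly_mapping_eqI; auto simp: neg_one_minus vec_simps jpar_def field_simps)+

section \<open>The bicommutant theorem over an ordered field\<close>

definition mmul :: "'a set \<Rightarrow> ('a \<Rightarrow> 'a \<Rightarrow> 'k) \<Rightarrow> ('a \<Rightarrow> 'a \<Rightarrow> 'k) \<Rightarrow> 'a \<Rightarrow> 'a \<Rightarrow> 'k::comm_semiring_0" where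
  "mmul J b c f g = (\<Sum>h\<in>J. b f h * c h g)"

text \<open>Gram-Schmidt by coordinates: either B vanishes at x0, or B is spanned by its subspace B0
  vanishing there together with one vector n orthogonal to B0. The order enters as positivity of the
  square norm of n.\<close>

lemma orthogonal_projection:
  fixes B :: "('x \<Rightarrow> 'k::linordered_field) set"
  assumes "finite X" "B \<noteq> {}"
    and "\<And>b c. b \<in> B \<Longrightarrow> c \<in> B \<Longrightarrow> (\<lambda>x. b x + c x) \<in> B"
    and "\<And>b s. b \<in> B \<Longrightarrow> (\<lambda>x. s * b x) \<in> B"
  shows "\<exists>b\<in>B. \<forall>c\<in>B. (\<Sum>x\<in>X. (v x - b x) * c x) = 0"
  using assms
proof (induction X arbitrary: B v rule: finite_induct)
  case empty
  then show ?case by auto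
next
  case (insert x0 X)
  have add: "\<And>b c. b \<in> B \<Longrightarrow> c \<in> B \<Longrightarrow> (\<lambda>x. b x + c x) \<in> B"
    and smult: "\<And>b s. b \<in> B \<Longrightarrow> (\<lambda>x. s * b x) \<in> B"
    using insert.prems by auto
  show ?case
  proof (cases "\<forall>b\<in>B. b x0 = 0")
    case True
    obtain b where "b \<in> B" "\<forall>c\<in>B. (\<Sum>x\<in>X. (v x - b x) * c x) = 0"
      using insert.IH[OF insert.prems] by blast
    with True insert.hyps show ?thesis by (intro bexI[of _ b]) auto
  next
    case False
    then obtain b0 where b0: "b0 \<in> B" "b0 x0 \<noteq> 0" by blast
    define B0 where "B0 = {b \<in> B. b x0 = 0}"
    have "(\<lambda>x. 0 * b0 x) \<in> B" using smult b0(1) .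
    then have "B0 \<noteq> {}" unfolding B0_def by force
    then have IH: "\<exists>b\<in>B0. \<forall>c\<in>B0. (\<Sum>x\<in>X. (w x - b x) * c x) = 0" for w
      by (rule insert.IH) (auto simp: B0_def intro: add smult)
    obtain p where p: "p \<in> B0" "\<forall>c\<in>B0. (\<Sum>x\<in>X. (b0 x - p x) * c x) = 0"
      using IH[of b0] by blast
    \<comment> \<open>b0 minus its projection to \<open>B0\<close>. Orthogonality over X is enough,
      because members of \<open>B0\<close> vanish at x0.\<close>
    define n where "n = (\<lambda>x. b0 x + (-1) * p x)"
    have n: "n \<in> B" "n x0 \<noteq> 0"
      using p(1) b0 add[OF b0(1) smult[of p "-1"]] by (auto simp: n_def B0_def)
    have n_orth: "(\<Sum>x\<in>X. n x * c x) = 0" if "c \<in> B0" for c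
      using p(2) that by (simp add: n_def)
    let ?N = "\<Sum>x\<in>insert x0 X. n x * n x"
    have "?N > 0"
      using n(2) insert.hyps by (intro sum_pos2[of _ x0]) (auto simp: zero_less_mult_iff)
    obtain p' where p': "p' \<in> B0" "\<forall>c\<in>B0. (\<Sum>x\<in>X. (v x - p' x) * c x) = 0"
      using IH[of v] by blast
    define t where "t = (\<Sum>x\<in>insert x0 X. (v x - p' x) * n x) / ?N"
    let ?b = "\<lambda>x. p' x + t * n x"
    have "?b \<in> B" using p'(1) n(1) add smult by (auto simp: B0_def)
    moreover have "(\<Sum>x\<in>insert x0 X. (v x - ?b x) * c x) = 0" if "c \<in> B" for c
    proof -
      define s where "s = c x0 / n x0"
      define d where "d = (\<lambda>x. c x + (- s) * n x)"
      have "d \<in> B" unfolding d_def by (rule add[OF that smult[OF n(1)]])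
      then have d: "d \<in> B0" using n(2) by (simp add: B0_def d_def s_def)
      have "(\<Sum>x\<in>insert x0 X. (v x - ?b x) * c x)
          = (\<Sum>x\<in>insert x0 X. (v x - ?b x) * d x) + s * (\<Sum>x\<in>insert x0 X. (v x - ?b x) * n x)"
        unfolding sum_distrib_left sum.distrib[symmetric]
        by (rule sum.cong) (auto simp: d_def algebra_simps)
      also have "(\<Sum>x\<in>insert x0 X. (v x - ?b x) * d x)
          = (\<Sum>x\<in>X. (v x - p' x) * d x) - t * (\<Sum>x\<in>X. n x * d x)"
        using insert.hyps d
        by (simp add: B0_def sum_subtractf sum_distrib_left algebra_simps sum.distrib)
      also have "\<dots> = 0" using p'(2) n_orth d by simp
      also have "(\<Sum>x\<in>insert x0 X. (v x - ?b x) * n x)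
          = (\<Sum>x\<in>insert x0 X. (v x - p' x) * n x) - t * ?N"
        unfolding sum_distrib_left sum_subtractf[symmetric]
        by (rule sum.cong) (auto simp: algebra_simps)
      also have "\<dots> = 0" using \<open>?N > 0\<close> by (simp add: t_def)
      finally show ?thesis by simp
    qed
    ultimately show ?thesis by (intro bexI[of _ ?b] ballI)
  qed
qed

text \<open>B acts on the matrix space by left multiplication, and closure under transposition makes
  the orthogonal projection P onto B commute with this action. Each block of P, from one column to
  another, then commutes with B and hence with x. So x = x P(1) = P(x), which lies in B.\<close>

lemma bicommutant:
  fixes B :: "('a \<Rightarrow> 'a \<Rightarrow> 'k::linordered_field) set"
  assumes J: "finite J"
    and one: "(\<lambda>f g. of_bool (f = g)) \<in> B"
    and add: "\<And>b c. b \<in> B \<Longrightarrow> c \<in> B \<Longrightarrow> (\<lambda>f g. b f g + c f g) \<in> B"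
    and smult: "\<And>b s. b \<in> B \<Longrightarrow> (\<lambda>f g. s * b f g) \<in> B"
    and mult: "\<And>b c. b \<in> B \<Longrightarrow> c \<in> B \<Longrightarrow> mmul J b c \<in> B"
    and transpose: "\<And>b. b \<in> B \<Longrightarrow> (\<lambda>f g. b g f) \<in> B"
    and x: "\<And>y. (\<And>b f g. b \<in> B \<Longrightarrow> f \<in> J \<Longrightarrow> g \<in> J \<Longrightarrow> mmul J b y f g = mmul J y b f g)
      \<Longrightarrow> (\<And>f g. f \<in> J \<Longrightarrow> g \<in> J \<Longrightarrow> mmul J x y f g = mmul J y x f g)"
  shows "\<exists>b\<in>B. \<forall>f\<in>J. \<forall>g\<in>J. b f g = x f g"
proof -
  define ip where "ip = (\<lambda>b c. \<Sum>f\<in>J. \<Sum>g\<in>J. b f g * c f (g::'a) :: 'k)"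
  define proj where "proj = (\<lambda>v b. b \<in> B \<and> (\<forall>c\<in>B. ip (\<lambda>f g. v f g - b f g) c = 0))"
  have ip_lin: "ip (\<lambda>f g. b f g + c f g) d = ip b d + ip c d"
    "ip (\<lambda>f g. b f g - c f g) d = ip b d - ip c d"
    "ip (\<lambda>f g. s * b f g) d = s * ip b d"
    "ip (\<lambda>f g. \<Sum>i\<in>I. e i f g) d = (\<Sum>i\<in>I. ip (e i) d)"
    for b c d s and I :: "'i set" and e :: "'i \<Rightarrow> _"
    by (simp_all add: ip_def sum.distrib sum_subtractf sum_distrib_left algebra_simps
        sum.swap[of _ I] sum_distrib_right)
  have sum: "(\<lambda>f g. \<Sum>i\<in>I. e i f g) \<in> B" if "finite I" "\<And>i. i \<in> I \<Longrightarrow> e i \<in> B"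
    for I :: "'i set" and e
    using that
  proof (induction I rule: finite_induct)
    case empty
    show ?case using smult[OF one, of 0] by simp
  next
    case (insert i I)
    then show ?case using add[of "e i" "\<lambda>f g. \<Sum>i\<in>I. e i f g"] by simp
  qed
  have ex: "\<exists>b. proj v b" for v
  proof -
    have "\<exists>b\<in>case_prod ` B. \<forall>c\<in>case_prod ` B. (\<Sum>x\<in>J \<times> J. (case_prod v x - b x) * c x) = 0"
      by (rule orthogonal_projection)
        (use J one add smult in \<open>auto simp: case_prod_unfold intro!: imageI\<close>)
    then show ?thesis
      by (auto simp: proj_def ip_def sum.cartesian_product case_prod_unfold)
  qed
  have unique: "b f g = c f g" if "proj v b" "proj v c" "f \<in> J" "g \<in> J" for v b c f g
  proof -
    let ?d = "\<lambda>f g. b f g + (-1) * c f g"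
    have d: "?d \<in> B" using that by (intro add smult) (auto simp: proj_def)
    have "ip ?d ?d = ip (\<lambda>f g. v f g - c f g) ?d - ip (\<lambda>f g. v f g - b f g) ?d"
      unfolding ip_lin(2)[symmetric] by (simp add: ip_def)
    also have "\<dots> = 0" using that d unfolding proj_def by simp
    finally have "(\<Sum>f\<in>J. \<Sum>g\<in>J. ?d f g * ?d f g) = 0" by (simp add: ip_def)
    then have "?d f g * ?d f g = 0"
      using J that(3,4) by (simp add: sum_nonneg_eq_0_iff sum_nonneg)
    then show ?thesis by simp
  qed
  \<comment> \<open>P of a matrix unit. The choices for different units are independent;
    \<open>proj_sum\<close> and \<open>unique\<close> combine them into a linear map.\<close>
  define p where "p = (\<lambda>k j. SOME b. proj (\<lambda>f g. of_bool (f = k \<and> g = j)) b)"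
  have p: "proj (\<lambda>f g. of_bool (f = k \<and> g = j)) (p k j)" for k j
    unfolding p_def by (rule someI_ex[OF ex])
  have proj_sum: "proj (\<lambda>f g. \<Sum>i\<in>I. s i * e i f g) (\<lambda>f g. \<Sum>i\<in>I. s i * c i f g)"
    if "finite I" "\<And>i. i \<in> I \<Longrightarrow> proj (e i) (c i)" for I :: "'a set" and s e c
    using that unfolding proj_def
    by (auto simp: ip_lin right_diff_distrib[symmetric] sum_subtractf[symmetric] intro!: sum smult)
  \<comment> \<open>Left linearity of P: pairing b (v - c) with d is pairing v - c with the
    transpose of b times d, which is again in B.\<close>
  have proj_mult: "proj (mmul J b v) (mmul J b c)" if "b \<in> B" "proj v c" for b v c
    unfolding proj_def
  proof (intro conjI ballI)
    show "mmul J b c \<in> B" using that mult by (simp add: proj_def)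
    fix d assume "d \<in> B"
    then have d: "mmul J (\<lambda>f g. b g f) d \<in> B" using that transpose mult by blast
    have "ip (\<lambda>f g. mmul J b v f g - mmul J b c f g) d
        = (\<Sum>f\<in>J. \<Sum>g\<in>J. \<Sum>h\<in>J. b f h * (v h g - c h g) * d f g)"
      by (simp add: ip_def mmul_def sum_distrib_right sum_subtractf[symmetric] right_diff_distrib)
    also have "\<dots> = (\<Sum>f\<in>J. \<Sum>h\<in>J. \<Sum>g\<in>J. b f h * (v h g - c h g) * d f g)"
      by (intro sum.cong sum.swap refl)
    also have "\<dots> = (\<Sum>h\<in>J. \<Sum>f\<in>J. \<Sum>g\<in>J. b f h * (v h g - c h g) * d f g)"
      by (rule sum.swap)
    also have "\<dots> = (\<Sum>h\<in>J. \<Sum>g\<in>J. \<Sum>f\<in>J. b f h * (v h g - c h g) * d f g)"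
      by (intro sum.cong sum.swap refl)
    also have "\<dots> = ip (\<lambda>f g. v f g - c f g) (mmul J (\<lambda>f g. b g f) d)"
      by (simp add: ip_def mmul_def sum_distrib_left mult_ac)
    also have "\<dots> = 0" using that(2) d by (simp add: proj_def)
    finally show "ip (\<lambda>f g. mmul J b v f g - mmul J b c f g) d = 0" .
  qed
  have proj_cong: "proj w c" if "proj v c" "\<And>f g. f \<in> J \<Longrightarrow> g \<in> J \<Longrightarrow> v f g = w f g" for v w c
    using that by (auto simp: proj_def ip_def)
  have comm: "mmul J x (p k j) i j' = (\<Sum>l\<in>J. x l k * p l j i j')"
    if "i \<in> J" "j' \<in> J" "k \<in> J" "j \<in> J" for i j' k j
  proof -
    \<comment> \<open>The block of P from column j to column j'. That it commutes with B is left
      linearity of P read at one column.\<close>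
    let ?y = "\<lambda>i k. p k j i j'"
    have "mmul J b ?y f g = mmul J ?y b f g" if "b \<in> B" "f \<in> J" "g \<in> J" for b f g
    proof -
      have 1: "proj (mmul J b (\<lambda>f h. of_bool (f = g \<and> h = j))) (mmul J b (p g j))"
        by (rule proj_mult[OF \<open>b \<in> B\<close> p])
      have "proj (\<lambda>f h. \<Sum>l\<in>J. b l g * of_bool (f = l \<and> h = j)) (\<lambda>f h. \<Sum>l\<in>J. b l g * p l j f h)"
        by (rule proj_sum[OF J p])
      then have 2: "proj (mmul J b (\<lambda>f h. of_bool (f = g \<and> h = j))) (\<lambda>f h. \<Sum>l\<in>J. b l g * p l j f h)"
      proof (rule proj_cong)
        fix f h assume "f \<in> J"
        then show "(\<Sum>l\<in>J. b l g * of_bool (f = l \<and> h = j))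
            = mmul J b (\<lambda>f h. of_bool (f = g \<and> h = j)) f h"
          using J \<open>g \<in> J\<close>
          by (cases "h = j") (auto simp: mmul_def of_bool_def if_distrib cong: if_cong)
      qed
      show ?thesis
        using unique[OF 1 2, of f j'] that \<open>j' \<in> J\<close> by (simp add: mmul_def mult.commute)
    qed
    from x[OF this, of i k] that show ?thesis by (simp add: mmul_def mult.commute)
  qed
  \<comment> \<open>P(x), expanded in matrix units.\<close>
  let ?b = "\<lambda>f g. \<Sum>j\<in>J. \<Sum>l\<in>J. x l j * p l j f g"
  have "?b \<in> B" using p J by (intro sum smult) (auto simp: proj_def)
  moreover have "?b f g = x f g" if "f \<in> J" "g \<in> J" for f g
  proof -
    have "proj (\<lambda>f g. of_bool (f = g)) (\<lambda>f g. of_bool (f = g))"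
      using one by (simp add: proj_def ip_def)
    moreover have "proj (\<lambda>f g. of_bool (f = g)) (\<lambda>f g. \<Sum>j\<in>J. 1 * p j j f g)"
      by (rule proj_cong[OF proj_sum[OF J p]])
        (use J in \<open>auto simp: of_bool_def if_distrib cong: if_cong intro!: sum.neutral\<close>)
    ultimately have id: "(\<Sum>j\<in>J. p j j h g) = of_bool (h = g)" if "h \<in> J" for h
      using unique[of _ _ _ h g] that \<open>g \<in> J\<close> by fastforce
    have "?b f g = (\<Sum>j\<in>J. mmul J x (p j j) f g)"
      using that by (intro sum.cong) (auto simp: comm)
    also have "\<dots> = (\<Sum>h\<in>J. x f h * (\<Sum>j\<in>J. p j j h g))"
      unfolding mmul_def by (subst sum.swap) (simp add: sum_distrib_left)
    also have "\<dots> = (\<Sum>h\<in>J. x f h * of_bool (h = g))"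
      by (intro sum.cong) (auto simp: id)
    also have "\<dots> = x f g"
      using J that by (auto simp: of_bool_def if_distrib cong: if_cong)
    finally show ?thesis .
  qed
  ultimately show ?thesis by (intro bexI[of _ ?b] ballI)
qed

section \<open>Specialization at \<open>p = q = 1\<close>\<close>

text \<open>The local ring of Q(p,q) at p = q = 1 with its residue map, as a relation: regularity at
  the point and the value there form one statement. The inner polynomial variable is p, the outer
  one q.\<close>

definition spec :: "Qpq \<Rightarrow> rat \<Rightarrow> bool" where
  "spec x c \<longleftrightarrow> (\<exists>a b. poly (poly b 1) 1 \<noteq> 0 \<and> x = Fract a b
     \<and> c = poly (poly a 1) 1 / poly (poly b 1) 1)"

lemma specI: "poly (poly b 1) 1 \<noteq> 0 \<Longrightarrow> spec (Fract a b) (poly (poly a 1) 1 / poly (poly b 1) 1)"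
  by (auto simp: spec_def)

lemma spec_add:
  assumes "spec x c" "spec y d"
  shows "spec (x + y) (c + d)"
proof -
  obtain a b a' b' where *: "poly (poly b 1) 1 \<noteq> 0" "x = Fract a b" "c = poly (poly a 1) 1 / poly (poly b 1) 1"
    "poly (poly b' 1) 1 \<noteq> 0" "y = Fract a' b'" "d = poly (poly a' 1) 1 / poly (poly b' 1) 1"
    using assms by (auto simp: spec_def)
  then have "b \<noteq> 0" "b' \<noteq> 0" by auto
  with * show ?thesis using specI[of "b * b'" "a * b' + a' * b"] by (simp add: add_frac_eq)
qed

lemma spec_mult:
  assumes "spec x c" "spec y d"
  shows "spec (x * y) (c * d)"
proof -
  obtain a b a' b' where *: "poly (poly b 1) 1 \<noteq> 0" "x = Fract a b" "c = poly (poly a 1) 1 / poly (poly b 1) 1"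
    "poly (poly b' 1) 1 \<noteq> 0" "y = Fract a' b'" "d = poly (poly a' 1) 1 / poly (poly b' 1) 1"
    using assms by (auto simp: spec_def)
  then show ?thesis using specI[of "b * b'" "a * a'"] by simp
qed

lemma spec_const: "spec (Fract [:[:c:]:] 1) c"
  using specI[of 1 "[:[:c:]:]"] by simp

lemma spec_0 [simp]: "spec 0 0" and spec_1 [simp]: "spec 1 1"
  using specI[of 1 0] specI[of 1 1] by (simp_all add: Zero_fract_def One_fract_def)

lemma spec_pvar: "spec pvar 1" and spec_qvar: "spec qvar 1"
  using specI[of 1 "[:[:0, 1:]:]"] specI[of 1 "[:0, 1:]"] by (simp_all add: pvar_def qvar_def)

lemma spec_uminus: "spec x c \<Longrightarrow> spec (- x) (- c)"
proof -
  assume x: "spec x c"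
  have "spec (- 1) (- 1)" using specI[of 1 "-1"] by (simp add: One_fract_def)
  from spec_mult[OF this x] show ?thesis by simp
qed

lemma spec_diff: "spec x c \<Longrightarrow> spec y d \<Longrightarrow> spec (x - y) (c - d)"
  using spec_add[OF _ spec_uminus] by fastforce

lemma spec_sum: "(\<And>i. i \<in> I \<Longrightarrow> spec (x i) (c i)) \<Longrightarrow> spec (sum x I) (sum c I)"
  by (induction I rule: infinite_finite_induct) (auto intro: spec_add)

lemma spec_inverse: "spec x c \<Longrightarrow> c \<noteq> 0 \<Longrightarrow> spec (inverse x) (inverse c)"
proof -
  assume "spec x c" "c \<noteq> 0"
  then obtain a b where "poly (poly b 1) 1 \<noteq> 0" "poly (poly a 1) 1 \<noteq> 0" "x = Fract a b"
    "c = poly (poly a 1) 1 / poly (poly b 1) 1"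
    by (auto simp: spec_def)
  then show ?thesis using specI[of a b] by simp
qed

lemma spec_0_unique:
  assumes "spec 0 c" shows "c = 0"
proof -
  obtain a b where *: "poly (poly b 1) 1 \<noteq> 0" "0 = Fract a b" "c = poly (poly a 1) 1 / poly (poly b 1) 1"
    using assms by (auto simp: spec_def)
  then have "b \<noteq> 0" by auto
  with *(2) have "a = 0" by (simp add: Zero_fract_def eq_fract)
  with * show ?thesis by simp
qed

lemma spec_of_bool: "spec (of_bool b) (of_bool b)"
  by (cases b) auto

lemma spec_power: "spec x c \<Longrightarrow> spec (x ^ n) (c ^ n)"
  by (induction n) (auto intro: spec_mult)

lemma spec_qpow: "spec (qvar powi n) 1"
proof (cases "n \<ge> 0")
  case True
  then show ?thesis using spec_power[OF spec_qvar, of "nat n"] by (simp add: power_int_def)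
next
  case False
  then show ?thesis using spec_inverse[OF spec_power[OF spec_qvar, of "nat (- n)"]]
    by (simp add: power_int_def power_inverse)
qed

text \<open>The derivative of q^n at q = 1. A weight operator tends to the identity, and this
  quotient is what recovers its integer weight.\<close>

lemma spec_qint: "spec ((qvar powi n - 1) / (qvar - 1)) (of_int n)"
proof -
  have q1: "qvar - 1 \<noteq> 0" by (simp add: qvar_def One_fract_def Zero_fract_def eq_fract one_pCons)
  have nat: "spec ((qvar ^ k - 1) / (qvar - 1)) (of_nat k)" for k :: nat
  proof (induction k)
    case (Suc k)
    have "(qvar ^ Suc k - 1) / (qvar - 1) = qvar ^ k + (qvar ^ k - 1) / (qvar - 1)"
      using q1 by (simp add: field_simps)
    with spec_add[OF spec_power[OF spec_qvar, of k] Suc] show ?case by simp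
  qed simp
  show ?thesis
  proof (cases "n \<ge> 0")
    case True
    then show ?thesis using nat[of "nat n"] by (simp add: power_int_def)
  next
    case False
    define k where "k = nat (- n)"
    have n: "n = - int k" using False by (simp add: k_def)
    have "(qvar powi n - 1) / (qvar - 1) = - (qvar powi n * ((qvar ^ k - 1) / (qvar - 1)))"
      using q1 by (simp add: n power_int_minus field_simps)
    with spec_uminus[OF spec_mult[OF spec_qpow[of n] nat[of k]]] show ?thesis by (simp add: n)
  qed
qed

text \<open>A family that specializes to a diagonal matrix with nonzero entries can be reduced by
  Gaussian elimination: all pivots specialize to 1.\<close>

lemma interpolation:
  fixes A :: "('x \<Rightarrow> Qpq) set"
  assumes R: "finite R"
    and add: "\<And>a b. a \<in> A \<Longrightarrow> b \<in> A \<Longrightarrow> (\<lambda>x. a x + b x) \<in> A"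
    and smult: "\<And>s a. a \<in> A \<Longrightarrow> (\<lambda>x. s * a x) \<in> A"
    and "A \<noteq> {}"
    and diag: "\<And>i. i \<in> R \<Longrightarrow> \<exists>a\<in>A. \<forall>j\<in>R. spec (a j) (d i j)"
    and d: "\<And>i. i \<in> R \<Longrightarrow> d i i \<noteq> 0" "\<And>i j. i \<in> R \<Longrightarrow> j \<in> R \<Longrightarrow> i \<noteq> j \<Longrightarrow> d i j = 0"
  shows "\<exists>a\<in>A. \<forall>j\<in>R. a j = c j"
proof -
  \<comment> \<open>Elimination invariant: the columns in S already agree with the identity matrix,
    the others do so only after specialization. Hence the next pivot cannot be zero.\<close>
  have "\<exists>b. \<forall>i\<in>R. b i \<in> A \<and> (\<forall>j\<in>R. spec (b i j) (of_bool (i = j)))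
      \<and> (\<forall>j\<in>S. b i j = of_bool (i = j))" if "S \<subseteq> R" for S
    using finite_subset[OF that R] that
  proof (induction S rule: finite_induct)
    case empty
    obtain a where a: "\<And>i. i \<in> R \<Longrightarrow> a i \<in> A" "\<And>i j. i \<in> R \<Longrightarrow> j \<in> R \<Longrightarrow> spec (a i j) (d i j)"
      using diag by metis
    have "spec (inverse (a i i) * a i j) (of_bool (i = j))" if "i \<in> R" "j \<in> R" for i j
      using spec_mult[OF spec_inverse[OF a(2)[OF \<open>i \<in> R\<close> \<open>i \<in> R\<close>]] a(2)[OF that]] d that by auto
    then show ?case using a(1) smult by (intro exI[of _ "\<lambda>i x. inverse (a i i) * a i x"]) auto
  next
    case (insert s S)
    then obtain b where b: "\<And>i. i \<in> R \<Longrightarrow> b i \<in> A"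
      "\<And>i j. i \<in> R \<Longrightarrow> j \<in> R \<Longrightarrow> spec (b i j) (of_bool (i = j))"
      "\<And>i j. i \<in> R \<Longrightarrow> j \<in> S \<Longrightarrow> b i j = of_bool (i = j)"
      by auto
    have s: "s \<in> R" "s \<notin> S" using insert by auto
    then have nz: "b s s \<noteq> 0" using b(2)[of s s] spec_0_unique[of 1] by auto
    define e where "e = (\<lambda>x. inverse (b s s) * b s x)"
    have e: "e \<in> A" "e s = 1" "\<And>j. j \<in> S \<Longrightarrow> e j = 0"
      "\<And>j. j \<in> R \<Longrightarrow> spec (e j) (of_bool (s = j))"
      using s b nz spec_mult[OF spec_inverse[OF b(2)[OF s(1) s(1)]] b(2)[OF s(1)]] smult
      by (auto simp: e_def)
    define b' where "b' = (\<lambda>i. if i = s then e else (\<lambda>x. b i x + (- b i s) * e x))"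
    have "b' i \<in> A" if "i \<in> R" for i
      using e(1) add[OF b(1)[OF that] smult[OF e(1), of "- b i s"]] by (simp add: b'_def)
    moreover have "spec (b' i j) (of_bool (i = j))" if "i \<in> R" "j \<in> R" for i j
      using e(4)[OF that(2)] spec_diff[OF b(2)[OF that] spec_mult[OF b(2)[OF that(1) s(1)] e(4)[OF that(2)]]]
      by (auto simp: b'_def)
    moreover have "b' i j = of_bool (i = j)" if "i \<in> R" "j \<in> insert s S" for i j
      using that e(2,3) b(3) s by (auto simp: b'_def)
    ultimately show ?case by (intro exI[of _ b']) auto
  qed
  from this[OF subset_refl] obtain b where b: "\<And>i. i \<in> R \<Longrightarrow> b i \<in> A"
    "\<And>i j. i \<in> R \<Longrightarrow> j \<in> R \<Longrightarrow> b i j = of_bool (i = j)" by blast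
  have "(\<lambda>x. \<Sum>i\<in>I. c i * b i x) \<in> A" if "I \<subseteq> R" for I
    using finite_subset[OF that R] that
  proof (induction I rule: finite_induct)
    case empty
    obtain a where "a \<in> A" using \<open>A \<noteq> {}\<close> by blast
    from smult[OF this, of 0] show ?case by simp
  next
    case (insert i I)
    then show ?case using add[OF smult[of "b i" "c i"]] b(1) by simp
  qed
  moreover have "(\<Sum>i\<in>R. c i * b i j) = c j" if "j \<in> R" for j
  proof -
    have "(\<Sum>i\<in>R. c i * b i j) = (\<Sum>i\<in>R. if i = j then c i else 0)"
      by (intro sum.cong) (auto simp: b that)
    then show ?thesis using R that by simp
  qed
  ultimately show ?thesis by (intro bexI[of _ "\<lambda>x. \<Sum>i\<in>R. c i * b i x"]) simp_all
qed

section \<open>Endomorphisms commuting with the Hecke algebra\<close>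

definition desc :: "nat \<Rightarrow> rat list \<Rightarrow> bool" where
  "desc i f \<longleftrightarrow> (if i = 0 then f ! 0 < 0 else f ! i < f ! (i - 1))"

lemma weyl_act_fixed_iff:
  assumes "i < length f"
  shows "weyl_act f i = f \<longleftrightarrow> (if i = 0 then f ! 0 = 0 else f ! (i - 1) = f ! i)"
proof (cases "i = 0")
  case True
  with assms show ?thesis by (cases f) (auto simp: weyl_act_def)
next
  case False
  have "f[i - 1 := f ! i, i := f ! (i - 1)] = f" if "f ! (i - 1) = f ! i"
    by (metis that list_update_id)
  moreover have "f ! (i - 1) = f ! i" if "f[i - 1 := f ! i, i := f ! (i - 1)] = f"
    using arg_cong[OF that, of "\<lambda>g. g ! i"] assms by simp
  ultimately show ?thesis using False by (auto simp: weyl_act_def)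
qed

lemma length_weyl_act [simp]: "length (weyl_act f i) = length f"
  by (simp add: weyl_act_def)

lemma weyl_act_invol:
  assumes "i < length f"
  shows "weyl_act (weyl_act f i) i = f"
  by (rule nth_equalityI) (use assms in \<open>auto simp: weyl_act_def nth_list_update\<close>)

lemma desc_not_fixed: "i < length f \<Longrightarrow> desc i f \<Longrightarrow> weyl_act f i \<noteq> f"
  by (auto simp: weyl_act_fixed_iff desc_def split: if_splits)

definition hdiag :: "nat \<Rightarrow> rat list \<Rightarrow> Qpq" where
  "hdiag i f = (if weyl_act f i = f then inverse (qpar i)
     else if desc i f then inverse (qpar i) - qpar i else 0)"

text \<open>One shape for H_0 and the other generators: on a word that is not fixed, the
  off-diagonal entry is 1 in both directions, which is why \<open>hmat\<close> is symmetric.\<close>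

lemma hop_M_cases:
  assumes "i < length f"
  shows "hop i (M f) = scale (of_bool (weyl_act f i \<noteq> f)) (M (weyl_act f i)) + scale (hdiag i f) (M f)"
  using assms
  by (auto simp: hop_M hecke_rep_def hdiag_def weyl_act_fixed_iff desc_def qpar_def)

text \<open>A height function in place of the Bruhat order: undoing a descent strictly raises it.
  Increasing weights detect swaps, and starting at weight 1 detects the sign change of the first
  letter.\<close>

definition pot :: "rat list \<Rightarrow> rat" where
  "pot f = (\<Sum>j<length f. of_nat (Suc j) * f ! j)"

lemma pot_desc:
  assumes "i < length f" "desc i f"
  shows "pot f < pot (weyl_act f i)"
proof (cases "i = 0")
  case True
  with assms show ?thesis
    unfolding pot_def length_weyl_act
    by (intro sum_strict_mono_ex1) (auto simp: weyl_act_def desc_def nth_list_update)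
next
  case False
  have split: "pot g = (\<Sum>j\<in>{..<length f} - {i - 1, i}. of_nat (Suc j) * g ! j)
      + of_nat i * g ! (i - 1) + of_nat (Suc i) * g ! i" if "length g = length f" for g
  proof -
    have "pot g = of_nat (Suc i) * g ! i + (\<Sum>j\<in>{..<length f} - {i}. of_nat (Suc j) * g ! j)"
      unfolding pot_def that using assms(1) by (subst sum.remove[of _ i]) auto
    also have "(\<Sum>j\<in>{..<length f} - {i}. of_nat (Suc j) * g ! j)
        = of_nat i * g ! (i - 1) + (\<Sum>j\<in>{..<length f} - {i} - {i - 1}. of_nat (Suc j) * g ! j)"
      using assms(1) False by (subst sum.remove[of _ "i - 1"]) auto
    also have "{..<length f} - {i} - {i - 1} = {..<length f} - {i - 1, i}" by blast
    finally show ?thesis by simp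
  qed
  have "(\<Sum>j\<in>{..<length f} - {i - 1, i}. of_nat (Suc j) * weyl_act f i ! j)
      = (\<Sum>j\<in>{..<length f} - {i - 1, i}. of_nat (Suc j) * f ! j)"
    by (rule sum.cong) (use False in \<open>auto simp: weyl_act_def\<close>)
  then show ?thesis
    using assms False by (subst (1 2) split) (auto simp: weyl_act_def desc_def algebra_simps)
qed

definition dom_pairs :: "nat \<Rightarrow> nat \<Rightarrow> (rat list \<times> rat list) set" where
  "dom_pairs r m = {(f, g). f \<in> basis r m \<and> g \<in> basis r m
     \<and> (\<forall>i<m. \<not> desc i g \<and> (weyl_act g i = g \<longrightarrow> \<not> desc i f))}"

definition hmat :: "nat \<Rightarrow> rat list \<Rightarrow> rat list \<Rightarrow> Qpq" where
  "hmat i f g = lookup (hop i (M g)) f"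

lemma sum_of_bool:
  fixes F :: "'a \<Rightarrow> 'k::comm_semiring_1"
  assumes "finite J" "k \<in> J"
  shows "(\<Sum>h\<in>J. F h * of_bool (k = h)) = F k" "(\<Sum>h\<in>J. of_bool (k = h) * F h) = F k"
    "(\<Sum>h\<in>J. F h * of_bool (h = k)) = F k" "(\<Sum>h\<in>J. of_bool (h = k) * F h) = F k"
proof -
  have "(\<Sum>h\<in>J. F h * of_bool (k = h)) = (\<Sum>h\<in>J. if h = k then F h else 0)"
    by (rule sum.cong) auto
  then show "(\<Sum>h\<in>J. F h * of_bool (k = h)) = F k" using assms by simp
  then show "(\<Sum>h\<in>J. of_bool (k = h) * F h) = F k"
    "(\<Sum>h\<in>J. F h * of_bool (h = k)) = F k" "(\<Sum>h\<in>J. of_bool (h = k) * F h) = F k"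
    by (simp_all add: mult.commute eq_commute[of _ k])
qed

lemma mmul_hmat_right:
  assumes "i < m" "g \<in> basis r m"
  shows "mmul (basis r m) x (hmat i) f g
    = of_bool (weyl_act g i \<noteq> g) * x f (weyl_act g i) + hdiag i g * x f g"
proof -
  have "length g = m" using assms(2) by (simp add: basis_def)
  then have "mmul (basis r m) x (hmat i) f g
      = of_bool (weyl_act g i \<noteq> g) * (\<Sum>h\<in>basis r m. x f h * of_bool (weyl_act g i = h))
        + hdiag i g * (\<Sum>h\<in>basis r m. x f h * of_bool (g = h))"
    unfolding mmul_def sum_distrib_left sum.distrib[symmetric]
    by (intro sum.cong) (use assms in \<open>simp_all add: hmat_def hop_M_cases lookup_add lookup_M algebra_simps\<close>)
  then show ?thesis
    using assms weyl_act_basis[OF assms] by (simp only: sum_of_bool finite_basis)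
qed

lemma hmat_sym:
  assumes "i < m" "f \<in> basis r m" "g \<in> basis r m"
  shows "hmat i f g = hmat i g f"
proof -
  have "length f = m" "length g = m" using assms by (auto simp: basis_def)
  then show ?thesis
    using assms(1) weyl_act_invol[of i f] weyl_act_invol[of i g]
    by (auto simp: hmat_def hop_M_cases lookup_add lookup_M)
qed

lemma mmul_hmat_left:
  assumes "i < m" "f \<in> basis r m"
  shows "mmul (basis r m) (hmat i) x f g
    = of_bool (weyl_act f i \<noteq> f) * x (weyl_act f i) g + hdiag i f * x f g"
proof -
  have "mmul (basis r m) (hmat i) x f g = mmul (basis r m) (\<lambda>g f. x f g) (hmat i) g f"
    unfolding mmul_def by (rule sum.cong) (use assms hmat_sym in \<open>auto simp: mult.commute\<close>)
  then show ?thesis using mmul_hmat_right[OF assms] by simp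
qed

text \<open>Two climbs along \<open>pot\<close>, each ended by finiteness of the basis. With g
  dominant, a nonzero entry outside \<open>dom_pairs\<close> propagates through the stabilizer of g
  to a higher f. With g not dominant, a nonzero column g forces a nonzero column at a higher
  word.\<close>

lemma commuting_eq_0:
  assumes comm: "\<And>i f g. i < m \<Longrightarrow> f \<in> basis r m \<Longrightarrow> g \<in> basis r m \<Longrightarrow>
      mmul (basis r m) x (hmat i) f g = mmul (basis r m) (hmat i) x f g"
    and zero: "\<And>f g. (f, g) \<in> dom_pairs r m \<Longrightarrow> x f g = 0"
    and "f \<in> basis r m" "g \<in> basis r m"
  shows "x f g = 0"
proof -
  have comm': "of_bool (weyl_act g i \<noteq> g) * x f (weyl_act g i) + hdiag i g * x f g
      = of_bool (weyl_act f i \<noteq> f) * x (weyl_act f i) g + hdiag i f * x f g"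
    if "i < m" "f \<in> basis r m" "g \<in> basis r m" for i f g
    using comm[OF that] that by (simp add: mmul_hmat_left mmul_hmat_right)
  have len: "length f = m" if "f \<in> basis r m" for f using that by (simp add: basis_def)
  have max: "\<exists>f\<in>S. \<forall>g\<in>S. pot g \<le> pot f" if "S \<subseteq> basis r m" "S \<noteq> {}" for S
  proof -
    have S: "finite S" using finite_subset[OF that(1)] by simp
    then have "Max (pot ` S) \<in> pot ` S" using that by (intro Max_in) auto
    then obtain f where "f \<in> S" "pot f = Max (pot ` S)" by auto
    then show ?thesis using S by (intro bexI[of _ f]) auto
  qed
  have dominant: "x f g = 0" if g: "g \<in> basis r m" "\<forall>i<m. \<not> desc i g" and f: "f \<in> basis r m" for f g
  proof (rule ccontr)
    assume "x f g \<noteq> 0"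
    then have "{f \<in> basis r m. x f g \<noteq> 0} \<noteq> {}" using f by blast
    from max[OF _ this] obtain f where f: "f \<in> basis r m" "x f g \<noteq> 0"
      and f_max: "\<And>f'. f' \<in> basis r m \<Longrightarrow> x f' g \<noteq> 0 \<Longrightarrow> pot f' \<le> pot f"
      by auto
    have "(f, g) \<notin> dom_pairs r m" using zero f by blast
    then obtain i where i: "i < m" "weyl_act g i = g" "desc i f"
      using f(1) g by (auto simp: dom_pairs_def)
    have "weyl_act f i \<noteq> f" using desc_not_fixed i f(1) len by simp
    \<comment> \<open>The fixed word g contributes q_i^{-1}, the descent of f contributes q_i^{-1} -
      q_i; their difference is the factor q_i.\<close>
    then have "x (weyl_act f i) g = qpar i * x f g"
      using comm'[OF i(1) f(1) g(1)] i by (simp add: hdiag_def algebra_simps)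
    moreover have "qpar i \<noteq> 0" by (simp add: qpar_def)
    ultimately have "pot (weyl_act f i) \<le> pot f"
      using f_max weyl_act_basis[OF i(1) f(1)] f(2) by simp
    then show False using pot_desc[of i f] i f(1) len by simp
  qed
  show ?thesis
  proof (rule ccontr)
    assume "x f g \<noteq> 0"
    then have "{g \<in> basis r m. \<exists>f\<in>basis r m. x f g \<noteq> 0} \<noteq> {}" using assms by blast
    from max[OF _ this] obtain f g where fg: "g \<in> basis r m" "f \<in> basis r m" "x f g \<noteq> 0"
      and g_max: "\<And>f' g'. g' \<in> basis r m \<Longrightarrow> f' \<in> basis r m \<Longrightarrow> x f' g' \<noteq> 0 \<Longrightarrow> pot g' \<le> pot g"
      by auto
    obtain i where i: "i < m" "desc i g" using dominant fg by blast
    let ?g = "weyl_act g i"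
    have g: "?g \<in> basis r m" "length g = m" using i fg weyl_act_basis len by auto
    have "pot g < pot ?g" using pot_desc i g by simp
    then have 0: "x f' ?g = 0" if "f' \<in> basis r m" for f'
      using g_max[OF g(1) that] by force
    have "weyl_act ?g i = g" "?g \<noteq> g" using i g weyl_act_invol desc_not_fixed by auto
    \<comment> \<open>The relation at (f, ?g) contains x f g with coefficient 1; every other term
      lies in the vanishing column ?g.\<close>
    then have "x f g = 0"
      using comm'[OF i(1) fg(2) g(1)] 0[OF fg(2)] 0[OF weyl_act_basis[OF i(1) fg(2)]] by simp
    with fg show False by simp
  qed
qed

section \<open>Invariant matrices at \<open>p = q = 1\<close>\<close>

type_synonym site = "rat \<Rightarrow> rat \<Rightarrow> rat"

text \<open>\<open>sym_mat P x\<close> is the sum, over all injections of \<open>P\<close> into the tensor positions, of the tensor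
  product of the \<open>x i\<close> at the chosen positions and of identities elsewhere; \<open>der x\<close> is the case of
  one label.\<close>

fun sym_mat :: "nat set \<Rightarrow> (nat \<Rightarrow> site) \<Rightarrow> rat list \<Rightarrow> rat list \<Rightarrow> rat" where
  "sym_mat P x [] [] = of_bool (P = {})"
| "sym_mat P x (a # f) (b # g) = of_bool (a = b) * sym_mat P x f g
     + (\<Sum>i\<in>P. x i a b * sym_mat (P - {i}) x f g)"
| "sym_mat P x _ _ = 0"

fun der :: "site \<Rightarrow> rat list \<Rightarrow> rat list \<Rightarrow> rat" where
  "der x [] [] = 0"
| "der x (a # f) (b # g) = of_bool (a = b) * der x f g + x a b * of_bool (f = g)"
| "der x _ _ = 0"

lemma sym_mat_cong:
  assumes "\<And>i. i \<in> P \<Longrightarrow> x i = y i"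
  shows "sym_mat P x f g = sym_mat P y f g"
  using assms
proof (induction P x f g rule: sym_mat.induct)
  case (2 P x a f b g)
  have "sym_mat P x f g = sym_mat P y f g" by (rule 2(1)) (use 2(3) in auto)
  moreover have "sym_mat (P - {i}) x f g = sym_mat (P - {i}) y f g" if "i \<in> P" for i
    by (rule 2(2)) (use 2(3) that in auto)
  ultimately show ?case using 2(3) by (simp cong: sum.cong)
qed auto

lemma sym_mat_empty: "length f = length g \<Longrightarrow> sym_mat {} x f g = of_bool (f = g)"
  by (induction f g rule: list_induct2) auto

lemma basis_Suc: "basis r (Suc m) = (\<lambda>(a, f). a # f) ` (idx r \<times> basis r m)"
proof (rule Set.set_eqI)
  show "f \<in> basis r (Suc m) \<longleftrightarrow> f \<in> (\<lambda>(a, f). a # f) ` (idx r \<times> basis r m)" for f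
    by (cases f) (auto simp: basis_def)
qed

lemma sum_basis_Suc: "(\<Sum>h\<in>basis r (Suc m). F h) = (\<Sum>a\<in>idx r. \<Sum>h\<in>basis r m. F (a # h))"
  unfolding basis_Suc sum.cartesian_product
  by (subst sum.reindex) (auto simp: inj_on_def intro!: sum.cong)

text \<open>One entry of (1 \<otimes> D + X \<otimes> 1)(1 \<otimes> S + \<Sum> Z_i \<otimes> T_i),
  with rows of the left and columns of the right factor inserted. \<open>der\<close> and
  \<open>sym_mat\<close> take these shapes once the first letter is split off.\<close>

lemma kronecker_product:
  fixes X D S :: "_ \<Rightarrow> 'k::comm_ring_1"
  assumes "finite I" "finite J" "finite P" "a \<in> I" "b \<in> I" "f \<in> J"
  shows "(\<Sum>c\<in>I. \<Sum>h\<in>J. (of_bool (a = c) * D h + X c * of_bool (f = h)) *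
          (of_bool (c = b) * S h + (\<Sum>i\<in>P. Z i c * T i h)))
    = of_bool (a = b) * (\<Sum>h\<in>J. D h * S h) + (\<Sum>i\<in>P. Z i a * (\<Sum>h\<in>J. D h * T i h))
      + X b * S f + (\<Sum>i\<in>P. (\<Sum>c\<in>I. X c * Z i c) * T i f)"
proof -
  let ?R = "\<lambda>c h. of_bool (c = b) * S h + (\<Sum>i\<in>P. Z i c * T i h)"
  have "(\<Sum>c\<in>I. \<Sum>h\<in>J. (of_bool (a = c) * D h + X c * of_bool (f = h)) * ?R c h)
      = (\<Sum>h\<in>J. \<Sum>c\<in>I. of_bool (a = c) * (D h * ?R c h)) + (\<Sum>c\<in>I. X c * (\<Sum>h\<in>J. of_bool (f = h) * ?R c h))"
    by (subst sum.swap[of _ I J])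
      (simp add: sum.distrib[symmetric] sum_distrib_left algebra_simps)
  also have "(\<Sum>h\<in>J. \<Sum>c\<in>I. of_bool (a = c) * (D h * ?R c h)) = (\<Sum>h\<in>J. D h * ?R a h)"
    using assms by (simp only: sum_of_bool)
  also have "\<dots> = of_bool (a = b) * (\<Sum>h\<in>J. D h * S h) + (\<Sum>h\<in>J. \<Sum>i\<in>P. Z i a * (D h * T i h))"
    by (simp add: distrib_left sum.distrib sum_distrib_left mult_ac)
  also have "(\<Sum>h\<in>J. \<Sum>i\<in>P. Z i a * (D h * T i h)) = (\<Sum>i\<in>P. Z i a * (\<Sum>h\<in>J. D h * T i h))"
    by (subst sum.swap) (simp add: sum_distrib_left)
  also have "(\<Sum>c\<in>I. X c * (\<Sum>h\<in>J. of_bool (f = h) * ?R c h)) = (\<Sum>c\<in>I. X c * ?R c f)"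
    using assms by (simp only: sum_of_bool)
  also have "\<dots> = (\<Sum>c\<in>I. of_bool (c = b) * (X c * S f)) + (\<Sum>c\<in>I. \<Sum>i\<in>P. X c * Z i c * T i f)"
    by (simp add: distrib_left sum.distrib sum_distrib_left mult_ac)
  also have "(\<Sum>c\<in>I. of_bool (c = b) * (X c * S f)) = X b * S f"
    using assms by (simp only: sum_of_bool)
  also have "(\<Sum>c\<in>I. \<Sum>i\<in>P. X c * Z i c * T i f) = (\<Sum>i\<in>P. (\<Sum>c\<in>I. X c * Z i c) * T i f)"
    by (subst sum.swap) (simp add: sum_distrib_right)
  finally show ?thesis by (simp add: add_ac)
qed

lemma sum_sum_minus_swap:
  assumes "finite P"
  shows "(\<Sum>i\<in>P. \<Sum>j\<in>P - {i}. F i j) = (\<Sum>i\<in>P. \<Sum>j\<in>P - {i}. F j i)"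
proof -
  have "(\<Sum>i\<in>P. \<Sum>j\<in>P - {i}. F i j) = (\<Sum>i\<in>P. \<Sum>j\<in>{j \<in> P. j \<noteq> i}. F i j)"
    by (intro sum.cong) auto
  also have "\<dots> = (\<Sum>j\<in>P. \<Sum>i\<in>{i \<in> P. j \<noteq> i}. F i j)"
    by (rule sum.swap_restrict) (use assms in auto)
  also have "\<dots> = (\<Sum>j\<in>P. \<Sum>i\<in>P - {j}. F i j)"
    by (intro sum.cong) auto
  finally show ?thesis .
qed

text \<open>x either lands on a position still carrying the identity, which creates the new label l,
  or on the position of a label i, where it multiplies z i. Solved for the first term, this builds
  symmetrized tensors out of derivations.\<close>

lemma der_mult_sym_mat:
  assumes "finite P" "l \<notin> P" "f \<in> basis r m" "g \<in> basis r m"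
  shows "mmul (basis r m) (der x) (sym_mat P z) f g
    = sym_mat (insert l P) (z(l := x)) f g
      + (\<Sum>i\<in>P. sym_mat P (z(i := mmul (idx r) x (z i))) f g)"
proof -
  define zl where "zl = z(l := x)"
  define zi where "zi = (\<lambda>i. z(i := mmul (idx r) x (z i)))"
  have zl: "zl l = x" "\<And>i. i \<noteq> l \<Longrightarrow> zl i = z i" by (auto simp: zl_def)
  have zi: "zi i i = mmul (idx r) x (z i)" "\<And>j. j \<noteq> i \<Longrightarrow> zi i j = z j" for i
    by (auto simp: zi_def)
  have "mmul (basis r m) (der x) (sym_mat P z) f g
    = sym_mat (insert l P) zl f g + (\<Sum>i\<in>P. sym_mat P (zi i) f g)"
    using assms
  proof (induction m arbitrary: P f g)
    case 0
    then show ?case by (simp add: basis_0 mmul_def)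
  next
    case (Suc m)
    then obtain a f' b g' where fg: "f = a # f'" "g = b # g'"
      and in_basis: "a \<in> idx r" "b \<in> idx r" "f' \<in> basis r m" "g' \<in> basis r m"
      by (auto simp: basis_Suc)
    let ?D = "\<lambda>P. mmul (basis r m) (der x) (sym_mat P z) f' g'"
    have D: "?D Q = sym_mat (insert l Q) zl f' g' + (\<Sum>i\<in>Q. sym_mat Q (zi i) f' g')"
      if "Q \<subseteq> P" for Q
      using Suc.IH[of Q f' g'] that Suc.prems in_basis finite_subset by blast
    have "mmul (basis r (Suc m)) (der x) (sym_mat P z) f g
        = (\<Sum>c\<in>idx r. \<Sum>h\<in>basis r m. (of_bool (a = c) * der x f' h + x a c * of_bool (f' = h)) *
            (of_bool (c = b) * sym_mat P z h g' + (\<Sum>i\<in>P. z i c b * sym_mat (P - {i}) z h g')))"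
      unfolding mmul_def sum_basis_Suc fg by simp
    also have "\<dots> = of_bool (a = b) * ?D P + (\<Sum>i\<in>P. z i a b * ?D (P - {i}))
        + x a b * sym_mat P z f' g' + (\<Sum>i\<in>P. mmul (idx r) x (z i) a b * sym_mat (P - {i}) z f' g')"
      unfolding mmul_def
      by (rule kronecker_product) (use Suc.prems(1) in_basis in auto)
    also have "(\<Sum>i\<in>P. z i a b * ?D (P - {i}))
        = (\<Sum>i\<in>P. z i a b * sym_mat (insert l (P - {i})) zl f' g')
          + (\<Sum>i\<in>P. \<Sum>j\<in>P - {i}. z i a b * sym_mat (P - {i}) (zi j) f' g')"
      by (simp add: D distrib_left sum.distrib sum_distrib_left)
    \<comment> \<open>Exchanging i and j lets the terms be collected, label by label, into the
      expansion of \<open>sym_mat P (zi i) f g\<close>.\<close>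
    also have "(\<Sum>i\<in>P. \<Sum>j\<in>P - {i}. z i a b * sym_mat (P - {i}) (zi j) f' g')
        = (\<Sum>i\<in>P. \<Sum>j\<in>P - {i}. z j a b * sym_mat (P - {j}) (zi i) f' g')"
      by (rule sum_sum_minus_swap[OF Suc.prems(1)])
    also have "of_bool (a = b) * ?D P = of_bool (a = b) * sym_mat (insert l P) zl f' g'
        + (\<Sum>i\<in>P. of_bool (a = b) * sym_mat P (zi i) f' g')"
      by (simp add: D distrib_left sum_distrib_left)
    finally have lhs: "mmul (basis r (Suc m)) (der x) (sym_mat P z) f g
      = of_bool (a = b) * sym_mat (insert l P) zl f' g' + x a b * sym_mat P z f' g'
        + (\<Sum>i\<in>P. z i a b * sym_mat (insert l (P - {i})) zl f' g')
        + (\<Sum>i\<in>P. of_bool (a = b) * sym_mat P (zi i) f' g'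
            + mmul (idx r) x (z i) a b * sym_mat (P - {i}) z f' g'
            + (\<Sum>j\<in>P - {i}. z j a b * sym_mat (P - {j}) (zi i) f' g'))"
      by (simp only: sum.distrib add_ac)
    have 1: "sym_mat (insert l P) zl f g
        = of_bool (a = b) * sym_mat (insert l P) zl f' g' + x a b * sym_mat P z f' g'
        + (\<Sum>i\<in>P. z i a b * sym_mat (insert l (P - {i})) zl f' g')"
    proof -
      have "insert l P - {i} = insert l (P - {i})" "zl i = z i" if "i \<in> P" for i
        using that Suc.prems(2) zl(2)[of i] by auto
      moreover have "sym_mat P zl f' g' = sym_mat P z f' g'"
        by (rule sym_mat_cong) (metis zl(2) Suc.prems(2))
      moreover have "insert l P - {l} = P" using Suc.prems(2) by auto
      ultimately show ?thesis using Suc.prems(1,2) zl(1) by (simp add: fg cong: sum.cong)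
    qed
    have 2: "sym_mat P (zi i) f g = of_bool (a = b) * sym_mat P (zi i) f' g'
            + mmul (idx r) x (z i) a b * sym_mat (P - {i}) z f' g'
            + (\<Sum>j\<in>P - {i}. z j a b * sym_mat (P - {j}) (zi i) f' g')" if "i \<in> P" for i
    proof -
      have "sym_mat (P - {i}) (zi i) f' g' = sym_mat (P - {i}) z f' g'"
        by (rule sym_mat_cong) (auto simp: zi)
      moreover have "(\<Sum>j\<in>P - {i}. zi i j a b * sym_mat (P - {j}) (zi i) f' g')
          = (\<Sum>j\<in>P - {i}. z j a b * sym_mat (P - {j}) (zi i) f' g')"
        by (rule sum.cong) (auto simp: zi)
      ultimately show ?thesis
        using Suc.prems(1) that by (simp add: fg sum.remove[of P i] zi(1))
    qed
    show ?case unfolding lhs 1 by (simp add: 2 cong: sum.cong)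
  qed
  then show ?thesis by (simp add: zl_def zi_def)
qed

lemma der_add: "der (\<lambda>a b. x a b + y a b) f g = der x f g + der y f g"
  and der_smult: "der (\<lambda>a b. c * x a b) f g = c * der x f g"
  by (induction x f g rule: der.induct) (auto simp: algebra_simps)

lemma der_cong:
  assumes "\<And>a b. a \<in> idx r \<Longrightarrow> b \<in> idx r \<Longrightarrow> x a b = y a b" "f \<in> basis r m" "g \<in> basis r m"
  shows "der x f g = der y f g"
  using assms(2,3)
proof (induction m arbitrary: f g)
  case (Suc m)
  then show ?case using assms(1) by (auto simp: basis_Suc)
qed (simp add: basis_0)

text \<open>\<open>der\<close> is a Lie algebra map: contributions with x and y at different
  positions cancel in the commutator.\<close>

lemma der_mult_der:
  assumes "f \<in> basis r m" "g \<in> basis r m"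
  shows "mmul (basis r m) (der x) (der y) f g - mmul (basis r m) (der y) (der x) f g
    = der (\<lambda>a b. mmul (idx r) x y a b - mmul (idx r) y x a b) f g"
  using assms
proof (induction m arbitrary: f g)
  case 0
  then show ?case by (simp add: basis_0 mmul_def)
next
  case (Suc m)
  then obtain a f' b g' where fg: "f = a # f'" "g = b # g'"
    and in_basis: "a \<in> idx r" "b \<in> idx r" "f' \<in> basis r m" "g' \<in> basis r m"
    by (auto simp: basis_Suc)
  have *: "mmul (basis r (Suc m)) (der x) (der y) f g
      = of_bool (a = b) * mmul (basis r m) (der x) (der y) f' g' + y a b * der x f' g'
        + x a b * der y f' g' + mmul (idx r) x y a b * of_bool (f' = g')" for x y
  proof -
    \<comment> \<open>The one-point index set presents y \<otimes> 1 as the sum that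
      \<open>kronecker_product\<close> expects.\<close>
    have "mmul (basis r (Suc m)) (der x) (der y) f g
      = (\<Sum>c\<in>idx r. \<Sum>h\<in>basis r m. (of_bool (a = c) * der x f' h + x a c * of_bool (f' = h)) *
            (of_bool (c = b) * der y h g' + (\<Sum>i\<in>{()}. y c b * of_bool (h = g'))))"
      unfolding mmul_def sum_basis_Suc fg by simp
    also have "\<dots> = of_bool (a = b) * mmul (basis r m) (der x) (der y) f' g'
        + (\<Sum>i\<in>{()}. y a b * (\<Sum>h\<in>basis r m. der x f' h * of_bool (h = g')))
        + x a b * der y f' g' + (\<Sum>i\<in>{()}. mmul (idx r) x y a b * of_bool (f' = g'))"
      unfolding mmul_def by (rule kronecker_product) (use in_basis in auto)
    finally show ?thesis using in_basis by (simp add: sum_of_bool)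
  qed
  show ?case
    unfolding * using Suc.IH[OF in_basis(3,4)]
    by (auto simp: fg algebra_simps)
qed

lemma der_id:
  assumes "length f = length g"
  shows "der (\<lambda>a b. of_bool (a = b)) f g = of_nat (length f) * of_bool (f = g)"
  using assms by (induction f g rule: list_induct2) (auto simp: algebra_simps)

text \<open>These span the centralizer of the sign change on letters; \<open>ymat 0 0\<close> is
  twice a matrix unit.\<close>

definition ymat :: "rat \<Rightarrow> rat \<Rightarrow> site" where
  "ymat a b x y = of_bool (x = a \<and> y = b) + of_bool (x = - a \<and> y = - b)"

lemma ymat_mult:
  assumes "b \<in> idx r"
  shows "mmul (idx r) (ymat a b) (ymat c d) x y
    = of_bool (b = c) * ymat a d x y + of_bool (b = - c) * ymat a (- d) x y"
proof -
  have "mmul (idx r) (ymat a b) (ymat c d) x y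
      = (\<Sum>z\<in>idx r. of_bool (b = z) * (of_bool (x = a) * ymat c d z y))
        + (\<Sum>z\<in>idx r. of_bool (- b = z) * (of_bool (x = - a) * ymat c d z y))"
    unfolding mmul_def sum.distrib[symmetric]
    by (rule sum.cong) (auto simp: ymat_def)
  also have "\<dots> = of_bool (x = a) * ymat c d b y + of_bool (x = - a) * ymat c d (- b) y"
    using assms idx_uminus by (simp only: sum_of_bool finite_idx)
  also have "\<dots> = of_bool (b = c) * ymat a d x y + of_bool (b = - c) * ymat a (- d) x y"
    by (auto simp: ymat_def)
  finally show ?thesis .
qed

section \<open>Limits of a matrix algebra and the derivations among them\<close>

locale matrix_algebra =
  fixes A :: "(rat list \<Rightarrow> rat list \<Rightarrow> Qpq) set" and r m :: nat
  assumes one: "(\<lambda>f g. of_bool (f = g)) \<in> A"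
    and add: "b \<in> A \<Longrightarrow> c \<in> A \<Longrightarrow> (\<lambda>f g. b f g + c f g) \<in> A"
    and smult: "b \<in> A \<Longrightarrow> (\<lambda>f g. s * b f g) \<in> A"
    and mult: "b \<in> A \<Longrightarrow> c \<in> A \<Longrightarrow> mmul (basis r m) b c \<in> A"
begin

text \<open>Specializations of those elements of A that are regular at p = q = 1. They form a
  rational algebra, hence are closed under commutators.\<close>

definition limits :: "(rat list \<Rightarrow> rat list \<Rightarrow> rat) set" where
  "limits = {X. \<exists>b\<in>A. \<forall>f\<in>basis r m. \<forall>g\<in>basis r m. spec (b f g) (X f g)}"

lemma limitsI: "b \<in> A \<Longrightarrow> (\<And>f g. f \<in> basis r m \<Longrightarrow> g \<in> basis r m \<Longrightarrow> spec (b f g) (X f g)) \<Longrightarrow> X \<in> limits"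
  by (auto simp: limits_def)

lemma limits_cong:
  assumes "X \<in> limits" "\<And>f g. f \<in> basis r m \<Longrightarrow> g \<in> basis r m \<Longrightarrow> X f g = Y f g"
  shows "Y \<in> limits"
  using assms by (auto simp: limits_def)

lemma limits_one: "(\<lambda>f g. of_bool (f = g)) \<in> limits"
  by (rule limitsI[OF one]) (rule spec_of_bool)

lemma limits_add:
  assumes "X \<in> limits" "Y \<in> limits"
  shows "(\<lambda>f g. X f g + Y f g) \<in> limits"
proof -
  obtain b c where "b \<in> A" "\<forall>f\<in>basis r m. \<forall>g\<in>basis r m. spec (b f g) (X f g)"
    "c \<in> A" "\<forall>f\<in>basis r m. \<forall>g\<in>basis r m. spec (c f g) (Y f g)"
    using assms by (auto simp: limits_def)
  then show ?thesis by (intro limitsI[OF add[of b c]] spec_add) auto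
qed

lemma limits_smult:
  assumes "X \<in> limits"
  shows "(\<lambda>f g. s * X f g) \<in> limits"
proof -
  obtain b where "b \<in> A" "\<forall>f\<in>basis r m. \<forall>g\<in>basis r m. spec (b f g) (X f g)"
    using assms by (auto simp: limits_def)
  then show ?thesis by (intro limitsI[OF smult[of b "Fract [:[:s:]:] 1"]] spec_mult spec_const) auto
qed

lemma limits_diff:
  assumes "X \<in> limits" "Y \<in> limits"
  shows "(\<lambda>f g. X f g - Y f g) \<in> limits"
  using limits_add[OF assms(1) limits_smult[OF assms(2), of "-1"]] by simp

lemma limits_mult:
  assumes "X \<in> limits" "Y \<in> limits"
  shows "mmul (basis r m) X Y \<in> limits"
proof -
  obtain b c where "b \<in> A" "\<forall>f\<in>basis r m. \<forall>g\<in>basis r m. spec (b f g) (X f g)"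
    "c \<in> A" "\<forall>f\<in>basis r m. \<forall>g\<in>basis r m. spec (c f g) (Y f g)"
    using assms by (auto simp: limits_def)
  then show ?thesis
    by (intro limitsI[OF mult[of b c]]) (auto simp: mmul_def intro!: spec_sum spec_mult)
qed

lemma limits_sum:
  "(\<And>i. i \<in> I \<Longrightarrow> X i \<in> limits) \<Longrightarrow> (\<lambda>f g. \<Sum>i\<in>I. X i f g) \<in> limits"
proof (induction I rule: infinite_finite_induct)
  case (insert i I)
  then show ?case using limits_add[of "X i" "\<lambda>f g. \<Sum>i\<in>I. X i f g"] by simp
qed (use limits_smult[OF limits_one, of 0] in simp_all)

definition lie :: "site \<Rightarrow> bool" where
  "lie x \<longleftrightarrow> der x \<in> limits"

lemma lie_cong:
  assumes "lie x" "\<And>a b. a \<in> idx r \<Longrightarrow> b \<in> idx r \<Longrightarrow> x a b = y a b"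
  shows "lie y"
  using assms limits_cong[of "der x" "der y"] der_cong[of r x y] by (auto simp: lie_def)

lemma lie_add: "lie x \<Longrightarrow> lie y \<Longrightarrow> lie (\<lambda>a b. x a b + y a b)"
  unfolding lie_def by (drule (1) limits_add, erule limits_cong) (simp add: der_add)

lemma lie_smult: "lie x \<Longrightarrow> lie (\<lambda>a b. s * x a b)"
  unfolding lie_def by (drule limits_smult[of _ s], erule limits_cong) (simp add: der_smult)

lemma lie_diff: "lie x \<Longrightarrow> lie y \<Longrightarrow> lie (\<lambda>a b. x a b - y a b)"
  using lie_add[OF _ lie_smult[of y "-1"], of x] by simp

lemma lie_sum: "(\<And>i. i \<in> I \<Longrightarrow> lie (x i)) \<Longrightarrow> lie (\<lambda>a b. \<Sum>i\<in>I. x i a b)"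
proof (induction I rule: infinite_finite_induct)
  case (insert i I)
  then show ?case using lie_add[of "x i" "\<lambda>a b. \<Sum>i\<in>I. x i a b"] by simp
next
  case empty
  have "(\<lambda>f g. 0) \<in> limits" using limits_smult[OF limits_one, of 0] by simp
  moreover have "der (\<lambda>a b. 0) f g = 0" for f g using der_smult[of 0 "\<lambda>a b. 0" f g] by simp
  ultimately show ?case by (simp add: lie_def fun_eq_iff limits_cong)
next
  case (infinite I)
  have "(\<lambda>f g. 0) \<in> limits" using limits_smult[OF limits_one, of 0] by simp
  moreover have "der (\<lambda>a b. 0) f g = 0" for f g using der_smult[of 0 "\<lambda>a b. 0" f g] by simp
  ultimately show ?case using infinite by (simp add: lie_def fun_eq_iff limits_cong)
qed

lemma lie_bracket:
  assumes "lie x" "lie y"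
  shows "lie (\<lambda>a b. mmul (idx r) x y a b - mmul (idx r) y x a b)"
proof -
  have "(\<lambda>f g. mmul (basis r m) (der x) (der y) f g - mmul (basis r m) (der y) (der x) f g) \<in> limits"
    using assms by (intro limits_diff limits_mult) (simp_all add: lie_def)
  then show ?thesis
    unfolding lie_def by (rule limits_cong) (rule der_mult_der)
qed

text \<open>Supplies the trace: the raising, lowering and Cartan derivations used below are
  traceless, while the identity comes from the scalars in A.\<close>

lemma lie_id: "lie (\<lambda>a b. of_bool (a = b))"
  unfolding lie_def
  by (rule limits_cong[OF limits_smult[OF limits_one, of "of_nat m"]])
    (subst der_id; simp add: basis_def)

abbreviation yint :: "int \<Rightarrow> int \<Rightarrow> site" where
  "yint k l \<equiv> ymat (of_int k) (of_int l)"

abbreviation ybracket :: "int \<Rightarrow> int \<Rightarrow> int \<Rightarrow> int \<Rightarrow> site" where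
  "ybracket k l k' l' \<equiv> (\<lambda>x y. of_bool (l = k') * yint k l' x y + of_bool (l = - k') * yint k (- l') x y
    - of_bool (l' = k) * yint k' l x y - of_bool (l' = - k) * yint k' (- l) x y)"

lemma lie_ybracket:
  assumes "lie (yint k l)" "lie (yint k' l')" "\<bar>l\<bar> \<le> int r" "\<bar>l'\<bar> \<le> int r"
  shows "lie (ybracket k l k' l')"
proof (rule lie_cong[OF lie_bracket[OF assms(1,2)]])
  have "rat_of_int l \<in> idx r" "rat_of_int l' \<in> idx r"
    using assms(3,4) by (auto simp: idx_def)
  moreover have "rat_of_int l = - of_int k' \<longleftrightarrow> l = - k'" "rat_of_int l' = - of_int k \<longleftrightarrow> l' = - k"
    by (simp_all flip: of_int_minus)
  ultimately show "mmul (idx r) (yint k l) (yint k' l') a b - mmul (idx r) (yint k' l') (yint k l) a b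
      = ybracket k l k' l' a b" for a b
    by (simp add: ymat_mult)
qed

lemma yint_uminus: "yint (- k) (- l) = yint k l"
  by (auto simp: ymat_def fun_eq_iff)

context
  assumes r: "r \<ge> 1"
    and up: "\<And>c. 0 \<le> c \<Longrightarrow> c < int r \<Longrightarrow> lie (yint c (c + 1))"
    and down: "\<And>c. 0 \<le> c \<Longrightarrow> c < int r \<Longrightarrow> lie (yint (c + 1) c)"
    and cartan: "\<And>c. 0 \<le> c \<Longrightarrow> c < int r \<Longrightarrow> lie (\<lambda>x y. yint c c x y - yint (c + 1) (c + 1) x y)"
begin

lemma lie_diagonal:
  assumes "\<bar>c\<bar> \<le> int r"
  shows "lie (yint c c)"
proof -
  have nat: "lie (\<lambda>x y. yint 0 0 x y - yint (int n) (int n) x y)" if "n \<le> r" for n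
    using that
  proof (induction n)
    case 0
    then show ?case using lie_smult[OF lie_id, of 0] by simp
  next
    case (Suc n)
    have "lie (\<lambda>x y. (yint 0 0 x y - yint (int n) (int n) x y)
        + (yint (int n) (int n) x y - yint (int n + 1) (int n + 1) x y))"
      by (rule lie_add[OF Suc.IH cartan]) (use Suc.prems in auto)
    then show ?case by (simp add: add.commute)
  qed
  have diff: "lie (\<lambda>x y. yint 0 0 x y - yint c c x y)" if "\<bar>c\<bar> \<le> int r" for c
  proof (cases "c \<ge> 0")
    case True
    then show ?thesis using nat[of "nat c"] that by simp
  next
    case False
    then show ?thesis using nat[of "nat (- c)"] that yint_uminus[of c c] by simp
  qed
  let ?I = "{- int r..int r}"
  \<comment> \<open>The y_cc with c from -r to r add up to twice the identity, so this element is
    (2r+1) y_00; the differences then give every other y_cc.\<close>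
  have *: "lie (\<lambda>x y. (\<Sum>c\<in>?I. yint 0 0 x y - yint c c x y) + 2 * of_bool (x = y))"
    by (intro lie_add lie_sum lie_smult lie_id diff) auto
  have diag: "(\<Sum>c\<in>?I. yint c c x y) = 2 * of_bool (x = y)" if x: "x \<in> idx r" for x y
  proof -
    obtain k where k: "x = of_int k" "k \<in> ?I" using x by (fastforce simp: idx_def)
    have "(\<Sum>c\<in>?I. yint c c x y) = (\<Sum>c\<in>?I. of_bool (x = y) * of_bool (c = k)) + (\<Sum>c\<in>?I. of_bool (x = y) * of_bool (c = - k))"
      unfolding sum.distrib[symmetric]
      by (rule sum.cong) (auto simp: ymat_def k(1) simp flip: of_int_minus)
    also have "\<dots> = 2 * of_bool (x = y)"
      using k(2) by (subst (1 2) sum_of_bool) auto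
    finally show ?thesis .
  qed
  define N :: rat where "N = of_nat (card ?I)"
  have "N \<noteq> 0" by (simp add: N_def)
  have "lie (\<lambda>x y. N * yint 0 0 x y)"
    by (rule lie_cong[OF *]) (simp add: sum_subtractf diag N_def)
  from lie_smult[OF this, of "inverse N"] have "lie (yint 0 0)"
    using \<open>N \<noteq> 0\<close> by (simp add: field_simps)
  from lie_diff[OF this diff[OF assms]] show ?thesis by simp
qed

text \<open>Matrix units by iterated brackets: [y_{a,b}, y_{b,b+1}] = y_{a,b+1}, and likewise
  downwards; b > 0 keeps the sign-twisted terms of the bracket away.\<close>

lemma lie_nonneg:
  assumes "0 \<le> a" "a \<le> int r" "0 \<le> b" "b \<le> int r"
  shows "lie (yint a b)"
proof -
  have "lie (yint a (a + 1 + int n)) \<and> lie (yint (a + 1 + int n) a)" if "0 \<le> a" "a + 1 + int n \<le> int r" for a n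
    using that
  proof (induction n)
    case 0
    then show ?case using up[of a] down[of a] by simp
  next
    case (Suc n)
    let ?b = "a + 1 + int n"
    have "lie (ybracket a ?b ?b (?b + 1))"
      by (rule lie_ybracket) (use Suc up[of ?b] in auto)
    moreover have "lie (ybracket (?b + 1) ?b ?b a)"
      by (rule lie_ybracket) (use Suc down[of ?b] in auto)
    ultimately show ?case using Suc.prems by (simp add: algebra_simps)
  qed
  from this[of a "nat (b - a - 1)"] this[of b "nat (a - b - 1)"] lie_diagonal[of a] assms
  show ?thesis by (cases a b rule: linorder_cases) auto
qed

text \<open>Signs are crossed at the index 0, which is its own negative: [y_{1,0}, y_{0,1}] contains
  y_{1,-1} besides diagonal terms. Further brackets carry y_{1,-1} to all a and b.\<close>

lemma lie_nonneg_neg: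
  assumes "0 \<le> a" "a \<le> int r" "0 \<le> b" "b \<le> int r"
  shows "lie (yint a (- b))"
proof -
  have "lie (ybracket 1 0 0 1)"
    by (rule lie_ybracket) (use lie_nonneg[of 1 0] lie_nonneg[of 0 1] r in auto)
  moreover have "ybracket 1 0 0 1 = (\<lambda>x y. yint 1 1 x y + yint 1 (- 1) x y - yint 0 0 x y)"
    by (simp add: fun_eq_iff)
  ultimately have "lie (\<lambda>x y. yint 1 1 x y + yint 1 (- 1) x y - yint 0 0 x y)" by metis
  from lie_diff[OF lie_add[OF this lie_diagonal[of 0]] lie_diagonal[of 1]] r
  have 11: "lie (yint 1 (- 1))" by simp
  have 1: "lie (yint a (- 1))" if "1 \<le> a" "a \<le> int r" for a
  proof (cases "a = 1")
    case False
    have "lie (ybracket a 1 1 (- 1))"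
      by (rule lie_ybracket) (use lie_nonneg[of a 1] 11 that in auto)
    then show ?thesis using that False by simp
  qed (use 11 in simp)
  consider "a = 0" | "b = 0" | "1 \<le> a" "1 \<le> b" using assms by linarith
  then show ?thesis
  proof cases
    case 1
    then show ?thesis using lie_nonneg[of 0 b] yint_uminus[of 0 b] assms by simp
  next
    case 2
    then show ?thesis using lie_nonneg[of a 0] assms by simp
  next
    case 3
    show ?thesis
    proof (cases "b = 1")
      case True
      then show ?thesis using 1 3 assms by simp
    next
      case False
      have "lie (ybracket a (- 1) 1 b)"
        by (rule lie_ybracket) (use lie_nonneg[of 1 b] 1 3 assms in auto)
      \<comment> \<open>For a = b the bracket also contains -y_{1,-1}, which is added back.\<close>
      then have "lie (\<lambda>x y. ybracket a (- 1) 1 b x y + of_bool (a = b) * yint 1 (- 1) x y)"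
        by (rule lie_add[OF _ lie_smult[OF 11]])
      then show ?thesis using 3 by (auto simp: eq_commute[of b a])
    qed
  qed
qed

lemma lie_ymat:
  assumes "a \<in> idx r" "b \<in> idx r"
  shows "lie (ymat a b)"
proof -
  have "lie (yint k l)" if "\<bar>k\<bar> \<le> int r" "\<bar>l\<bar> \<le> int r" for k l
  proof -
    consider "0 \<le> k" "0 \<le> l" | "0 \<le> k" "l < 0" | "k < 0" "0 \<le> l" | "k < 0" "l < 0" by linarith
    then show ?thesis
      by cases (use that lie_nonneg[of k l] lie_nonneg_neg[of k "- l"] lie_nonneg_neg[of "- k" l]
          lie_nonneg[of "- k" "- l"] yint_uminus[of k l] yint_uminus[of "- k" l] in auto)
  qed
  moreover obtain k l where "a = of_int k" "b = of_int l" "\<bar>k\<bar> \<le> int r" "\<bar>l\<bar> \<le> int r"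
    using assms by (fastforce simp: idx_def)
  ultimately show ?thesis by simp
qed

end

end

section \<open>Symmetrized tensors and orbits of pairs of words\<close>

definition zinv :: "site \<Rightarrow> bool" where
  "zinv x \<longleftrightarrow> (\<forall>a b. x (- a) (- b) = x a b)"

lemma zinv_ymat: "zinv (ymat a b)"
proof -
  have "- x = a \<longleftrightarrow> x = - a" for x a :: rat by auto
  then show ?thesis by (simp add: zinv_def ymat_def add.commute)
qed

lemma zinv_mmul:
  assumes "zinv x" "zinv y"
  shows "zinv (mmul (idx r) x y)"
  unfolding zinv_def
proof (intro allI)
  fix a b
  have "uminus ` idx r = idx r"
  proof
    show "idx r \<subseteq> uminus ` idx r"
      using idx_uminus by (metis image_eqI minus_minus subsetI)
  qed (auto intro: idx_uminus)
  then have "mmul (idx r) x y (- a) (- b) = (\<Sum>c\<in>uminus ` idx r. x (- a) c * y c (- b))"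
    by (simp add: mmul_def)
  also have "\<dots> = (\<Sum>c\<in>idx r. x (- a) (- c) * y (- c) (- b))"
    by (subst sum.reindex) (auto simp: inj_on_def)
  finally show "mmul (idx r) x y (- a) (- b) = mmul (idx r) x y a b"
    using assms by (simp add: zinv_def mmul_def)
qed

lemma sym_mat_eq_0:
  assumes "finite P" "length f < card P" "length f = length g"
  shows "sym_mat P z f g = 0"
  using assms(3,1,2)
proof (induction f g arbitrary: P rule: list_induct2)
  case (Cons a f b g)
  have "sym_mat (P - {i}) z f g = 0" if "i \<in> P" for i
    by (rule Cons.IH) (use Cons.prems that in auto)
  then show ?case using Cons by simp
qed auto

lemma sym_mat_nonneg:
  assumes "\<And>i a b. z i a b \<ge> 0" "length f = length g"
  shows "sym_mat P z f g \<ge> 0"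
  using assms(2)
  by (induction f g arbitrary: P rule: list_induct2) (auto intro!: add_nonneg_nonneg sum_nonneg simp: assms(1))

text \<open>The injection sending each label to its own position contributes a positive product, and
  no contribution is negative. The offset k keeps labels aligned with positions as letters are
  stripped off.\<close>

lemma sym_mat_pos:
  assumes "\<And>i a b. z i a b \<ge> 0" "length f = length g"
    and "\<And>j. j < length f \<Longrightarrow> z (k + j) (f ! j) (g ! j) > 0"
  shows "sym_mat {k..<k + length f} z f g > 0"
  using assms(2,3)
proof (induction f g arbitrary: k rule: list_induct2)
  case (Cons a f b g)
  let ?P = "{k..<k + length (a # f)}"
  have "sym_mat {Suc k..<Suc k + length f} z f g > 0"
    by (rule Cons.IH) (use Cons.prems[of "Suc _"] in auto)
  moreover have "?P - {k} = {Suc k..<Suc k + length f}" by auto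
  ultimately have "z k a b * sym_mat (?P - {k}) z f g > 0"
    using Cons.prems[of 0] by simp
  then have "(\<Sum>i\<in>?P. z i a b * sym_mat (?P - {i}) z f g) > 0"
    using Cons.hyps by (intro sum_pos2[of _ k]) (auto intro!: mult_nonneg_nonneg sym_mat_nonneg assms(1))
  moreover have "of_bool (a = b) * sym_mat ?P z f g \<ge> 0"
    using Cons.hyps by (auto intro!: sym_mat_nonneg assms(1))
  ultimately show ?case by (simp add: add_nonneg_pos)
qed simp

text \<open>Orbits of the Weyl group on pairs of words are multisets of letter pairs up to a common
  sign in each pair; the lexicographic maximum is the normal form for that sign.\<close>

definition pair_abs :: "rat \<times> rat \<Rightarrow> rat \<times> rat" where
  "pair_abs p = max p (- fst p, - snd p)"

lemma ymat_pair_abs: "ymat c d a b \<noteq> 0 \<Longrightarrow> pair_abs (b, a) = pair_abs (d, c)"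
proof -
  assume "ymat c d a b \<noteq> 0"
  then have "a = c \<and> b = d \<or> a = - c \<and> b = - d" by (auto simp: ymat_def)
  then show ?thesis by (auto simp: pair_abs_def max.commute)
qed

text \<open>With as many labels as positions, \<open>sym_mat_eq_0\<close> leaves no position for an
  identity. A nonzero entry therefore contains a bijection between labels and positions along which
  letter pairs agree up to sign.\<close>

lemma sym_mat_mset:
  assumes "finite P" "card P = length f" "length f = length g"
    and "sym_mat P (\<lambda>i. ymat (c i) (d i)) f g \<noteq> 0"
  shows "image_mset (\<lambda>i. pair_abs (d i, c i)) (mset_set P) = image_mset pair_abs (mset (zip g f))"
  using assms(3,1,2,4)
proof (induction f g arbitrary: P rule: list_induct2)
  case (Cons a f b g)
  let ?z = "\<lambda>i. ymat (c i) (d i)"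
  have "sym_mat P ?z f g = 0"
    by (rule sym_mat_eq_0) (use Cons in auto)
  then have "(\<Sum>i\<in>P. ?z i a b * sym_mat (P - {i}) ?z f g) \<noteq> 0"
    using Cons.prems(3) by simp
  then obtain i where "i \<in> P" "?z i a b * sym_mat (P - {i}) ?z f g \<noteq> 0"
    by (rule sum.not_neutral_contains_not_neutral)
  then have i: "i \<in> P" "?z i a b \<noteq> 0" "sym_mat (P - {i}) ?z f g \<noteq> 0"
    by simp_all
  have "image_mset (\<lambda>i. pair_abs (d i, c i)) (mset_set (P - {i})) = image_mset pair_abs (mset (zip g f))"
    by (rule Cons.IH) (use Cons.prems i in auto)
  moreover have "mset_set P = add_mset i (mset_set (P - {i}))"
    using Cons.prems(1) i(1) by (simp add: mset_set.remove)
  ultimately show ?case using ymat_pair_abs[OF i(2)] by simp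
qed simp

text \<open>With g listed first, dominance becomes lexicographic order: ties in g, and a first
  letter 0 of g, are settled by f. A dominant pair is thus the sorted list of its normalized letter
  pairs and can be read off its multiset.\<close>

lemma dom_pairs_sorted:
  assumes "(f, g) \<in> dom_pairs r m"
  shows "sorted (zip g f)" and "p \<in> set (zip g f) \<Longrightarrow> pair_abs p = p"
proof -
  have len: "length f = m" "length g = m"
    and dom: "\<And>i. i < m \<Longrightarrow> \<not> desc i g" "\<And>i. i < m \<Longrightarrow> weyl_act g i = g \<Longrightarrow> \<not> desc i f"
    using assms by (auto simp: dom_pairs_def basis_def)
  show sorted: "sorted (zip g f)"
    unfolding sorted_iff_nth_Suc
  proof (intro allI impI)
    fix i assume "Suc i < length (zip g f)"
    then have i: "Suc i < m" using len by simp
    show "zip g f ! i \<le> zip g f ! Suc i"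
      using dom(1)[OF i] dom(2)[OF i] i len weyl_act_fixed_iff[of "Suc i" g]
      by (auto simp: desc_def less_eq_prod_simp)
  qed
  show "pair_abs p = p" if "p \<in> set (zip g f)"
  proof -
    have "m > 0" using that len by auto
    then have "(0, 0) \<le> zip g f ! 0"
      using dom[of 0] len weyl_act_fixed_iff[of 0 g] by (auto simp: desc_def less_eq_prod_simp)
    also have "zip g f ! 0 \<le> p"
      using that sorted by (metis in_set_conv_nth le0 sorted_nth_mono)
    finally show ?thesis
      by (cases p) (auto simp: pair_abs_def max_def less_eq_prod_simp)
  qed
qed

lemma dom_pairs_unique:
  assumes "(f, g) \<in> dom_pairs r m" "(f', g') \<in> dom_pairs r m"
    and "image_mset pair_abs (mset (zip g f)) = image_mset pair_abs (mset (zip g' f'))"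
  shows "f = f' \<and> g = g'"
proof -
  have "image_mset pair_abs (mset (zip g f)) = mset (zip g f)" if "(f, g) \<in> dom_pairs r m" for f g
    using dom_pairs_sorted(2)[OF that] by (simp flip: mset_map add: map_idI)
  with assms have "mset (zip g f) = mset (zip g' f')" by simp
  then have "zip g f = zip g' f'"
    using assms(1,2) dom_pairs_sorted(1) by (metis properties_for_sort sorted_sort_id)
  moreover have "length f = m" "length g = m" "length f' = m" "length g' = m"
    using assms(1,2) by (auto simp: dom_pairs_def basis_def)
  ultimately show ?thesis by (metis map_fst_zip map_snd_zip)
qed

text \<open>\<open>interpolation\<close> finds b in A with the entries of x on
  \<open>dom_pairs\<close>; then x - b commutes with the \<open>hmat i\<close> and is zero by
  \<open>commuting_eq_0\<close>.\<close>

lemma (in matrix_algebra) commutant_subset: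
  assumes lie: "\<And>a b. a \<in> idx r \<Longrightarrow> b \<in> idx r \<Longrightarrow> lie (ymat a b)"
    and A_comm: "\<And>b i f g. b \<in> A \<Longrightarrow> i < m \<Longrightarrow> f \<in> basis r m \<Longrightarrow> g \<in> basis r m \<Longrightarrow>
      mmul (basis r m) b (hmat i) f g = mmul (basis r m) (hmat i) b f g"
    and x_comm: "\<And>i f g. i < m \<Longrightarrow> f \<in> basis r m \<Longrightarrow> g \<in> basis r m \<Longrightarrow>
      mmul (basis r m) x (hmat i) f g = mmul (basis r m) (hmat i) x f g"
  shows "\<exists>b\<in>A. \<forall>f\<in>basis r m. \<forall>g\<in>basis r m. b f g = x f g"
proof -
  have lie_zinv: "lie z" if z: "zinv z" for z
  proof (rule lie_cong)
    \<comment> \<open>The factor 1/2 is due to each entry of z being met twice, at (a, b) and at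
      (-a, -b).\<close>
    show "lie (\<lambda>x y. \<Sum>a\<in>idx r. \<Sum>b\<in>idx r. (z a b / 2) * ymat a b x y)"
      by (intro lie_sum lie_smult lie)
    fix x y assume xy: "x \<in> idx r" "y \<in> idx r"
    have "(\<Sum>a\<in>idx r. \<Sum>b\<in>idx r. (z a b / 2) * ymat a b x y)
        = (\<Sum>a\<in>idx r. of_bool (x = a) * (\<Sum>b\<in>idx r. of_bool (y = b) * (z a b / 2)))
          + (\<Sum>a\<in>idx r. of_bool (- x = a) * (\<Sum>b\<in>idx r. of_bool (- y = b) * (z a b / 2)))"
      unfolding sum.distrib[symmetric] sum_distrib_left
      by (intro sum.cong) (auto simp: ymat_def)
    also have "\<dots> = z x y / 2 + z (- x) (- y) / 2"
      using xy idx_uminus by (simp only: sum_of_bool finite_idx)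
    finally show "(\<Sum>a\<in>idx r. \<Sum>b\<in>idx r. (z a b / 2) * ymat a b x y) = z x y"
      using z by (simp add: zinv_def)
  qed
  have sym: "sym_mat P z \<in> limits" if "finite P" "\<And>i. zinv (z i)" for P z
    using that
  proof (induction P arbitrary: z rule: finite_induct)
    case empty
    show ?case
      by (rule limits_cong[OF limits_one]) (simp add: sym_mat_empty basis_def)
  next
    case (insert l P)
    \<comment> \<open>\<open>der_mult_sym_mat\<close> solved for the tensor with one more label; the
      corrections carry only the labels of P and their sites stay in \<open>zinv\<close>.\<close>
    have "(\<lambda>f g. mmul (basis r m) (der (z l)) (sym_mat P z) f g
        - (\<Sum>i\<in>P. sym_mat P (z(i := mmul (idx r) (z l) (z i))) f g)) \<in> limits"
      using lie_zinv[OF insert.prems] insert.prems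
      by (intro limits_diff limits_mult limits_sum insert.IH) (auto simp: lie_def zinv_mmul)
    then show ?case
      by (rule limits_cong) (use der_mult_sym_mat[OF insert.hyps, of _ r m _ "z l" z] in simp)
  qed
  \<comment> \<open>The limit attached to the pair i, evaluated at the pair j: the square array that
    has to be diagonal.\<close>
  define d where "d = (\<lambda>(f, g) (f', g'). sym_mat {..<m} (\<lambda>i. ymat (f ! i) (g ! i)) f' g')"
  have "\<exists>a\<in>case_prod ` A. \<forall>j\<in>dom_pairs r m. a j = case_prod x j"
  proof (rule interpolation)
    have "dom_pairs r m \<subseteq> basis r m \<times> basis r m" by (auto simp: dom_pairs_def)
    then show "finite (dom_pairs r m)" by (rule finite_subset) simp
  next
    fix a b assume "a \<in> case_prod ` A" "b \<in> case_prod ` A"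
    then obtain a' b' where "a = case_prod a'" "b = case_prod b'" "a' \<in> A" "b' \<in> A" by auto
    then show "(\<lambda>x. a x + b x) \<in> case_prod ` A"
      using imageI[OF add[of a' b'], of case_prod] by (simp add: case_prod_unfold)
  next
    fix a s assume "a \<in> case_prod ` A"
    then obtain a' where "a = case_prod a'" "a' \<in> A" by auto
    then show "(\<lambda>x. s * a x) \<in> case_prod ` A"
      using imageI[OF smult[of a' s], of case_prod] by (simp add: case_prod_unfold)
  next
    show "case_prod ` A \<noteq> {}" using one by auto
  next
    fix i assume "i \<in> dom_pairs r m"
    obtain f g where i: "i = (f, g)" by (cases i)
    have "sym_mat {..<m} (\<lambda>i. ymat (f ! i) (g ! i)) \<in> limits"
      by (rule sym) (auto simp: zinv_ymat)
    then obtain b where "b \<in> A" "\<And>f' g'. f' \<in> basis r m \<Longrightarrow> g' \<in> basis r m \<Longrightarrow> spec (b f' g') (d i (f', g'))"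
      by (auto simp: limits_def d_def i)
    then show "\<exists>a\<in>case_prod ` A. \<forall>j\<in>dom_pairs r m. spec (a j) (d i j)"
      by (intro bexI[of _ "case_prod b"]) (auto simp: dom_pairs_def)
  next
    fix i assume i: "i \<in> dom_pairs r m"
    obtain f g where fg: "i = (f, g)" by (cases i)
    then have "length f = m" "length g = m" using i by (auto simp: dom_pairs_def basis_def)
    moreover have "ymat a b a b > 0" "ymat a b a' b' \<ge> 0" for a b a' b'
      by (simp_all add: ymat_def add_pos_nonneg)
    ultimately show "d i i \<noteq> 0"
      using sym_mat_pos[of "\<lambda>i. ymat (f ! i) (g ! i)" f g 0]
      by (simp add: d_def fg atLeast0LessThan)
  next
    fix i j assume ij: "i \<in> dom_pairs r m" "j \<in> dom_pairs r m" "i \<noteq> j"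
    obtain f g f' g' where fg: "i = (f, g)" "j = (f', g')" by (cases i; cases j)
    have len: "length f = m" "length g = m" "length f' = m" "length g' = m"
      using ij fg by (auto simp: dom_pairs_def basis_def)
    show "d i j = 0"
    proof (rule ccontr)
      assume "d i j \<noteq> 0"
      then have "image_mset (\<lambda>i. pair_abs (g ! i, f ! i)) (mset_set {..<m}) = image_mset pair_abs (mset (zip g' f'))"
        using len by (intro sym_mat_mset) (auto simp: d_def fg)
      moreover have "zip g f = map (\<lambda>i. (g ! i, f ! i)) [0..<m]"
        by (rule nth_equalityI) (use len in auto)
      then have "mset (zip g f) = image_mset (\<lambda>i. (g ! i, f ! i)) (mset_set {..<m})"
        by (simp add: mset_map atLeast0LessThan)
      ultimately have "image_mset pair_abs (mset (zip g f)) = image_mset pair_abs (mset (zip g' f'))"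
        by (simp add: multiset.map_comp comp_def)
      then show False using dom_pairs_unique ij fg by blast
    qed
  qed
  then obtain b where b: "b \<in> A" "\<And>f g. (f, g) \<in> dom_pairs r m \<Longrightarrow> b f g = x f g"
    by fastforce
  have "x f g - b f g = 0" if "f \<in> basis r m" "g \<in> basis r m" for f g
  proof (rule commuting_eq_0[where x = "\<lambda>f g. x f g - b f g"])
    fix i f g assume "i < m" "f \<in> basis r m" "g \<in> basis r m"
    then show "mmul (basis r m) (\<lambda>f g. x f g - b f g) (hmat i) f g
        = mmul (basis r m) (hmat i) (\<lambda>f g. x f g - b f g) f g"
      using A_comm[OF b(1), of i f g] x_comm[of i f g]
      by (simp add: mmul_def left_diff_distrib right_diff_distrib sum_subtractf)
  qed (use b that in auto)
  then show ?thesis using b(1) by (intro bexI[of _ b]) auto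
qed

section \<open>Matrices of the two actions\<close>

lemma lookup_linop:
  assumes "linop F" "v \<in> tensor_space r m"
  shows "lookup (F v) f = (\<Sum>h\<in>basis r m. lookup v h * lookup (F (M h)) f)"
  using assms lookup_lin[of "basis r m" v "\<lambda>a. F (Poly_Mapping.single a 1)" f]
  by (simp add: linop_eq_lin[OF assms(1), of v] tensor_space_iff M_def)

context presented_action
begin

text \<open>Entries outside \<open>basis\<close> are left arbitrary, since operators on the tensor
  space do not determine them.\<close>

definition mats :: "'g ncpoly set \<Rightarrow> (rat list \<Rightarrow> rat list \<Rightarrow> Qpq) set" where
  "mats S = {b. \<exists>a\<in>S. \<forall>f\<in>basis r m. \<forall>g\<in>basis r m. b f g = lookup (act W a (M g)) f}"

lemma matsI:
  assumes "a \<in> S" "\<And>f g. f \<in> basis r m \<Longrightarrow> g \<in> basis r m \<Longrightarrow> b f g = lookup (act W a (M g)) f"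
  shows "b \<in> mats S"
  using assms by (auto simp: mats_def)

lemma matsE:
  assumes "b \<in> mats S"
  obtains a where "a \<in> S" "\<And>f g. f \<in> basis r m \<Longrightarrow> g \<in> basis r m \<Longrightarrow> b f g = lookup (act W a (M g)) f"
  using assms by (auto simp: mats_def)

lemma lookup_act_act:
  assumes "a \<in> carrier (free_alg X)" "b \<in> carrier (free_alg X)" "g \<in> basis r m"
  shows "lookup (act W a (act W b (M g))) f
    = (\<Sum>h\<in>basis r m. lookup (act W a (M h)) f * lookup (act W b (M g)) h)"
  using assms by (subst lookup_linop[OF linop_act, of _ r m]) (auto simp: act_closed mult.commute)

lemma mats_matrix_algebra:
  assumes "S \<subseteq> carrier (free_alg X)" "\<And>c. const c \<in> S"
    and "\<And>a b. a \<in> S \<Longrightarrow> b \<in> S \<Longrightarrow> a + b \<in> S"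
    and "\<And>a b. a \<in> S \<Longrightarrow> b \<in> S \<Longrightarrow> a * b \<in> S"
  shows "matrix_algebra (mats S) r m"
proof
  show "(\<lambda>f g. of_bool (f = g)) \<in> mats S"
    by (rule matsI[OF assms(2)[of 1]]) (auto simp: act_const lookup_M)
  show "(\<lambda>f g. b f g + c f g) \<in> mats S" if "b \<in> mats S" "c \<in> mats S" for b c
    using that by (elim matsE) (rule matsI[OF assms(3)]; simp add: act_add lookup_add)
  show "(\<lambda>f g. s * b f g) \<in> mats S" if b: "b \<in> mats S" for b s
  proof -
    obtain a where a: "a \<in> S" "\<And>f g. f \<in> basis r m \<Longrightarrow> g \<in> basis r m \<Longrightarrow> b f g = lookup (act W a (M g)) f"
      using b by (auto simp: mats_def)
    show ?thesis
      by (rule matsI[OF assms(4)[OF assms(2)[of s] a(1)]])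
        (simp add: a(2) act_mult act_const linop_scale[OF linop_act])
  qed
  show "mmul (basis r m) b c \<in> mats S" if b: "b \<in> mats S" and c: "c \<in> mats S" for b c
  proof -
    obtain a where a: "a \<in> S" "\<And>f g. f \<in> basis r m \<Longrightarrow> g \<in> basis r m \<Longrightarrow> b f g = lookup (act W a (M g)) f"
      using b by (auto simp: mats_def)
    obtain a' where a': "a' \<in> S" "\<And>f g. f \<in> basis r m \<Longrightarrow> g \<in> basis r m \<Longrightarrow> c f g = lookup (act W a' (M g)) f"
      using c by (auto simp: mats_def)
    \<comment> \<open>For a right action the product of matrices belongs to the reversed product of
      polynomials.\<close>
    have "(if flip then a' * a else a * a') \<in> S" using a a' assms(4) by simp
    then show ?thesis
      by (rule matsI)
        (use a a' assms(1) in \<open>auto simp: mmul_def act_mult lookup_act_act subset_iff\<close>)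
  qed
qed

text \<open>Members of \<open>End_alg\<close> are extensional functions and linear on the tensor
  space only; this trades them for a total linear map.\<close>

lemma End_eq_lin:
  assumes T: "T \<in> carrier (End_alg r m)" and v: "v \<in> tensor_space r m"
  shows "T v = lin (\<lambda>f. T (M f)) v"
proof -
  have add: "\<And>v w. v \<in> tensor_space r m \<Longrightarrow> w \<in> tensor_space r m \<Longrightarrow> T (v + w) = T v + T w"
    and smult: "\<And>c v. v \<in> tensor_space r m \<Longrightarrow> T (scale c v) = scale c (T v)"
    using T by (auto simp: End_alg_def)
  have sum: "T (\<Sum>f\<in>S. scale (c f) (M f)) = (\<Sum>f\<in>S. scale (c f) (T (M f)))"
    if "finite S" "S \<subseteq> basis r m" for S c
    using that
  proof (induction S rule: finite_induct)
    case empty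
    show ?case using smult[of 0 0] tensor_space_closed(1) by simp
  next
    case (insert f S)
    then show ?case
      by (subst sum.insert, simp, simp, subst add)
        (auto simp: smult intro!: tensor_space_closed)
  qed
  have "v = lin M v"
    using linop_eq_lin[OF linop_id, of v] by (simp add: M_def[abs_def])
  then have "T v = T (lin M v)" by (rule arg_cong)
  also have "\<dots> = lin (\<lambda>f. T (M f)) v"
    using v unfolding lin_def by (intro sum) (auto simp: tensor_space_iff)
  finally show ?thesis .
qed

lemma End_eq_rep:
  assumes T: "T \<in> carrier (End_alg r m)" and a: "a \<in> carrier (free_alg X)"
    and eq: "\<And>f g. f \<in> basis r m \<Longrightarrow> g \<in> basis r m \<Longrightarrow> lookup (T (M g)) f = lookup (act W a (M g)) f"
  shows "T = rep a"
proof -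
  have eq': "T (M g) = act W a (M g)" if g: "g \<in> basis r m" for g
  proof (rule poly_mapping_eqI)
    fix f
    have "T (M g) \<in> tensor_space r m" "act W a (M g) \<in> tensor_space r m"
      using T a g by (auto simp: End_alg_def act_closed)
    then have "lookup (T (M g)) f = 0 \<and> lookup (act W a (M g)) f = 0" if "f \<notin> basis r m"
      using that by (meson in_keys_iff subsetD tensor_space_iff)
    then show "lookup (T (M g)) f = lookup (act W a (M g)) f"
      using eq[OF _ g, of f] by (cases "f \<in> basis r m") auto
  qed
  have "T v = act W a v" if "v \<in> tensor_space r m" for v
    unfolding End_eq_lin[OF T that]
    by (rule linop_eqI[OF linop_lin linop_act]) (use that in \<open>auto simp: tensor_space_iff eq'\<close>)
  then show ?thesis
    using T a by (auto simp: rep End_alg_def extensional_def PiE_def fun_eq_iff)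
qed

lemma cls_uminus:
  assumes a: "a \<in> carrier (free_alg X)"
  shows "\<ominus>\<^bsub>presented_alg X R\<^esub> cls X R a = cls X R (- a)"
proof -
  interpret F: ring "free_alg X" by (rule free_alg_ring)
  interpret I: ideal "Idl\<^bsub>free_alg X\<^esub> R" "free_alg X" by (rule Idl_ideal)
  interpret P: ring "presented_alg X R"
    unfolding presented_alg_def by (rule I.quotient_is_ring)
  have neg: "- a \<in> carrier (free_alg X)" using a by (simp add: free_alg_def)
  have "cls X R 0 = \<zero>\<^bsub>presented_alg X R\<^esub>"
    using F.a_coset_add_zero[OF I.a_subset]
    by (simp add: cls_def presented_alg_def FactRing_def free_alg_def)
  then have "cls X R (- a) \<oplus>\<^bsub>presented_alg X R\<^esub> cls X R a = \<zero>\<^bsub>presented_alg X R\<^esub>"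
    using cls_hom(1)[OF neg a] by simp
  then show ?thesis
    by (rule P.minus_equality) (use a neg in \<open>simp_all add: presented_carrier\<close>)
qed

end

section \<open>Lifts of \<open>U_jmath\<close> to the free algebra\<close>

lemma Phi_cls:
  assumes "a \<in> carrier (free_alg (U_gens r))"
  shows "Phi r m (U_cls r a) = (\<lambda>v\<in>tensor_space r m. act (foldr gop) a v)"
  using U.coset_rep[OF assms, of m] by (simp add: Phi_def Phi_free_act[OF assms])

lemma Psi_cls:
  assumes "h \<in> carrier (free_alg {..<m})"
  shows "Psi r m (cls {..<m} (hecke_rels m) h) = (\<lambda>v\<in>tensor_space r m. act (fold hop) h v)"
  using H.coset_rep[OF assms, of r] by (simp add: Psi_def Psi_free_act[OF assms])

text \<open>The preimage of the coideal subalgebra among polynomials, where \<open>act\<close> and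
  matrices are available without cosets.\<close>

definition jmath_lifts :: "nat \<Rightarrow> ugen ncpoly set" where
  "jmath_lifts r = {a \<in> carrier (free_alg (U_gens r)). U_cls r a \<in> U_jmath r}"

lemma pos_rootsE:
  assumes "i \<in> pos_roots r"
  obtains c where "i = of_int c + 1/2" "0 \<le> c" "c < int r"
proof -
  obtain k where "i = of_int k - 1/2" "1 \<le> k" "k \<le> int r" using assms by (auto simp: pos_roots_def)
  then show thesis using that[of "k - 1"] by simp
qed

lemma pos_roots_roots:
  assumes "i \<in> pos_roots r"
  shows "i \<in> roots r" "- i \<in> roots r"
proof -
  obtain k where k: "i = of_int k - 1/2" "1 \<le> k" "k \<le> int r" using assms by (auto simp: pos_roots_def)
  show "i \<in> roots r" unfolding roots_def using k by (intro CollectI exI[of _ k]) auto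
  show "- i \<in> roots r" unfolding roots_def using k by (intro CollectI exI[of _ "1 - k"]) auto
qed

abbreviation jmath_gens :: "nat \<Rightarrow> ugen ncpoly set" where
  "jmath_gens r \<equiv> range const \<union> e_jmath ` pos_roots r \<union> f_jmath ` pos_roots r
        \<union> k_jmath ` pos_roots r \<union> kinv_jmath ` pos_roots r"

lemma jmath_gens_closed: "jmath_gens r \<subseteq> carrier (free_alg (U_gens r))"
  using pos_roots_roots
  by (auto simp: e_jmath_def f_jmath_def k_jmath_def kinv_jmath_def U_gens_def
      intro!: free_alg_closed)

lemma U_jmath_carrier: "U_jmath r \<subseteq> carrier (U_alg r)"
proof -
  interpret I: ideal "Idl\<^bsub>free_alg (U_gens r)\<^esub> (U_rels r)" "free_alg (U_gens r)" by (rule U.Idl_ideal)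
  interpret P: ring "U_alg r"
    unfolding U_alg_def presented_alg_def by (rule I.quotient_is_ring)
  show ?thesis
    unfolding U_jmath_def
    by (rule P.generate_ring_incl)
      (unfold U_alg_def U.presented_carrier, rule image_mono[OF jmath_gens_closed])
qed

lemma U_jmath_eq: "U_jmath r = U_cls r ` jmath_lifts r"
  using U_jmath_carrier[of r] by (auto simp: jmath_lifts_def U_alg_def U.presented_carrier)

lemma jmath_lifts_closed:
  "jmath_lifts r \<subseteq> carrier (free_alg (U_gens r))"
  "a \<in> jmath_gens r \<Longrightarrow> a \<in> jmath_lifts r"
  "a \<in> jmath_lifts r \<Longrightarrow> b \<in> jmath_lifts r \<Longrightarrow> a + b \<in> jmath_lifts r"
  "a \<in> jmath_lifts r \<Longrightarrow> b \<in> jmath_lifts r \<Longrightarrow> a * b \<in> jmath_lifts r"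
proof -
  show "jmath_lifts r \<subseteq> carrier (free_alg (U_gens r))" by (auto simp: jmath_lifts_def)
  show "a \<in> jmath_lifts r" if a: "a \<in> jmath_gens r"
  proof -
    have "U_cls r a \<in> U_jmath r"
      unfolding U_jmath_def by (rule generate_ring.incl[OF imageI[OF a]])
    with subsetD[OF jmath_gens_closed a] show ?thesis unfolding jmath_lifts_def by simp
  qed
  show "a + b \<in> jmath_lifts r" "a * b \<in> jmath_lifts r" if "a \<in> jmath_lifts r" "b \<in> jmath_lifts r"
    using that U.cls_hom(1,2)[of a r b] generate_ring.eng_add[of "U_cls r a" "U_alg r" _ "U_cls r b"]
      generate_ring.eng_mult[of "U_cls r a" "U_alg r" _ "U_cls r b"]
    unfolding jmath_lifts_def U_jmath_def
    by (auto simp: U_alg_def free_alg_closed)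
qed

lemma jmath_gens_hop_0:
  assumes "a \<in> jmath_gens r" "0 < m" "v \<in> tensor_space r m"
  shows "hop 0 (act (foldr gop) a v) = act (foldr gop) a (hop 0 v)"
proof (rule linop_eqI[where v = v])
  fix f assume "f \<in> Poly_Mapping.keys v"
  then obtain b g where "M f = tcons b (M g)"
    using assms(2,3) by (cases f) (auto simp: tensor_space_def tcons_M)
  moreover have "i - 1/2 \<ge> 0" "- i - 1/2 = - (i - 1/2) - 1" if "i \<in> pos_roots r" for i
    using that by (auto elim!: pos_rootsE)
  ultimately show "hop 0 (act (foldr gop) a (M f)) = act (foldr gop) a (hop 0 (M f))"
    using assms(1) jmath_hop_0_tcons
    by (auto simp only: Un_iff image_iff act_jmath U.act_const linop_scale[OF linop_hop])
qed (auto intro!: linop_comp[OF linop_hop U.linop_act] linop_comp[OF U.linop_act linop_hop])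

text \<open>Induction over the generated subring, carrying one representative along. The H_i with i
  \<ge> 1 commute with all of U; only H_0 appeals to the special form of the coideal
  generators.\<close>

lemma jmath_hop_comm:
  assumes "x \<in> U_jmath r"
  shows "\<exists>a\<in>carrier (free_alg (U_gens r)). x = U_cls r a \<and> (\<forall>i<m. \<forall>v\<in>tensor_space r m.
      hop i (act (foldr gop) a v) = act (foldr gop) a (hop i v))"
  using assms unfolding U_jmath_def
proof (induction x rule: generate_ring.induct)
  case one
  show ?case using U.cls_hom(3)[OF free_alg_closed(1) free_alg_closed(1)] by (intro bexI[of _ 1]) (auto simp: U_alg_def free_alg_closed)
next
  case (incl h)
  then obtain a where a: "h = U_cls r a" "a \<in> jmath_gens r" by (rule imageE)
  have "hop i (act (foldr gop) a v) = act (foldr gop) a (hop i v)" if "i < m" "v \<in> tensor_space r m" for i v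
  proof (cases i)
    case 0
    then show ?thesis using jmath_gens_hop_0[OF a(2)] that by simp
  next
    case (Suc j)
    then show ?thesis using act_hop_Suc[of j m v r a] subsetD[OF jmath_gens_closed a(2)] that by simp
  qed
  then show ?case using a(1) subsetD[OF jmath_gens_closed a(2)] by (intro bexI[of _ a]) simp_all
next
  case (a_inv x)
  then obtain a where "a \<in> carrier (free_alg (U_gens r))" "x = U_cls r a"
    "\<forall>i<m. \<forall>v\<in>tensor_space r m. hop i (act (foldr gop) a v) = act (foldr gop) a (hop i v)"
    by blast
  moreover from this have "- a \<in> carrier (free_alg (U_gens r))" by (simp add: free_alg_def)
  moreover have "hop i (- w) = - hop i w" for i w
    using hop_simps(4)[of i 0 w] by simp
  ultimately show ?case
    using U.cls_uminus by (intro bexI[of _ "- a"]) (auto simp: U_alg_def act_uminus)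
next
  case (eng_add x y)
  then obtain a b where "a \<in> carrier (free_alg (U_gens r))" "x = U_cls r a"
    "\<forall>i<m. \<forall>v\<in>tensor_space r m. hop i (act (foldr gop) a v) = act (foldr gop) a (hop i v)"
    "b \<in> carrier (free_alg (U_gens r))" "y = U_cls r b"
    "\<forall>i<m. \<forall>v\<in>tensor_space r m. hop i (act (foldr gop) b v) = act (foldr gop) b (hop i v)"
    by blast
  then show ?case
    by (intro bexI[of _ "a + b"]) (auto simp: U_alg_def U.cls_hom act_add free_alg_closed)
next
  case (eng_mult x y)
  then obtain a b where "a \<in> carrier (free_alg (U_gens r))" "x = U_cls r a"
    "\<forall>i<m. \<forall>v\<in>tensor_space r m. hop i (act (foldr gop) a v) = act (foldr gop) a (hop i v)"
    "b \<in> carrier (free_alg (U_gens r))" "y = U_cls r b"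
    "\<forall>i<m. \<forall>v\<in>tensor_space r m. hop i (act (foldr gop) b v) = act (foldr gop) b (hop i v)"
    by blast
  then show ?case
    by (intro bexI[of _ "a * b"]) (auto simp: U_alg_def U.cls_hom U.act_mult free_alg_closed U.act_closed)
qed

section \<open>The image of the coideal subalgebra\<close>

text \<open>At q = 1 the powers of q coming from K become 1, so the coproduct becomes primitive and
  E acts as the derivation of a matrix unit.\<close>

lemma spec_Eop:
  assumes "length f = length g"
  shows "spec (lookup (Eop c (M g)) f) (der (\<lambda>a b. of_bool (a = c \<and> b = c + 1)) f g)"
  using assms
proof (induction f g rule: list_induct2)
  case (Cons a f b g)
  have "lookup (Eop c (M (b # g))) (a # f) = of_bool (a = b) * lookup (Eop c (M g)) f
      + of_bool (a = c \<and> b = c + 1) * (qvar powi (- wt c g) * of_bool (f = g))"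
    by (auto simp flip: tcons_M simp: lookup_add lookup_tcons Lop_M lookup_M)
  moreover have "spec \<dots> (of_bool (a = b) * der (\<lambda>a b. of_bool (a = c \<and> b = c + 1)) f g
      + of_bool (a = c \<and> b = c + 1) * (1 * of_bool (f = g)))"
    by (intro spec_add spec_mult spec_of_bool spec_qpow Cons.IH)
  ultimately show ?case by simp
qed simp

lemma spec_Fop:
  assumes "length f = length g"
  shows "spec (lookup (Fop c (M g)) f) (der (\<lambda>a b. of_bool (a = c + 1 \<and> b = c)) f g)"
  using assms
proof (induction f g rule: list_induct2)
  case (Cons a f b g)
  have "lookup (Fop c (M (b # g))) (a # f) = qvar powi cf c b * (of_bool (a = b) * lookup (Fop c (M g)) f)
      + of_bool (a = c + 1 \<and> b = c) * of_bool (f = g)"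
    by (auto simp flip: tcons_M simp: lookup_add lookup_tcons lookup_M)
  moreover have "spec \<dots> (1 * (of_bool (a = b) * der (\<lambda>a b. of_bool (a = c + 1 \<and> b = c)) f g)
      + of_bool (a = c + 1 \<and> b = c) * of_bool (f = g))"
    by (intro spec_add spec_mult spec_of_bool spec_qpow Cons.IH)
  ultimately show ?case by simp
qed simp

lemma lookup_Lop: "lookup (Lop c v) f = qvar powi (- wt c f) * lookup v f"
proof -
  have "lookup (Lop c v) f = (\<Sum>a\<in>Poly_Mapping.keys v. lookup v a * lookup (scale (qvar powi (- wt c a)) (M a)) f)"
    by (simp add: Lop_def lookup_lin[of "Poly_Mapping.keys v" v])
  also have "\<dots> = qvar powi (- wt c f) * lookup v f"
  proof (cases "f \<in> Poly_Mapping.keys v")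
    case True
    then show ?thesis
      using sum_of_bool(3)[of "Poly_Mapping.keys v" f "\<lambda>a. lookup v a * qvar powi (- wt c a)"]
      by (simp add: lookup_M mult_ac)
  next
    case False
    then show ?thesis by (auto simp: lookup_M in_keys_iff intro!: sum.neutral)
  qed
  finally show ?thesis .
qed

lemma der_diagonal:
  assumes "length f = length g"
  shows "der (\<lambda>a b. of_bool (a = b) * s a) f g = of_bool (f = g) * (\<Sum>a\<leftarrow>f. s a)"
  using assms by (induction f g rule: list_induct2) (auto simp: algebra_simps)

lemma spec_jpar: "spec (jpar c) 1"
  by (simp add: jpar_def spec_pvar)

lemma spec_e_jmath:
  assumes "length f = length g" "i = c + 1/2"
  shows "spec (lookup (act (foldr gop) (e_jmath i) (M g)) f) (der (ymat c (c + 1)) f g)"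
proof -
  let ?E = "\<lambda>a b. of_bool (a = c \<and> b = c + 1) :: rat"
  let ?F = "\<lambda>a b. of_bool (a = (- c - 1) + 1 \<and> b = - c - 1) :: rat"
  have "- i - 1/2 = - c - 1" "i - 1/2 = c" using assms(2) by simp_all
  then have "lookup (act (foldr gop) (e_jmath i) (M g)) f = lookup (Eop c (M g)) f
      + inverse (jpar c) * (qvar powi (- wt c g) * lookup (Fop (- c - 1) (M g)) f)"
    by (simp only: act_jmath) (simp add: Lop_M lookup_add)
  moreover have "spec \<dots> (der ?E f g + inverse 1 * (1 * der ?F f g))"
    by (intro spec_add spec_mult spec_inverse spec_jpar spec_qpow spec_Eop spec_Fop assms) simp
  moreover have "ymat c (c + 1) = (\<lambda>a b. ?E a b + ?F a b)" by (auto simp: ymat_def fun_eq_iff)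
  ultimately show ?thesis by (simp add: der_add)
qed

lemma spec_f_jmath:
  assumes "length f = length g" "i = c + 1/2"
  shows "spec (lookup (act (foldr gop) (f_jmath i) (M g)) f) (der (ymat (c + 1) c) f g)"
proof -
  let ?E = "\<lambda>a b. of_bool (a = - c - 1 \<and> b = (- c - 1) + 1) :: rat"
  let ?F = "\<lambda>a b. of_bool (a = c + 1 \<and> b = c) :: rat"
  have "- i - 1/2 = - c - 1" "i - 1/2 = c" using assms(2) by simp_all
  then have "lookup (act (foldr gop) (f_jmath i) (M g)) f = lookup (Eop (- c - 1) (M g)) f
      + jpar c * (qvar powi (- wt (- c - 1) f) * lookup (Fop c (M g)) f)"
    by (simp only: act_jmath) (simp add: lookup_Lop lookup_add)
  moreover have "spec \<dots> (der ?E f g + 1 * (1 * der ?F f g))"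
    by (intro spec_add spec_mult spec_jpar spec_qpow spec_Eop spec_Fop assms)
  moreover have "ymat (c + 1) c = (\<lambda>a b. ?E a b + ?F a b)" by (auto simp: ymat_def fun_eq_iff)
  ultimately show ?thesis by (simp add: der_add)
qed

text \<open>k_i multiplies a basis word by q to an integer weight. Subtracting the identity and
  dividing by q - 1 leaves the weight itself in the limit, which is the Cartan derivation.\<close>

lemma spec_k_jmath:
  assumes "length f = length g" "i = c + 1/2"
  shows "spec (inverse (qvar - 1) * (lookup (act (foldr gop) (k_jmath i) (M g)) f - of_bool (f = g)))
    (der (\<lambda>a b. ymat c c a b - ymat (c + 1) (c + 1) a b) f g)"
proof -
  have *: "- i - 1/2 = - c - 1" "i - 1/2 = c" using assms(2) by simp_all
  let ?n = "wt c f - wt (- c - 1) f"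
  have "lookup (act (foldr gop) (k_jmath i) (M g)) f = qvar powi ?n * of_bool (f = g)"
    by (simp only: act_jmath *) (auto simp: Kop_M Lop_M lookup_M qpow_simps)
  then have "inverse (qvar - 1) * (lookup (act (foldr gop) (k_jmath i) (M g)) f - of_bool (f = g))
      = of_bool (f = g) * ((qvar powi ?n - 1) / (qvar - 1))"
    by (simp add: field_simps)
  moreover have "spec \<dots> (of_bool (f = g) * of_int ?n)"
    by (intro spec_mult spec_of_bool spec_qint)
  moreover have "of_int ?n = (\<Sum>a\<leftarrow>f. rat_of_int (cf c a - cf (- c - 1) a))"
    by (induction f) auto
  moreover have "(\<lambda>a b. ymat c c a b - ymat (c + 1) (c + 1) a b)
      = (\<lambda>a b. of_bool (a = b) * rat_of_int (cf c a - cf (- c - 1) a))"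
    by (auto simp: ymat_def cf_def fun_eq_iff)
  ultimately show ?thesis using der_diagonal[OF assms(1)] by simp
qed

lemma basis_length: "f \<in> basis r m \<Longrightarrow> g \<in> basis r m \<Longrightarrow> length f = length g"
  by (simp add: basis_def)

lemma hop_eq_Psi:
  assumes "i < m" "v \<in> tensor_space r m"
  shows "Psi r m (cls {..<m} (hecke_rels m) (gen i)) v = hop i v"
  using assms by (simp add: Psi_cls free_alg_closed)

lemma hop_commutes_act:
  assumes T: "T \<in> carrier (End_alg r m)"
    and comm: "\<And>i v. i < m \<Longrightarrow> v \<in> tensor_space r m \<Longrightarrow> T (hop i v) = hop i (T v)"
    and h: "h \<in> carrier (free_alg {..<m})" and v: "v \<in> tensor_space r m"
  shows "T (act (fold hop) h v) = act (fold hop) h (T v)"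
proof -
  let ?T = "lin (\<lambda>f. T (M f))"
  have T_closed: "T v \<in> tensor_space r m" if "v \<in> tensor_space r m" for v
    using T that by (auto simp: End_alg_def)
  have T_eq: "T v = ?T v" if "v \<in> tensor_space r m" for v
    by (rule H.End_eq_lin[OF T that])
  have word: "T (fold hop w v) = fold hop w (T v)" if "set w \<subseteq> {..<m}" "v \<in> tensor_space r m" for w v
    using that by (induction w arbitrary: v) (auto simp: comm hop_closed)
  have "T (act (fold hop) h v) = ?T (act (fold hop) h v)"
    by (rule T_eq) (rule H.act_closed[OF h v])
  also have "\<dots> = (\<Sum>w\<in>Poly_Mapping.keys h. scale (lookup h w) (?T (fold hop (letters w) v)))"
    unfolding act_def by (simp add: linop_sum[OF linop_lin] linop_scale[OF linop_lin])
  also have "\<dots> = act (fold hop) h (T v)"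
    unfolding act_def
  proof (rule sum.cong)
    fix w assume "w \<in> Poly_Mapping.keys h"
    then have w: "set (letters w) \<subseteq> {..<m}" using h by (auto simp: free_alg_def)
    show "scale (lookup h w) (?T (fold hop (letters w) v)) = scale (lookup h w) (fold hop (letters w) (T v))"
      using word[OF w v] T_eq[OF fold_hop_closed[OF w v]] by simp
  qed simp
  finally show ?thesis .
qed

lemma mmul_End_act:
  assumes T: "T \<in> carrier (End_alg r m)" and S: "linop S"
    and S_closed: "\<And>v. v \<in> tensor_space r m \<Longrightarrow> S v \<in> tensor_space r m"
    and g: "g \<in> basis r m"
  shows "mmul (basis r m) (\<lambda>f g. lookup (T (M g)) f) (\<lambda>f g. lookup (S (M g)) f) f g = lookup (T (S (M g))) f"
    and "mmul (basis r m) (\<lambda>f g. lookup (S (M g)) f) (\<lambda>f g. lookup (T (M g)) f) f g = lookup (S (T (M g))) f"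
proof -
  have Mg: "M g \<in> tensor_space r m" using g by simp
  have TM: "T (M g) \<in> tensor_space r m" using T Mg by (auto simp: End_alg_def)
  have "lookup (T (S (M g))) f = lookup (lin (\<lambda>f. T (M f)) (S (M g))) f"
    using H.End_eq_lin[OF T S_closed[OF Mg]] by simp
  also have "\<dots> = (\<Sum>h\<in>basis r m. lookup (S (M g)) h * lookup (T (M h)) f)"
    by (subst lookup_linop[OF linop_lin S_closed[OF Mg]]) simp
  finally show "mmul (basis r m) (\<lambda>f g. lookup (T (M g)) f) (\<lambda>f g. lookup (S (M g)) f) f g = lookup (T (S (M g))) f"
    by (simp add: mmul_def mult.commute)
  show "mmul (basis r m) (\<lambda>f g. lookup (S (M g)) f) (\<lambda>f g. lookup (T (M g)) f) f g = lookup (S (T (M g))) f"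
    by (simp add: mmul_def mult.commute lookup_linop[OF S TM])
qed

section \<open>Commutants of the two images\<close>

abbreviation Phi_mats :: "nat \<Rightarrow> nat \<Rightarrow> (rat list \<Rightarrow> rat list \<Rightarrow> Qpq) set" where
  "Phi_mats r m \<equiv> U.mats r m (jmath_lifts r)"

abbreviation Psi_mats :: "nat \<Rightarrow> nat \<Rightarrow> (rat list \<Rightarrow> rat list \<Rightarrow> Qpq) set" where
  "Psi_mats r m \<equiv> H.mats r m (carrier (free_alg {..<m}))"

text \<open>\<open>jmath_hop_comm\<close> yields one representative of the class; every other lift
  acts by the same operator, because \<open>Phi\<close> depends on the class only.\<close>

lemma jmath_lift_commutes:
  assumes "a \<in> jmath_lifts r" "i < m" "v \<in> tensor_space r m"
  shows "hop i (act (foldr gop) a v) = act (foldr gop) a (hop i v)"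
proof -
  have a: "a \<in> carrier (free_alg (U_gens r))" "U_cls r a \<in> U_jmath r"
    using assms(1) by (auto simp: jmath_lifts_def)
  obtain b where b: "b \<in> carrier (free_alg (U_gens r))" "U_cls r a = U_cls r b"
    "\<forall>i<m. \<forall>v\<in>tensor_space r m. hop i (act (foldr gop) b v) = act (foldr gop) b (hop i v)"
    using jmath_hop_comm[OF a(2), of m] by blast
  have "act (foldr gop) a v = act (foldr gop) b v" if "v \<in> tensor_space r m" for v
    using Phi_cls[OF a(1), of m] Phi_cls[OF b(1), of m] b(2) that by (metis restrict_apply')
  then show ?thesis using b(3) assms(2,3) hop_closed by simp
qed

lemma matrix_algebra_Phi: "matrix_algebra (Phi_mats r m) r m"
  by (rule U.mats_matrix_algebra) (auto simp: jmath_lifts_closed)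

lemma matrix_algebra_Psi: "matrix_algebra (Psi_mats r m) r m"
  by (rule H.mats_matrix_algebra) (auto simp: free_alg_closed)

text \<open>The hard inclusion, stated for bare matrices so that it serves twice: for endomorphisms
  over the Hecke algebra, and for the matrices that \<open>bicommutant\<close> tests
  against.\<close>

lemma commutant_hop:
  assumes r: "r \<ge> 1"
    and x: "\<And>i f g. i < m \<Longrightarrow> f \<in> basis r m \<Longrightarrow> g \<in> basis r m \<Longrightarrow>
      mmul (basis r m) x (hmat i) f g = mmul (basis r m) (hmat i) x f g"
  obtains a where "a \<in> jmath_lifts r"
    "\<And>f g. f \<in> basis r m \<Longrightarrow> g \<in> basis r m \<Longrightarrow> x f g = lookup (act (foldr gop) a (M g)) f"
proof -
  interpret A: matrix_algebra "Phi_mats r m" r m by (rule matrix_algebra_Phi)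
  have root: "rat_of_int c + 1/2 \<in> pos_roots r" if "0 \<le> c" "c < int r" for c
    unfolding pos_roots_def using that by (intro CollectI exI[of _ "c + 1"]) auto
  have gens: "(\<lambda>f g. lookup (act (foldr gop) a (M g)) f) \<in> Phi_mats r m" if "a \<in> jmath_gens r" for a
    by (rule U.matsI[OF jmath_lifts_closed(2)[OF that]]) simp
  have up: "A.lie (ymat (of_int c) (of_int (c + 1)))" if "0 \<le> c" "c < int r" for c
    unfolding A.lie_def
  proof (rule A.limitsI[OF gens])
    show "e_jmath (of_int c + 1/2) \<in> jmath_gens r" using root[OF that] by simp
    show "f \<in> basis r m \<Longrightarrow> g \<in> basis r m \<Longrightarrow>
        spec (lookup (act (foldr gop) (e_jmath (of_int c + 1/2)) (M g)) f) (der (ymat (of_int c) (of_int (c + 1))) f g)" for f g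
      using spec_e_jmath[OF basis_length refl, of f r m g "of_int c"] by simp
  qed
  have down: "A.lie (ymat (of_int (c + 1)) (of_int c))" if "0 \<le> c" "c < int r" for c
    unfolding A.lie_def
  proof (rule A.limitsI[OF gens])
    show "f_jmath (of_int c + 1/2) \<in> jmath_gens r" using root[OF that] by simp
    show "f \<in> basis r m \<Longrightarrow> g \<in> basis r m \<Longrightarrow>
        spec (lookup (act (foldr gop) (f_jmath (of_int c + 1/2)) (M g)) f) (der (ymat (of_int (c + 1)) (of_int c)) f g)" for f g
      using spec_f_jmath[OF basis_length refl, of f r m g "of_int c"] by simp
  qed
  have cartan: "A.lie (\<lambda>x y. ymat (of_int c) (of_int c) x y - ymat (of_int (c + 1)) (of_int (c + 1)) x y)"
    if "0 \<le> c" "c < int r" for c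
  proof -
    let ?k = "k_jmath (of_int c + 1/2)"
    \<comment> \<open>The algebra is closed under all scalars of Q(p,q), including 1/(q - 1), which
      is not regular at q = 1.\<close>
    have "(\<lambda>f g. inverse (qvar - 1) * (lookup (act (foldr gop) ?k (M g)) f + (- 1) * of_bool (f = g))) \<in> Phi_mats r m"
      using root[OF that] by (intro A.smult A.add A.one gens) auto
    then show ?thesis
      unfolding A.lie_def
      by (rule A.limitsI) (use spec_k_jmath[OF basis_length refl] in simp)
  qed
  have "\<exists>b\<in>Phi_mats r m. \<forall>f\<in>basis r m. \<forall>g\<in>basis r m. b f g = x f g"
  proof (rule A.commutant_subset[OF A.lie_ymat[OF r up down cartan] _ x])
    fix b i f g assume b: "b \<in> Phi_mats r m" and *: "i < m" "f \<in> basis r m" "g \<in> basis r m"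
    obtain a where a: "a \<in> jmath_lifts r"
      "\<And>f g. f \<in> basis r m \<Longrightarrow> g \<in> basis r m \<Longrightarrow> b f g = lookup (act (foldr gop) a (M g)) f"
      using b by (auto simp: U.mats_def)
    have ac: "a \<in> carrier (free_alg (U_gens r))" using a(1) jmath_lifts_closed(1) by blast
    have "mmul (basis r m) b (hmat i) f g = lookup (act (foldr gop) a (hop i (M g))) f"
      using * by (simp add: mmul_def a(2) hmat_def mult.commute
          lookup_linop[OF U.linop_act hop_closed[OF *(1)]])
    moreover have "mmul (basis r m) (hmat i) b f g = lookup (hop i (act (foldr gop) a (M g))) f"
      using * by (simp add: mmul_def a(2) hmat_def mult.commute
          lookup_linop[OF linop_hop U.act_closed[OF ac]])
    ultimately show "mmul (basis r m) b (hmat i) f g = mmul (basis r m) (hmat i) b f g"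
      using jmath_lift_commutes[OF a(1) *(1), of "M g"] *(3) by simp
  qed
  then show thesis using that by (auto simp: U.mats_def)
qed

text \<open>Each generator is symmetric by \<open>hmat_sym\<close>, so transposing a product of
  generators reverses the word.\<close>

lemma fold_hop_transpose:
  assumes "set w \<subseteq> {..<m}" "f \<in> basis r m" "g \<in> basis r m"
  shows "lookup (fold hop w (M g)) f = lookup (fold hop (rev w) (M f)) g"
  using assms
proof (induction w arbitrary: g)
  case Nil
  then show ?case by (simp add: lookup_M eq_commute)
next
  case (Cons i w)
  have i: "i < m" and w: "set w \<subseteq> {..<m}" using Cons.prems by auto
  have "lookup (fold hop (i # w) (M g)) f = (\<Sum>h\<in>basis r m. hmat i h g * lookup (fold hop w (M h)) f)"
    using lookup_linop[OF H.linop_W[of w] hop_closed[OF i], of "M g" r f] Cons.prems(3)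
    by (simp add: hmat_def)
  also have "\<dots> = (\<Sum>h\<in>basis r m. lookup (fold hop (rev w) (M f)) h * hmat i g h)"
    by (rule sum.cong) (use Cons.IH w Cons.prems hmat_sym[OF i] in \<open>auto simp: mult.commute\<close>)
  also have "\<dots> = lookup (hop i (fold hop (rev w) (M f))) g"
    using lookup_linop[OF linop_hop[of i] fold_hop_closed[of "rev w" m "M f" r], of g] w Cons.prems(2)
    by (simp add: hmat_def)
  finally show ?case by simp
qed

lemma Psi_mats_transpose:
  assumes "b \<in> Psi_mats r m"
  shows "(\<lambda>f g. b g f) \<in> Psi_mats r m"
proof -
  obtain h where h: "h \<in> carrier (free_alg {..<m})"
    "\<And>f g. f \<in> basis r m \<Longrightarrow> g \<in> basis r m \<Longrightarrow> b f g = lookup (act (fold hop) h (M g)) f"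
    using assms by (auto simp: H.mats_def)
  have letters: "set (letters w) \<subseteq> {..<m}" if "w \<in> Poly_Mapping.keys h" for w
    using h(1) that by (auto simp: free_alg_def)
  \<comment> \<open>h under the anti-automorphism of the free algebra that reverses words.\<close>
  define h' where "h' = (\<Sum>w\<in>Poly_Mapping.keys h. Poly_Mapping.single (Word (rev (letters w))) (lookup h w))"
  have "h' \<in> carrier (free_alg {..<m})"
    unfolding h'_def
  proof -
    have "(\<Sum>w\<in>S. Poly_Mapping.single (Word (rev (letters w))) (lookup h w)) \<in> carrier (free_alg {..<m})"
      if "finite S" "S \<subseteq> Poly_Mapping.keys h" for S
      using that
    proof (induction S rule: finite_induct)
      case empty
      show ?case by (simp add: free_alg_def)
    next
      case (insert w S)
      have "Poly_Mapping.single (Word (rev (letters w))) (lookup h w) \<in> carrier (free_alg {..<m})"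
        using letters insert.prems by (auto simp: free_alg_def)
      then show ?case using insert by (simp add: free_alg_closed)
    qed
    then show "(\<Sum>w\<in>Poly_Mapping.keys h. Poly_Mapping.single (Word (rev (letters w))) (lookup h w)) \<in> carrier (free_alg {..<m})"
      by simp
  qed
  then show ?thesis
  proof (rule H.matsI)
    fix f g assume fg: "f \<in> basis r m" "g \<in> basis r m"
    have "b g f = (\<Sum>w\<in>Poly_Mapping.keys h. lookup h w * lookup (fold hop (letters w) (M f)) g)"
      using h(2)[OF fg(2,1)] by (simp add: act_def lookup_sum)
    also have "\<dots> = (\<Sum>w\<in>Poly_Mapping.keys h. lookup h w * lookup (fold hop (rev (letters w)) (M g)) f)"
      by (rule sum.cong) (use fold_hop_transpose[OF letters fg(2,1)] in auto)
    also have "\<dots> = lookup (act (fold hop) h' (M g)) f"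
      by (simp add: h'_def act_sum lookup_sum)
    finally show "b g f = lookup (act (fold hop) h' (M g)) f" .
  qed
qed

theorem theorem4p4:
  fixes r m :: nat
  assumes "r \<ge> 1" and "m \<ge> 1"
  shows "Phi r m \<in> ring_hom (U_alg r) (End_alg r m)
    \<and> Psi r m \<in> ring_hom (hecke_alg m) (opposite (End_alg r m))
    \<and> (\<forall>x\<in>U_jmath r. \<forall>h\<in>carrier (hecke_alg m). \<forall>v\<in>tensor_space r m.
         Psi r m h (Phi r m x v) = Phi r m x (Psi r m h v))
    \<and> Phi r m ` U_jmath r = carrier (End_over r m (Psi r m) (carrier (hecke_alg m)))
    \<and> carrier (opposite (End_over r m (Phi r m) (U_jmath r))) = Psi r m ` carrier (hecke_alg m)"
proof (intro conjI)
  show Phi: "Phi r m \<in> ring_hom (U_alg r) (End_alg r m)" by (rule Phi_hom)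
  show "Psi r m \<in> ring_hom (hecke_alg m) (opposite (End_alg r m))" by (rule Psi_hom)
  have hecke_carrier: "carrier (hecke_alg m) = cls {..<m} (hecke_rels m) ` carrier (free_alg {..<m})"
    by (simp add: hecke_alg_def H.presented_carrier)
  have Phi_End: "Phi r m x \<in> carrier (End_alg r m)" if "x \<in> U_jmath r" for x
    using ring_hom_closed[OF Phi] U_jmath_carrier that by blast
  have Phi_hop: "Phi r m x (hop i v) = hop i (Phi r m x v)"
    if x: "x \<in> U_jmath r" and i: "i < m" and v: "v \<in> tensor_space r m" for x i v
  proof -
    obtain a where a: "a \<in> jmath_lifts r" "x = U_cls r a" using x by (auto simp: U_jmath_eq)
    then have "a \<in> carrier (free_alg (U_gens r))" using jmath_lifts_closed(1) by blast
    then show ?thesis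
      using jmath_lift_commutes[OF a(1) i v] hop_closed[OF i v] v by (simp add: a(2) Phi_cls)
  qed
  have Phi_Psi: "Psi r m h (Phi r m x v) = Phi r m x (Psi r m h v)"
    if x: "x \<in> U_jmath r" and h: "h \<in> carrier (hecke_alg m)" and v: "v \<in> tensor_space r m" for x h v
  proof -
    obtain h' where h': "h' \<in> carrier (free_alg {..<m})" "h = cls {..<m} (hecke_rels m) h'"
      using h by (auto simp: hecke_carrier)
    have "Phi r m x v \<in> tensor_space r m" using Phi_End[OF x] v by (auto simp: End_alg_def)
    then show ?thesis
      using hop_commutes_act[OF Phi_End[OF x] Phi_hop[OF x] h'(1) v] v by (simp add: h' Psi_cls)
  qed
  then show "\<forall>x\<in>U_jmath r. \<forall>h\<in>carrier (hecke_alg m). \<forall>v\<in>tensor_space r m.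
      Psi r m h (Phi r m x v) = Phi r m x (Psi r m h v)" by blast
  show "Phi r m ` U_jmath r = carrier (End_over r m (Psi r m) (carrier (hecke_alg m)))"
  proof (intro equalityI subsetI)
    fix T assume "T \<in> Phi r m ` U_jmath r"
    then show "T \<in> carrier (End_over r m (Psi r m) (carrier (hecke_alg m)))"
      using Phi_End Phi_Psi by (auto simp: End_over_def)
  next
    fix T assume "T \<in> carrier (End_over r m (Psi r m) (carrier (hecke_alg m)))"
    then have T: "T \<in> carrier (End_alg r m)"
      and comm: "\<And>h v. h \<in> carrier (hecke_alg m) \<Longrightarrow> v \<in> tensor_space r m \<Longrightarrow> T (Psi r m h v) = Psi r m h (T v)"
      by (auto simp: End_over_def)
    have T_closed: "T v \<in> tensor_space r m" if "v \<in> tensor_space r m" for v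
      using T that by (auto simp: End_alg_def)
    have T_hop: "T (hop i v) = hop i (T v)" if "i < m" "v \<in> tensor_space r m" for i v
      using comm[of "cls {..<m} (hecke_rels m) (gen i)" v] that hop_eq_Psi[OF that(1) that(2)]
        hop_eq_Psi[OF that(1) T_closed[OF that(2)]]
      by (simp add: hecke_carrier free_alg_closed)
    obtain a where a: "a \<in> jmath_lifts r"
      "\<And>f g. f \<in> basis r m \<Longrightarrow> g \<in> basis r m \<Longrightarrow> lookup (T (M g)) f = lookup (act (foldr gop) a (M g)) f"
    proof (rule commutant_hop[OF assms(1), of m "\<lambda>f g. lookup (T (M g)) f"])
      fix i f g assume i: "i < m" and "f \<in> basis r m" and g: "g \<in> basis r m"
      show "mmul (basis r m) (\<lambda>f g. lookup (T (M g)) f) (hmat i) f g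
          = mmul (basis r m) (hmat i) (\<lambda>f g. lookup (T (M g)) f) f g"
        using mmul_End_act[OF T linop_hop hop_closed[OF i] g, of f] T_hop[OF i, of "M g"] g
        by (simp add: hmat_def[abs_def])
    qed blast
    have ac: "a \<in> carrier (free_alg (U_gens r))" using a(1) jmath_lifts_closed(1) by blast
    have "T = Phi r m (U_cls r a)"
      using U.End_eq_rep[OF T ac a(2)] by (simp add: Phi_cls[OF ac] Phi_free_act[OF ac])
    then show "T \<in> Phi r m ` U_jmath r" using a(1) by (auto simp: U_jmath_eq)
  qed
  have "carrier (opposite (End_over r m (Phi r m) (U_jmath r))) = carrier (End_over r m (Phi r m) (U_jmath r))"
    by (simp add: opposite_def)
  also have "\<dots> = Psi r m ` carrier (hecke_alg m)"
  proof (intro equalityI subsetI)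
    fix T assume "T \<in> Psi r m ` carrier (hecke_alg m)"
    then obtain h where h: "h \<in> carrier (free_alg {..<m})" "cls {..<m} (hecke_rels m) h \<in> carrier (hecke_alg m)"
      "T = Psi r m (cls {..<m} (hecke_rels m) h)"
      by (auto simp: hecke_carrier)
    then have "T \<in> carrier (End_alg r m)"
      using H.rep_closed[OF h(1), of r] by (simp add: Psi_cls Psi_free_act)
    then show "T \<in> carrier (End_over r m (Phi r m) (U_jmath r))"
      using Phi_Psi h(2,3) by (auto simp: End_over_def)
  next
    fix T assume "T \<in> carrier (End_over r m (Phi r m) (U_jmath r))"
    then have T: "T \<in> carrier (End_alg r m)"
      and comm: "\<And>x v. x \<in> U_jmath r \<Longrightarrow> v \<in> tensor_space r m \<Longrightarrow> T (Phi r m x v) = Phi r m x (T v)"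
      by (auto simp: End_over_def)
    have T_closed: "T v \<in> tensor_space r m" if "v \<in> tensor_space r m" for v
      using T that by (auto simp: End_alg_def)
    interpret B: matrix_algebra "Psi_mats r m" r m by (rule matrix_algebra_Psi)
    let ?t = "\<lambda>f g. lookup (T (M g)) f"
    \<comment> \<open>T lies in the bicommutant: a matrix commuting with the Hecke matrices comes
      from \<open>U_jmath\<close> by \<open>commutant_hop\<close>, and T commutes with everything
      from there.\<close>
    have "\<exists>b\<in>Psi_mats r m. \<forall>f\<in>basis r m. \<forall>g\<in>basis r m. b f g = ?t f g"
    proof (rule bicommutant)
      fix y f g
      assume y: "\<And>b f g. b \<in> Psi_mats r m \<Longrightarrow> f \<in> basis r m \<Longrightarrow> g \<in> basis r m \<Longrightarrow>
          mmul (basis r m) b y f g = mmul (basis r m) y b f g"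
        and fg: "f \<in> basis r m" "g \<in> basis r m"
      have hmat: "hmat i \<in> Psi_mats r m" if "i < m" for i
        by (rule H.matsI[of "gen i"]) (use that in \<open>auto simp: free_alg_closed hmat_def\<close>)
      obtain a where a: "a \<in> jmath_lifts r"
        "\<And>f g. f \<in> basis r m \<Longrightarrow> g \<in> basis r m \<Longrightarrow> y f g = lookup (act (foldr gop) a (M g)) f"
        by (rule commutant_hop[OF assms(1), of m y]) (use y hmat in auto)
      have ac: "a \<in> carrier (free_alg (U_gens r))" "U_cls r a \<in> U_jmath r"
        using a(1) by (auto simp: jmath_lifts_def)
      have "mmul (basis r m) ?t y f g = lookup (T (act (foldr gop) a (M g))) f"
        using mmul_End_act(1)[OF T U.linop_act U.act_closed[OF ac(1)] fg(2), of f] fg a(2)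
        by (simp add: mmul_def)
      also have "\<dots> = lookup (act (foldr gop) a (T (M g))) f"
        using comm[OF ac(2), of "M g"] T_closed[of "M g"] fg(2) by (simp add: Phi_cls[OF ac(1)])
      also have "\<dots> = mmul (basis r m) y ?t f g"
        using mmul_End_act(2)[OF T U.linop_act U.act_closed[OF ac(1)] fg(2), of f] fg a(2)
        by (simp add: mmul_def)
      finally show "mmul (basis r m) ?t y f g = mmul (basis r m) y ?t f g" .
    qed (auto intro: B.one B.add B.smult B.mult Psi_mats_transpose)
    then obtain h where h: "h \<in> carrier (free_alg {..<m})"
      "\<And>f g. f \<in> basis r m \<Longrightarrow> g \<in> basis r m \<Longrightarrow> lookup (T (M g)) f = lookup (act (fold hop) h (M g)) f"
      by (auto simp: H.mats_def)
    have "T = Psi r m (cls {..<m} (hecke_rels m) h)"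
      using H.End_eq_rep[OF T h] by (simp add: Psi_cls[OF h(1)] Psi_free_act[OF h(1)])
    then show "T \<in> Psi r m ` carrier (hecke_alg m)" using h(1) by (auto simp: hecke_carrier)
  qed
  finally show "carrier (opposite (End_over r m (Phi r m) (U_jmath r))) = Psi r m ` carrier (hecke_alg m)" .
qed

end
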